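(* Let $G$ be a Polish group and $H \leq G$ a closed subgroup. Then $H$ is amenable if and only if the affine $G$-flow $P(\mathrm{Sa}(G/H))$ is affine $G$-projective.
   Context: All topological spaces are Hausdorff. A $G$-flow is a (nonempty) compact Hausdorff space with a continuous left action of $G$; a $G$-map is a continuous $G$-equivariant map. For a compact space $X$, $P(X)$ is the space of regular Borel probability measures on $X$ with the weak$^*$ topology. An affine $G$-flow is a (nonempty) compact convex set $K$ (a compact convex subset of a Hausdorff locally convex topological vector space) with a continuous action of $G$ by affine homeomorphisms; if $X$ is a $G$-flow then $P(X)$ is an affine $G$-flow with the push-forward action. An affine $G$-map is a continuous affine $G$-equivariant map between affine $G$-flows; an affine extension is a surjective affine $G$-map. A flow $X$ of a topological group is proximal if for all $x,y\in X$ there is a net $(g_\lambda)$ in the group with $\lim g_\lambda x=\lim g_\lambda y$; it is strongly proximal if $P(X)$ is proximal. A topological group is amenable if every strongly proximal flow of it has a fixed point. An affine $G$-flow $K$ is affine $G$-projective if for all affine $G$-flows $L,Q$, every affine $G$-map $\phi\colon K\to L$ and every affine extension $\pi\colon Q\to L$, there is an affine $G$-map $\psi\colon K\to Q$ with $\pi\circ\psi=\phi$. For a closed subgroup $H\le G$, $\mathrm{Sa}(G/H)$ is the Samuel compactification of $G/H$: the Gelfand spectrum of the unital commutative $C^*$-algebra $\mathrm{RUC}^b(G/H)$ of bounded functions $f\colon G/H\to\mathbb{C}$ such that for every $\varepsilon>0$ there is an open neighbourhood $U$ of $1_G$ with $|f(ux)-f(x)|<\varepsilon$ for all $u\in U$,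 $x\in G/H$. It is a $G$-flow (with the action induced by translation) containing $G/H$ as a dense $G$-invariant subset, and if $X$ is a $G$-flow and $x\in X$ is fixed by $H$, there is a unique $G$-map $\mathrm{Sa}(G/H)\to X$ with $gH\mapsto gx$. *)

theory Defs
  imports "HOL-Probability.Probability_Measure" "HOL-Algebra.Group_Action" "HOL-Algebra.Left_Coset" "HOL-Library.Function_Algebras"
begin

section \<open>Hausdorff locally convex spaces\<close>

text \<open>
  The Hausdorff axiom is spelled out instead of inheriting from \<open>t2_space\<close>: \<open>HOL-Analysis\<close> already
  has the arity \<open>fun :: (countable, metric_space) metric_space\<close>, which excludes a general arity
  \<open>fun :: (type, t2_space) t2_space\<close> and hence the product instance below.
\<close>

class locally_convex_space = topological_ab_group_add + real_vector +
  assumes separated: "x \<noteq> y \<Longrightarrow> \<exists>U V. open U \<and> open V \<and> x \<in> U \<and> y \<in> V \<and> U \<inter> V = {}"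
    and tendsto_scaleR_Pair:
      "LIM x (nhds a \<times>\<^sub>F nhds b). fst x *\<^sub>R snd x :> nhds (a *\<^sub>R b)"
    and locally_convex_raw:
      "open U \<Longrightarrow> 0 \<in> U \<Longrightarrow> \<exists>V. open V \<and> 0 \<in> V \<and> V \<subseteq> U \<and>
        (\<forall>x\<in>V. \<forall>y\<in>V. \<forall>u\<ge>0. \<forall>v\<ge>0. u + v = 1 \<longrightarrow> u *\<^sub>R x + v *\<^sub>R y \<in> V)"

lemma locally_convex:
  fixes U :: "'a::locally_convex_space set"
  assumes "open U" "0 \<in> U"
  shows "\<exists>V. open V \<and> convex V \<and> 0 \<in> V \<and> V \<subseteq> U"
  using locally_convex_raw[OF assms] unfolding convex_def by blast

instance real_normed_vector \<subseteq> locally_convex_space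
proof
  fix x y :: 'a assume "x \<noteq> y"
  then show "\<exists>U V. open U \<and> open V \<and> x \<in> U \<and> y \<in> V \<and> U \<inter> V = {}"
    by (rule hausdorff)
next
  fix a :: real and b :: 'a
  show "LIM x (nhds a \<times>\<^sub>F nhds b). fst x *\<^sub>R snd x :> nhds (a *\<^sub>R b)"
    by (intro tendsto_scaleR filterlim_fst filterlim_snd)
next
  fix U :: "'a set" assume "open U" "0 \<in> U"
  then obtain e where "e > 0" "ball 0 e \<subseteq> U"
    by (meson open_contains_ball)
  moreover have "convex (ball (0::'a) e)" by simp
  ultimately show "\<exists>V. open V \<and> 0 \<in> V \<and> V \<subseteq> U \<and>
      (\<forall>x\<in>V. \<forall>y\<in>V. \<forall>u\<ge>0. \<forall>v\<ge>0. u + v = 1 \<longrightarrow> u *\<^sub>R x + v *\<^sub>R y \<in> V)"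
    unfolding convex_def by (intro exI[of _ "ball 0 e"]) simp
qed

text \<open>
  A function space \<open>'i \<Rightarrow> 'v\<close> carries the product topology of \<open>HOL-Analysis.Function_Topology\<close>
  and the pointwise vector space structure; with these it is again locally convex.
\<close>

instantiation "fun" :: (type, real_vector) real_vector
begin

definition scaleR_fun :: "real \<Rightarrow> ('a \<Rightarrow> 'b) \<Rightarrow> 'a \<Rightarrow> 'b"
  where "c *\<^sub>R f = (\<lambda>x. c *\<^sub>R f x)"

instance
  by standard (auto simp: scaleR_fun_def fun_eq_iff scaleR_add_right scaleR_add_left)

end

lemma scaleR_fun_apply [simp]: "(c *\<^sub>R f) x = c *\<^sub>R f x"
  by (simp add: scaleR_fun_def)

lemma tendsto_fun_iff:
  fixes f :: "'a \<Rightarrow> 'i \<Rightarrow> 'v::topological_space"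
  shows "(f \<longlongrightarrow> l) F \<longleftrightarrow> (\<forall>i. ((\<lambda>x. f x i) \<longlongrightarrow> l i) F)"
  using limitin_componentwise[of "\<lambda>_::'i. euclidean :: 'v topology" UNIV f l F]
  by (simp add: euclidean_product_topology)

instance "fun" :: (type, locally_convex_space) locally_convex_space
proof
  fix f g :: "'a \<Rightarrow> 'b" assume "f \<noteq> g"
  then obtain i where "f i \<noteq> g i" by (auto simp: fun_eq_iff)
  then obtain U V where UV: "open U" "open V" "f i \<in> U" "g i \<in> V" "U \<inter> V = {}"
    using separated[OF \<open>f i \<noteq> g i\<close>] by metis
  have "open {h :: 'a \<Rightarrow> 'b. h i \<in> W}" if "open W" for W
    using product_topology_basis'[of "{i}" "\<lambda>_. W" "\<lambda>i. i"] that by simp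
  with UV show "\<exists>U V. open U \<and> open V \<and> f \<in> U \<and> g \<in> V \<and> U \<inter> V = {}"
    by (intro exI[of _ "{h. h i \<in> U}"] exI[of _ "{h. h i \<in> V}"]) auto
next
  fix f g :: "'a \<Rightarrow> 'b" and c :: real
  have proj: "((\<lambda>h :: 'a \<Rightarrow> 'b. h i) \<longlongrightarrow> h i) (nhds h)" for h i
    using tendsto_fun_iff[of "\<lambda>x. x" h "nhds h"] by (simp add: filterlim_ident)
  have fst: "((\<lambda>x. fst x i) \<longlongrightarrow> f i) (nhds f \<times>\<^sub>F F)"
    and snd: "((\<lambda>x. snd x i) \<longlongrightarrow> g i) (F' \<times>\<^sub>F nhds g)" for i and F :: "'c filter" and F' :: "'d filter"
    by (rule filterlim_compose[OF proj filterlim_fst] filterlim_compose[OF proj filterlim_snd])+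
  show "LIM x (nhds f \<times>\<^sub>F nhds g). fst x + snd x :> nhds (f + g)"
    unfolding tendsto_fun_iff plus_fun_apply by (intro allI tendsto_add fst snd)
  show "(uminus \<longlongrightarrow> - f) (nhds f)"
    unfolding tendsto_fun_iff fun_Compl_def by (intro allI tendsto_minus proj)
  have "((\<lambda>x. fst x *\<^sub>R snd x i) \<longlongrightarrow> c *\<^sub>R g i) (nhds c \<times>\<^sub>F nhds g)" for i
    using filterlim_compose[OF tendsto_scaleR_Pair filterlim_Pair[OF filterlim_fst snd]] by simp
  then show "LIM x (nhds c \<times>\<^sub>F nhds g). fst x *\<^sub>R snd x :> nhds (c *\<^sub>R g)"
    unfolding tendsto_fun_iff by simp
next
  fix U :: "('a \<Rightarrow> 'b) set" assume U: "open U" "0 \<in> U"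
  then obtain X where X: "0 \<in> Pi\<^sub>E UNIV X" "\<And>i. open (X i)" "finite {i. X i \<noteq> UNIV}" "Pi\<^sub>E UNIV X \<subseteq> U"
    using product_topology_open_contains_basis[of "\<lambda>_. euclidean" UNIV U 0]
    unfolding open_fun_def by auto
  have "\<exists>V. open V \<and> convex V \<and> 0 \<in> V \<and> V \<subseteq> X i \<and> (X i = UNIV \<longrightarrow> V = UNIV)" for i
  proof (cases "X i = UNIV")
    case False
    have "0 \<in> X i" using X(1) by (auto simp: PiE_def Pi_def)
    with False show ?thesis using locally_convex[OF X(2)] by metis
  qed (auto intro!: exI[of _ UNIV])
  then obtain V where V: "\<And>i. open (V i)" "\<And>i. convex (V i)" "\<And>i. 0 \<in> V i" "\<And>i. V i \<subseteq> X i"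
      "\<And>i. X i = UNIV \<longrightarrow> V i = UNIV"
    by metis
  have "open (Pi\<^sub>E UNIV V)"
    by (rule open_PiE) (auto intro: V(1) finite_subset[OF _ X(3)] simp: V(5))
  moreover have "0 \<in> Pi\<^sub>E UNIV V" "Pi\<^sub>E UNIV V \<subseteq> U"
    using V(3,4) X(4) by (fastforce simp: PiE_def Pi_def)+
  moreover have "u *\<^sub>R x + v *\<^sub>R y \<in> Pi\<^sub>E UNIV V"
    if "x \<in> Pi\<^sub>E UNIV V" "y \<in> Pi\<^sub>E UNIV V" "u \<ge> 0" "v \<ge> 0" "u + v = 1" for x y u v
    using that convexD[OF V(2)] by (auto simp: PiE_def Pi_def)
  ultimately show "\<exists>V. open V \<and> 0 \<in> V \<and> V \<subseteq> U \<and>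
      (\<forall>x\<in>V. \<forall>y\<in>V. \<forall>u\<ge>0. \<forall>v\<ge>0. u + v = 1 \<longrightarrow> u *\<^sub>R x + v *\<^sub>R y \<in> V)"
    by (intro exI[of _ "Pi\<^sub>E UNIV V"]) auto
qed

section \<open>Topological groups and flows\<close>

locale topological_group = group G for G (structure) +
  fixes T :: "'a topology"
  assumes topspace_eq: "topspace T = carrier G"
    and Hausdorff: "Hausdorff_space T"
    and continuous_mult: "continuous_map (prod_topology T T) T (\<lambda>(x, y). x \<otimes> y)"
    and continuous_inv: "continuous_map T T (\<lambda>x. inv x)"

locale polish_group = topological_group +
  assumes separable: "separable_space T"
    and completely_metrizable: "completely_metrizable_space T"

text \<open>
  The library locale \<open>group_action\<close> makes every \<open>act g\<close> an extensional function on the space acted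
  upon; this is why the concrete actions below are written with a restricted abstraction.
\<close>

definition flow ::
    "('g, 'b) monoid_scheme \<Rightarrow> 'g topology \<Rightarrow> 'x topology \<Rightarrow> ('g \<Rightarrow> 'x \<Rightarrow> 'x) \<Rightarrow> bool" where
  "flow G T X act \<longleftrightarrow>
     topspace X \<noteq> {} \<and> compact_space X \<and> Hausdorff_space X \<and>
     group_action G (topspace X) act \<and>
     continuous_map (prod_topology T X) X (\<lambda>(g, x). act g x)"

text \<open>Nets in the group are rendered by proper filters on its carrier.\<close>

definition proximal ::
    "('g, 'b) monoid_scheme \<Rightarrow> 'x topology \<Rightarrow> ('g \<Rightarrow> 'x \<Rightarrow> 'x) \<Rightarrow> bool" where
  "proximal G X act \<longleftrightarrow>
     (\<forall>x\<in>topspace X. \<forall>y\<in>topspace X. \<exists>F z. F \<noteq> bot \<and> F \<le> principal (carrier G) \<and>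
        limitin X (\<lambda>g. act g x) z F \<and> limitin X (\<lambda>g. act g y) z F)"


section \<open>Regular Borel probability measures with the weak* topology\<close>

definition continuous_functions :: "'x topology \<Rightarrow> ('x \<Rightarrow> real) set" where
  "continuous_functions X = {f \<in> extensional (topspace X). continuous_map X euclideanreal f}"

definition regular_borel_probs :: "'x topology \<Rightarrow> 'x measure set" where
  "regular_borel_probs X = {\<mu>.
     space \<mu> = topspace X \<and> sets \<mu> = sigma_sets (topspace X) {U. openin X U} \<and> prob_space \<mu> \<and>
     (\<forall>A\<in>sets \<mu>. emeasure \<mu> A = (INF U\<in>{U. openin X U \<and> A \<subseteq> U}. emeasure \<mu> U)) \<and>
     (\<forall>A\<in>sets \<mu>. emeasure \<mu> A = (SUP C\<in>{C. compactin X C \<and> C \<subseteq> A}. emeasure \<mu> C))}"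

text \<open>
  A measure is identified with its integration functional on \<open>C(X)\<close>, extended by \<open>0\<close> to the remaining
  functions. For compact Hausdorff \<open>X\<close> this is injective on regular Borel measures, and the product
  topology on the functionals induces the weak* topology. Thus \<open>Prob X\<close> is a convex subset of the
  locally convex space \<open>('x \<Rightarrow> real) \<Rightarrow> real\<close>.
\<close>

definition integration_functional :: "'x topology \<Rightarrow> 'x measure \<Rightarrow> ('x \<Rightarrow> real) \<Rightarrow> real" where
  "integration_functional X \<mu> = (\<lambda>f. if f \<in> continuous_functions X then \<integral>x. f x \<partial>\<mu> else 0)"

definition Prob :: "'x topology \<Rightarrow> (('x \<Rightarrow> real) \<Rightarrow> real) set" where
  "Prob X = integration_functional X ` regular_borel_probs X"

text \<open>
  The push-forward action, through \<open>\<integral> f d(g\<mu>) = \<integral> f(gx) d\<mu>(x)\<close>; see \<open>Prob_action_distr\<close> below.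
\<close>

definition Prob_action ::
    "'x topology \<Rightarrow> ('g \<Rightarrow> 'x \<Rightarrow> 'x) \<Rightarrow> 'g \<Rightarrow> (('x \<Rightarrow> real) \<Rightarrow> real) \<Rightarrow> (('x \<Rightarrow> real) \<Rightarrow> real)" where
  "Prob_action X act = (\<lambda>g. \<lambda>\<Lambda>\<in>Prob X.
     (\<lambda>f. if f \<in> continuous_functions X then \<Lambda> (\<lambda>x\<in>topspace X. f (act g x)) else 0))"

lemma regular_borel_probsD:
  assumes "\<mu> \<in> regular_borel_probs X"
  shows "space \<mu> = topspace X" and "sets \<mu> = sigma_sets (topspace X) {U. openin X U}"
    and "prob_space \<mu>"
    and "A \<in> sets \<mu> \<Longrightarrow> emeasure \<mu> A = (INF U\<in>{U. openin X U \<and> A \<subseteq> U}. emeasure \<mu> U)"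
    and "A \<in> sets \<mu> \<Longrightarrow> emeasure \<mu> A = (SUP C\<in>{C. compactin X C \<and> C \<subseteq> A}. emeasure \<mu> C)"
  using assms unfolding regular_borel_probs_def by blast+

lemma flow_homeomorphic:
  assumes "topological_group G T" "flow G T X act" "g \<in> carrier G"
  shows "homeomorphic_map X X (act g)"
proof -
  interpret topological_group G T by fact
  interpret act: group_action G "topspace X" act using assms(2) by (simp add: flow_def)
  have cont: "continuous_map X X (act k)" if "k \<in> carrier G" for k
  proof -
    have "continuous_map X (prod_topology T X) (\<lambda>x. (k, x))"
      using that by (intro continuous_map_pairedI) (auto simp: topspace_eq)
    then have "continuous_map X X ((\<lambda>(g, x). act g x) \<circ> (\<lambda>x. (k, x)))"
      using assms(2) by (intro continuous_map_compose) (auto simp: flow_def)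
    then show ?thesis by (simp add: comp_def)
  qed
  have "homeomorphic_maps X X (act g) (act (inv\<^bsub>G\<^esub> g))"
    unfolding homeomorphic_maps_def
  proof (intro conjI ballI)
    show "continuous_map X X (act g)" "continuous_map X X (act (inv\<^bsub>G\<^esub> g))"
      using cont assms(3) by simp_all
    fix x assume x: "x \<in> topspace X"
    show "act (inv\<^bsub>G\<^esub> g) (act g x) = x"
      using act.orbit_sym_aux[OF assms(3) x] by blast
    have "act (inv\<^bsub>G\<^esub> (inv\<^bsub>G\<^esub> g)) (act (inv\<^bsub>G\<^esub> g) x) = x"
      using act.orbit_sym_aux[OF inv_closed[OF assms(3)] x] by blast
    then show "act g (act (inv\<^bsub>G\<^esub> g) x) = x" using assms(3) by simp
  qed
  then show ?thesis using homeomorphic_map_maps by blast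
qed

lemma act_measurable:
  assumes "topological_group G T" "flow G T X act" "g \<in> carrier G" "\<mu> \<in> regular_borel_probs X"
  shows "act g \<in> measurable \<mu> \<mu>"
proof -
  have hom: "homeomorphic_map X X (act g)" by (rule flow_homeomorphic[OF assms(1-3)])
  have mu: "space \<mu> = topspace X" "sets \<mu> = sigma_sets (topspace X) {U. openin X U}"
    by (rule regular_borel_probsD[OF assms(4)])+
  show ?thesis
  proof (rule measurable_sigma_sets[OF mu(2)])
    show "{U. openin X U} \<subseteq> Pow (topspace X)" by (auto dest: openin_subset)
    show "act g \<in> space \<mu> \<rightarrow> topspace X"
      unfolding mu(1) by (rule continuous_map_funspace[OF homeomorphic_imp_continuous_map[OF hom]])
    fix U assume "U \<in> {U. openin X U}"
    then have "openin X {x \<in> topspace X. act g x \<in> U}"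
      by (intro openin_continuous_map_preimage[OF homeomorphic_imp_continuous_map[OF hom]]) simp
    then show "act g -` U \<inter> space \<mu> \<in> sets \<mu>"
      unfolding mu by (intro sigma_sets.Basic) (simp add: vimage_def Int_def conj_commute)
  qed
qed

lemma distr_regular:
  assumes "topological_group G T" "flow G T X act" "g \<in> carrier G" "\<mu> \<in> regular_borel_probs X"
  shows "distr \<mu> \<mu> (act g) \<in> regular_borel_probs X"
proof -
  let ?h = "act g" and ?p = "\<lambda>A. act g -` A \<inter> topspace X"
  have hom: "homeomorphic_map X X ?h" by (rule flow_homeomorphic[OF assms(1-3)])
  have mu: "space \<mu> = topspace X" "sets \<mu> = sigma_sets (topspace X) {U. openin X U}" "prob_space \<mu>"
    and outer: "\<And>A. A \<in> sets \<mu> \<Longrightarrow> emeasure \<mu> A = (INF U\<in>{U. openin X U \<and> A \<subseteq> U}. emeasure \<mu> U)"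
    and inner: "\<And>A. A \<in> sets \<mu> \<Longrightarrow> emeasure \<mu> A = (SUP C\<in>{C. compactin X C \<and> C \<subseteq> A}. emeasure \<mu> C)"
    by (rule regular_borel_probsD[OF assms(4)]; assumption)+
  have meas: "?h \<in> measurable \<mu> \<mu>" by (rule act_measurable[OF assms])
  have H: "Hausdorff_space X" using assms(2) by (simp add: flow_def)
  obtain k where k: "homeomorphic_maps X X ?h k" using hom homeomorphic_map_maps by blast
  then have hk: "continuous_map X X ?h" "continuous_map X X k"
      "\<And>x. x \<in> topspace X \<Longrightarrow> k (?h x) = x" "\<And>x. x \<in> topspace X \<Longrightarrow> ?h (k x) = x"
    by (simp_all add: homeomorphic_maps_def)
  have hk_in: "?h x \<in> topspace X" "k x \<in> topspace X" if "x \<in> topspace X" for x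
    using hk(1,2) that by (auto dest: continuous_map_funspace)
  have p_img: "?p (?h ` B) = B" if "B \<subseteq> topspace X" for B
  proof (intro equalityI subsetI)
    fix x assume "x \<in> ?p (?h ` B)"
    then obtain y where "y \<in> B" "?h x = ?h y" "x \<in> topspace X" by blast
    then show "x \<in> B" using hk(3)[of x] hk(3)[of y] that by auto
  qed (use that in blast)
  have p_eq: "?p B = k ` B" if "B \<subseteq> topspace X" for B
  proof (intro equalityI subsetI)
    fix x assume "x \<in> ?p B"
    then show "x \<in> k ` B" using hk(3)[of x] by (intro image_eqI[of _ _ "?h x"]) auto
  next
    fix x assume "x \<in> k ` B"
    then show "x \<in> ?p B" using hk(4) hk_in(2) that by auto
  qed
  have img_p: "?h ` ?p B = B" if "B \<subseteq> topspace X" for B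
    unfolding p_eq[OF that] image_image using hk(4) that by (simp add: subset_iff)
  have sub: "A \<subseteq> topspace X" if "A \<in> sets \<mu>" for A
    using sets.sets_into_space[OF that] mu(1) by simp
  have op: "openin X (?p U)" "openin X (?h ` U)" if "openin X U" for U
  proof -
    have "openin X {x \<in> topspace X. ?h x \<in> U}"
      using hk(1) that by (rule openin_continuous_map_preimage)
    then show "openin X (?p U)" by (simp add: vimage_def Int_def conj_commute)
    show "openin X (?h ` U)"
      using homeomorphic_imp_open_map[OF hom] that by (simp add: open_map_def)
  qed
  have co: "compactin X (?h ` C)" if "compactin X C" for C
    using that hk(1) by (rule image_compactin)
  have op_sets: "openin X U \<Longrightarrow> U \<in> sets \<mu>" for U by (simp add: mu(2) sigma_sets.Basic)
  have co_sets: "C \<in> sets \<mu>" if "compactin X C" for C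
  proof -
    have "closedin X C" using H that by (rule compactin_imp_closedin)
    then have "openin X (topspace X - C)" "C = space \<mu> - (topspace X - C)"
      by (auto simp: closedin_def mu)
    then show ?thesis using sets.compl_sets[OF op_sets] by metis
  qed
  have em: "emeasure (distr \<mu> \<mu> ?h) A = emeasure \<mu> (?p A)" if "A \<in> sets \<mu>" for A
    using emeasure_distr[OF meas that] by (simp add: mu(1))
  have p_sets: "?p A \<in> sets \<mu>" if "A \<in> sets \<mu>" for A
    using measurable_sets[OF meas that] by (simp add: mu(1))
  have co_p: "compactin X (?p C)" if "compactin X C" for C
    unfolding p_eq[OF compactin_subset_topspace[OF that]] using that hk(2) by (rule image_compactin)
  have "emeasure (distr \<mu> \<mu> ?h) A = (INF U\<in>{U. openin X U \<and> A \<subseteq> U}. emeasure (distr \<mu> \<mu> ?h) U)"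
    if A: "A \<in> sets \<mu>" for A
  proof -
    have "{U. openin X U \<and> ?p A \<subseteq> U} = ?p ` {U. openin X U \<and> A \<subseteq> U}" (is "?L = ?R")
    proof
      show "?L \<subseteq> ?R"
      proof
        fix U assume "U \<in> ?L"
        then have U: "openin X U" "?p A \<subseteq> U" by auto
        have "A \<subseteq> ?h ` U" using image_mono[OF U(2), of ?h] unfolding img_p[OF sub[OF A]] .
        moreover have "U = ?p (?h ` U)" using p_img[OF openin_subset[OF U(1)]] by (rule sym)
        moreover note op(2)[OF U(1)]
        ultimately show "U \<in> ?R" by blast
      qed
    next
      show "?R \<subseteq> ?L" using op(1) by blast
    qed
    then show ?thesis
      by (simp only: em[OF A] outer[OF p_sets[OF A]] image_image)
         (rule INF_cong, simp_all only: em op_sets mem_Collect_eq)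
  qed
  moreover have "emeasure (distr \<mu> \<mu> ?h) A = (SUP C\<in>{C. compactin X C \<and> C \<subseteq> A}. emeasure (distr \<mu> \<mu> ?h) C)"
    if A: "A \<in> sets \<mu>" for A
  proof -
    have "{C. compactin X C \<and> C \<subseteq> ?p A} = ?p ` {C. compactin X C \<and> C \<subseteq> A}" (is "?L = ?R")
    proof
      show "?L \<subseteq> ?R"
      proof
        fix C assume "C \<in> ?L"
        then have C: "compactin X C" "C \<subseteq> ?p A" by auto
        have "?h ` C \<subseteq> A" using C(2) by blast
        moreover have "C = ?p (?h ` C)" using p_img[OF compactin_subset_topspace[OF C(1)]] by (rule sym)
        moreover note co[OF C(1)]
        ultimately show "C \<in> ?R" by blast
      qed
    next
      show "?R \<subseteq> ?L" using co_p by blast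
    qed
    then show ?thesis
      by (simp only: em[OF A] inner[OF p_sets[OF A]] image_image)
         (rule SUP_cong, simp_all only: em co_sets mem_Collect_eq)
  qed
  ultimately show ?thesis
    using mu(1,2) prob_space.prob_space_distr[OF mu(3) meas]
    unfolding regular_borel_probs_def mem_Collect_eq space_distr sets_distr by blast
qed

lemma Prob_action_distr:
  assumes "topological_group G T" "flow G T X act" "g \<in> carrier G" "\<mu> \<in> regular_borel_probs X"
  shows "Prob_action X act g (integration_functional X \<mu>) =
           integration_functional X (distr \<mu> \<mu> (act g))"
proof
  fix f
  have mu: "space \<mu> = topspace X" "sets \<mu> = sigma_sets (topspace X) {U. openin X U}"
    by (rule regular_borel_probsD[OF assms(4)])+
  note meas = act_measurable[OF assms]
  have hom: "homeomorphic_map X X (act g)" by (rule flow_homeomorphic[OF assms(1-3)])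
  have in_Prob: "integration_functional X \<mu> \<in> Prob X" using assms(4) by (simp add: Prob_def)
  show "Prob_action X act g (integration_functional X \<mu>) f =
           integration_functional X (distr \<mu> \<mu> (act g)) f"
  proof (cases "f \<in> continuous_functions X")
    case True
    then have f: "continuous_map X euclideanreal f" by (simp add: continuous_functions_def)
    have "continuous_map X euclideanreal (f \<circ> act g)"
      using f homeomorphic_imp_continuous_map[OF hom] continuous_map_compose by blast
    then have "(\<lambda>x\<in>topspace X. f (act g x)) \<in> continuous_functions X"
      by (auto simp: continuous_functions_def comp_def elim: continuous_map_eq)
    moreover have "f \<in> borel_measurable \<mu>"
    proof (rule borel_measurableI)
      fix S :: "real set" assume "open S"
      then have "openin X {x \<in> topspace X. f x \<in> S}"
        using openin_continuous_map_preimage[OF f] by simp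
      then show "f -` S \<inter> space \<mu> \<in> sets \<mu>"
        unfolding mu by (intro sigma_sets.Basic) (simp add: vimage_def Int_def conj_commute)
    qed
    ultimately show ?thesis
      using True in_Prob integral_distr[OF meas, of f]
      by (auto simp: Prob_action_def integration_functional_def mu(1) intro!: Bochner_Integration.integral_cong)
  qed (use in_Prob in \<open>simp add: Prob_action_def integration_functional_def\<close>)
qed

definition strongly_proximal ::
    "('g, 'b) monoid_scheme \<Rightarrow> 'x topology \<Rightarrow> ('g \<Rightarrow> 'x \<Rightarrow> 'x) \<Rightarrow> bool" where
  "strongly_proximal G X act \<longleftrightarrow> proximal G (top_of_set (Prob X)) (Prob_action X act)"

text \<open>
  HOL cannot quantify over types inside a formula, so the type from which the flows are taken is a
  parameter, here and in the definition of projectivity. A statement using these notions has to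
  choose types large enough for the parameter to be immaterial.
\<close>

definition amenable ::
    "'x itself \<Rightarrow> ('g, 'b) monoid_scheme \<Rightarrow> 'g topology \<Rightarrow> bool" where
  "amenable _ G T \<longleftrightarrow>
     (\<forall>(X :: 'x topology) act. flow G T X act \<and> strongly_proximal G X act \<longrightarrow>
        (\<exists>x\<in>topspace X. \<forall>g\<in>carrier G. act g x = x))"


section \<open>Affine flows\<close>

definition affine_on :: "'v::real_vector set \<Rightarrow> ('v \<Rightarrow> 'w::real_vector) \<Rightarrow> bool" where
  "affine_on K f \<longleftrightarrow>
     (\<forall>x\<in>K. \<forall>y\<in>K. \<forall>t\<in>{0..1}. f ((1 - t) *\<^sub>R x + t *\<^sub>R y) = (1 - t) *\<^sub>R f x + t *\<^sub>R f y)"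

definition affine_flow ::
    "('g, 'b) monoid_scheme \<Rightarrow> 'g topology \<Rightarrow> 'v::locally_convex_space set \<Rightarrow> ('g \<Rightarrow> 'v \<Rightarrow> 'v) \<Rightarrow> bool"
  where
  "affine_flow G T K act \<longleftrightarrow>
     convex K \<and> flow G T (top_of_set K) act \<and> (\<forall>g\<in>carrier G. affine_on K (act g))"

definition affine_gmap ::
    "('g, 'b) monoid_scheme \<Rightarrow> 'v::locally_convex_space set \<Rightarrow> ('g \<Rightarrow> 'v \<Rightarrow> 'v) \<Rightarrow>
     'w::locally_convex_space set \<Rightarrow> ('g \<Rightarrow> 'w \<Rightarrow> 'w) \<Rightarrow> ('v \<Rightarrow> 'w) \<Rightarrow> bool" where
  "affine_gmap G K a L b \<phi> \<longleftrightarrow>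
     \<phi> ` K \<subseteq> L \<and> continuous_on K \<phi> \<and> affine_on K \<phi> \<and>
     (\<forall>g\<in>carrier G. \<forall>x\<in>K. \<phi> (a g x) = b g (\<phi> x))"

definition affine_extension ::
    "('g, 'b) monoid_scheme \<Rightarrow> 'v::locally_convex_space set \<Rightarrow> ('g \<Rightarrow> 'v \<Rightarrow> 'v) \<Rightarrow>
     'w::locally_convex_space set \<Rightarrow> ('g \<Rightarrow> 'w \<Rightarrow> 'w) \<Rightarrow> ('v \<Rightarrow> 'w) \<Rightarrow> bool" where
  "affine_extension G Q c L b \<pi> \<longleftrightarrow> affine_gmap G Q c L b \<pi> \<and> \<pi> ` Q = L"

definition affine_projective ::
    "'l::locally_convex_space itself \<Rightarrow> 'q::locally_convex_space itself \<Rightarrow>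
     ('g, 'b) monoid_scheme \<Rightarrow> 'g topology \<Rightarrow> 'v::locally_convex_space set \<Rightarrow> ('g \<Rightarrow> 'v \<Rightarrow> 'v) \<Rightarrow> bool"
  where
  "affine_projective _ _ G T K a \<longleftrightarrow>
     affine_flow G T K a \<and>
     (\<forall>(L :: 'l set) b (Q :: 'q set) c \<phi> \<pi>.
        affine_flow G T L b \<and> affine_flow G T Q c \<and>
        affine_gmap G K a L b \<phi> \<and> affine_extension G Q c L b \<pi> \<longrightarrow>
        (\<exists>\<psi>. affine_gmap G K a Q c \<psi> \<and> (\<forall>x\<in>K. \<pi> (\<psi> x) = \<phi> x)))"


section \<open>The Samuel compactification of a coset space\<close>

text \<open>
  Functions on \<open>G/H\<close>, and functionals on an algebra of such functions, are total functions in HOL;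
  being extensional makes them honest functions on the intended domain.
\<close>

definition RUC ::
    "('g, 'b) monoid_scheme \<Rightarrow> 'g topology \<Rightarrow> 'g set \<Rightarrow> ('g set \<Rightarrow> complex) set" where
  "RUC G T H = {f \<in> extensional (lcosets\<^bsub>G\<^esub> H).
     bounded (f ` (lcosets\<^bsub>G\<^esub> H)) \<and>
     (\<forall>\<epsilon>>0. \<exists>U. openin T U \<and> \<one>\<^bsub>G\<^esub> \<in> U \<and>
        (\<forall>u\<in>U. \<forall>x\<in>lcosets\<^bsub>G\<^esub> H. cmod (f (u <#\<^bsub>G\<^esub> x) - f x) < \<epsilon>))}"

definition gelfand_spectrum ::
    "'s set \<Rightarrow> ('s \<Rightarrow> complex) set \<Rightarrow> (('s \<Rightarrow> complex) \<Rightarrow> complex) topology" where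
  "gelfand_spectrum S A =
     subtopology (product_topology (\<lambda>_. euclidean) A)
       {\<omega> \<in> extensional A.
          \<omega> (\<lambda>x\<in>S. 1) = 1 \<and>
          (\<forall>c. \<forall>f\<in>A. \<omega> (\<lambda>x\<in>S. c * f x) = c * \<omega> f) \<and>
          (\<forall>f\<in>A. \<forall>h\<in>A. \<omega> (\<lambda>x\<in>S. f x + h x) = \<omega> f + \<omega> h \<and>
                       \<omega> (\<lambda>x\<in>S. f x * h x) = \<omega> f * \<omega> h)}"

type_synonym 'g sa_point = "('g set \<Rightarrow> complex) \<Rightarrow> complex"
type_synonym 'g sa_functional = "('g sa_point \<Rightarrow> real) \<Rightarrow> real"

definition Sa ::
    "('g, 'b) monoid_scheme \<Rightarrow> 'g topology \<Rightarrow> 'g set \<Rightarrow> 'g sa_point topology" where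
  "Sa G T H = gelfand_spectrum (lcosets\<^bsub>G\<^esub> H) (RUC G T H)"

text \<open>
  \<open>(g\<omega>)(f) = \<omega>(x \<mapsto> f(gx))\<close>, so that the evaluation at \<open>x \<in> G/H\<close> is sent to the evaluation at \<open>gx\<close>.
\<close>

definition Sa_action ::
    "('g, 'b) monoid_scheme \<Rightarrow> 'g topology \<Rightarrow> 'g set \<Rightarrow> 'g \<Rightarrow> 'g sa_point \<Rightarrow> 'g sa_point" where
  "Sa_action G T H = (\<lambda>g. \<lambda>\<omega>\<in>topspace (Sa G T H). \<lambda>f\<in>RUC G T H.
     \<omega> (\<lambda>x\<in>lcosets\<^bsub>G\<^esub> H. f (g <#\<^bsub>G\<^esub> x)))"


text \<open>
  The types of \<open>Sa(G/H)\<close> and of \<open>P(Sa(G/H))\<close> do not depend on \<open>H\<close>, so \<open>'g sa_point\<close> also contains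
  the greatest ambit \<open>Sa(G) = Sa(G/1)\<close>, as well as that of every subgroup of \<open>G\<close>. In particular every
  minimal flow of a subgroup, being a quotient of the greatest ambit, has a copy on this type;
  similarly \<open>'g sa_functional\<close> contains the affine flow \<open>P(Sa(G))\<close>.
\<close>

end

theory Submission
  imports Defs
begin

text \<open>
  Write \<open>e\<close> for the coset \<open>H\<close>, a point of \<open>Sa(G/H)\<close> fixed by \<open>H\<close>. A \<open>G\<close>-map from \<open>Sa(G/H)\<close> to a compact space is
  the same as a point fixed by \<open>H\<close>, and an affine map on a space of measures is determined by its
  values at point masses. So lifting an affine \<open>G\<close>-map from \<open>P(Sa(G/H))\<close> through an affine extension
  \<open>\<pi>\<close> means finding a point fixed by \<open>H\<close> in the fibre of \<open>\<pi>\<close> over the image of the point mass at \<open>e\<close>.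

  Let \<open>H\<close> be amenable. The fibre is an affine flow of \<open>H\<close>, and an amenable group fixes a point in each
  of its affine flows \<open>K\<close> (\<open>amenable_imp_affine_fixed_point\<close>): pass to an irreducible affine subflow and
  to the closure of the orbit of one of its extreme points. This is a strongly proximal flow
  (\<open>strongly_proximal_Y\<close>): by irreducibility the closed convex hull of the orbit of any measure on it contains
  a measure whose barycenter is the extreme point, and by Bauer's theorem that measure is a point mass. A fixed point in the
  fibre yields the lift by taking barycenters (\<open>amenable_imp_affine_projective\<close>).

  Conversely, lift the identity of \<open>P(Sa(G/H))\<close> to \<open>P(Sa(G))\<close>. The image of the point mass at \<open>e\<close> is an
  \<open>H\<close>-invariant mean on the bounded uniformly continuous functions on \<open>G\<close>, and it is concentrated on \<open>H\<close>,
  because it lies over the point mass at \<open>e\<close>. Every orbit function on \<open>H\<close> of a flow \<open>X\<close> of \<open>H\<close> extends to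
  such a function on \<open>G\<close> (\<open>ruc_extension\<close>), and the mean of the extension depends on the orbit function
  only (\<open>localized_mean_null\<close>); both facts rest on length functions on \<open>G\<close>
  (\<open>length_function_exists\<close>). This gives an invariant measure on \<open>X\<close>, and when \<open>X\<close> is strongly proximal an
  invariant measure is a fixed point (\<open>strongly_proximal_fixed_point\<close>).

  Both implications hold for flows on arbitrary types. Towards amenability, the mean integrates
  functions on any flow of \<open>H\<close>. Towards projectivity, the strongly proximal flow extracted from an
  affine flow has a dense orbit, and compact spaces with a dense orbit inject into the type of points
  of the Samuel compactification (\<open>injection_of_transitive_space\<close>). The remaining two clauses follow by going
  back and forth between the two properties.

  The spaces of measures are handled as spaces of states, that is, positive normalized functionals,
  by the Riesz representation theorem (\<open>Prob_eq_states\<close>). Barycenters are characterized by the affine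
  functions on a compact convex set, which separate its points by the Hahn-Banach theorem.
\<close>

section \<open>States on the continuous functions of a compact space\<close>

abbreviation cont :: "'x topology \<Rightarrow> ('x \<Rightarrow> real) \<Rightarrow> bool" where
  "cont X f \<equiv> continuous_map X euclideanreal f"

text \<open>
  The elements of \<open>continuous_functions X\<close> are extensional, so a functional on them is applied to an
  arbitrary function through its restriction. This keeps the algebra below free of restrictions.
\<close>

definition integ :: "'x topology \<Rightarrow> (('x \<Rightarrow> real) \<Rightarrow> real) \<Rightarrow> ('x \<Rightarrow> real) \<Rightarrow> real" where
  "integ X \<Lambda> f = \<Lambda> (restrict f (topspace X))"

text \<open>
  The value \<open>0\<close> off the continuous functions is the convention of \<open>integration_functional\<close>. It makes
  a state determined by its integrals, and it is what allows \<open>Prob X\<close> to be compared with \<open>states X\<close>.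
\<close>

definition states :: "'x topology \<Rightarrow> (('x \<Rightarrow> real) \<Rightarrow> real) set" where
  "states X = {\<Lambda>. (\<forall>f. f \<notin> continuous_functions X \<longrightarrow> \<Lambda> f = 0) \<and> integ X \<Lambda> (\<lambda>_. 1) = 1 \<and>
     (\<forall>f g. cont X f \<longrightarrow> cont X g \<longrightarrow> integ X \<Lambda> (\<lambda>x. f x + g x) = integ X \<Lambda> f + integ X \<Lambda> g) \<and>
     (\<forall>c f. cont X f \<longrightarrow> integ X \<Lambda> (\<lambda>x. c * f x) = c * integ X \<Lambda> f) \<and>
     (\<forall>f. cont X f \<longrightarrow> (\<forall>x\<in>topspace X. 0 \<le> f x) \<longrightarrow> 0 \<le> integ X \<Lambda> f)}"

lemma cont_restrict [simp]: "cont X (restrict f (topspace X)) \<longleftrightarrow> cont X f"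
  by (metis (mono_tags, lifting) continuous_map_eq restrict_apply')

lemma restrict_in_continuous_functions [simp]:
  "restrict f (topspace X) \<in> continuous_functions X \<longleftrightarrow> cont X f"
  by (simp add: continuous_functions_def)

lemma integ_cong:
  assumes "\<And>x. x \<in> topspace X \<Longrightarrow> f x = g x"
  shows "integ X \<Lambda> f = integ X \<Lambda> g"
proof -
  have "restrict f (topspace X) = restrict g (topspace X)" using assms by (rule restrict_ext)
  then show ?thesis by (simp add: integ_def)
qed

lemma integ_add:
  "\<lbrakk>\<Lambda> \<in> states X; cont X f; cont X g\<rbrakk> \<Longrightarrow> integ X \<Lambda> (\<lambda>x. f x + g x) = integ X \<Lambda> f + integ X \<Lambda> g"
  by (simp add: states_def)

lemma integ_scale: "\<lbrakk>\<Lambda> \<in> states X; cont X f\<rbrakk> \<Longrightarrow> integ X \<Lambda> (\<lambda>x. c * f x) = c * integ X \<Lambda> f"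
  by (simp add: states_def)

lemma integ_nonneg:
  "\<lbrakk>\<Lambda> \<in> states X; cont X f; \<And>x. x \<in> topspace X \<Longrightarrow> 0 \<le> f x\<rbrakk> \<Longrightarrow> 0 \<le> integ X \<Lambda> f"
  by (simp add: states_def)

lemma integ_const: "\<Lambda> \<in> states X \<Longrightarrow> integ X \<Lambda> (\<lambda>_. c) = c"
  using integ_scale[of \<Lambda> X "\<lambda>_. 1" c] by (simp add: states_def)

lemma integ_diff:
  assumes "\<Lambda> \<in> states X" "cont X f" "cont X g"
  shows "integ X \<Lambda> (\<lambda>x. f x - g x) = integ X \<Lambda> f - integ X \<Lambda> g"
  using integ_add[OF assms(1,2), of "\<lambda>x. -1 * g x"] integ_scale[OF assms(1,3), of "-1"] assms
  by (simp add: continuous_intros)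

lemma integ_sum:
  assumes "\<Lambda> \<in> states X" "finite I" "\<And>i. i \<in> I \<Longrightarrow> cont X (f i)"
  shows "integ X \<Lambda> (\<lambda>x. \<Sum>i\<in>I. f i x) = (\<Sum>i\<in>I. integ X \<Lambda> (f i))"
  using assms(2,3)
proof (induction I rule: finite_induct)
  case empty
  then show ?case by (simp add: integ_const[OF assms(1)])
next
  case (insert i I)
  have "integ X \<Lambda> (\<lambda>x. f i x + (\<Sum>i\<in>I. f i x)) = integ X \<Lambda> (f i) + integ X \<Lambda> (\<lambda>x. \<Sum>i\<in>I. f i x)"
    using insert by (intro integ_add[OF assms(1)] continuous_intros) auto
  then show ?case using insert by simp
qed

lemma integ_mono:
  assumes "\<Lambda> \<in> states X" "cont X f" "cont X g" "\<And>x. x \<in> topspace X \<Longrightarrow> f x \<le> g x"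
  shows "integ X \<Lambda> f \<le> integ X \<Lambda> g"
  using integ_nonneg[OF assms(1), of "\<lambda>x. g x - f x"] integ_diff[OF assms(1,3,2)] assms
  by (simp add: continuous_intros)

lemma integ_uniform_bound:
  assumes "\<Lambda> \<in> states X" "cont X f" "cont X g" "\<And>x. x \<in> topspace X \<Longrightarrow> \<bar>f x - g x\<bar> \<le> c"
  shows "\<bar>integ X \<Lambda> f - integ X \<Lambda> g\<bar> \<le> c"
proof -
  have "integ X \<Lambda> (\<lambda>x. f x - g x) \<le> integ X \<Lambda> (\<lambda>_. c)"
    using assms abs_le_D1 by (intro integ_mono[OF assms(1)] continuous_intros) fastforce+
  moreover have "integ X \<Lambda> (\<lambda>_. - c) \<le> integ X \<Lambda> (\<lambda>x. f x - g x)"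
    using assms abs_le_D2 by (intro integ_mono[OF assms(1)] continuous_intros) fastforce+
  ultimately show ?thesis
    unfolding integ_const[OF assms(1)] integ_diff[OF assms(1,2,3)] by linarith
qed

lemma integ_abs_bound:
  assumes "\<Lambda> \<in> states X" "cont X f" "\<And>x. x \<in> topspace X \<Longrightarrow> \<bar>f x\<bar> \<le> c"
  shows "\<bar>integ X \<Lambda> f\<bar> \<le> c"
  using integ_uniform_bound[OF assms(1,2), of "\<lambda>_. 0" c] assms(3) by (simp add: integ_const[OF assms(1)])

lemma states_eqI:
  assumes "\<Lambda> \<in> states X" "\<Lambda>' \<in> states X" "\<And>f. cont X f \<Longrightarrow> integ X \<Lambda> f = integ X \<Lambda>' f"
  shows "\<Lambda> = \<Lambda>'"
proof
  fix f
  show "\<Lambda> f = \<Lambda>' f"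
  proof (cases "f \<in> continuous_functions X")
    case True
    then have "cont X f" "restrict f (topspace X) = f"
      by (auto simp: continuous_functions_def extensional_restrict)
    then show ?thesis using assms(3)[of f] by (simp add: integ_def)
  qed (use assms in \<open>auto simp: states_def\<close>)
qed

lemma cont_bounded:
  assumes "compact_space X" "cont X f"
  obtains B where "B > 0" "\<And>x. x \<in> topspace X \<Longrightarrow> \<bar>f x\<bar> \<le> B"
proof -
  have "compactin euclideanreal (f ` topspace X)"
    using assms image_compactin compact_space_def by blast
  then have "bounded (f ` topspace X)" by (simp add: compact_imp_bounded)
  then obtain B where "\<forall>y\<in>f ` topspace X. norm y \<le> B" unfolding bounded_iff by blast
  then have "\<bar>f x\<bar> \<le> max B 1" if "x \<in> topspace X" for x using that by fastforce
  then show ?thesis using that[of "max B 1"] by simp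
qed

section \<open>Riesz representation\<close>

lemma borel_measurable_cont:
  assumes "space \<mu> = topspace X" "sets \<mu> = sigma_sets (topspace X) {U. openin X U}" "cont X f"
  shows "f \<in> borel_measurable \<mu>"
proof (rule borel_measurableI)
  fix S :: "real set" assume "open S"
  then have "openin X {x \<in> topspace X. f x \<in> S}"
    using openin_continuous_map_preimage[OF assms(3)] by simp
  then show "f -` S \<inter> space \<mu> \<in> sets \<mu>"
    unfolding assms(1,2) by (intro sigma_sets.Basic) (simp add: vimage_def Int_def conj_commute)
qed

lemma integrable_cont:
  assumes "compact_space X" "space \<mu> = topspace X"
    "sets \<mu> = sigma_sets (topspace X) {U. openin X U}" "prob_space \<mu>" "cont X f"
  shows "integrable \<mu> f"
proof -
  interpret prob_space \<mu> by fact
  obtain B where "\<And>x. x \<in> topspace X \<Longrightarrow> \<bar>f x\<bar> \<le> B" using cont_bounded[OF assms(1,5)] by blast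
  then show ?thesis
    using borel_measurable_cont[OF assms(2,3,5)] assms(2)
    by (intro integrable_const_bound[of _ B]) auto
qed

lemma integration_functional_in_states:
  assumes "compact_space X" "space \<mu> = topspace X"
    "sets \<mu> = sigma_sets (topspace X) {U. openin X U}" "prob_space \<mu>"
  shows "integration_functional X \<mu> \<in> states X"
proof -
  interpret prob_space \<mu> by fact
  note int = integrable_cont[OF assms]
  have *: "integ X (integration_functional X \<mu>) f = (\<integral>x. f x \<partial>\<mu>)" if "cont X f" for f
    using that
    by (auto simp: integ_def integration_functional_def assms(2) intro!: Bochner_Integration.integral_cong)
  have "integ X (integration_functional X \<mu>) (\<lambda>_. 1) = 1" by (subst *) (auto simp: prob_space)
  then show ?thesis
    unfolding states_def mem_Collect_eq
    by (auto simp: * continuous_intros int assms(2)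
        intro!: Bochner_Integration.integral_nonneg_AE AE_I2)
      (auto simp: integration_functional_def)
qed

text \<open>
  A state is represented by a measure along the classical lines: the content of an open set is the
  supremum of the integrals of the functions below its indicator, the outer measure is the infimum
  of the contents of the open supersets, and open sets satisfy the condition of Caratheodory.
\<close>

locale state_on_compact =
  fixes X :: "'x topology" and \<Lambda> :: "('x \<Rightarrow> real) \<Rightarrow> real"
  assumes compact: "compact_space X" and Hausdorff: "Hausdorff_space X" and state: "\<Lambda> \<in> states X"
begin

text \<open>
  Only vanishing off \<open>U\<close> is demanded, not a support inside \<open>U\<close>: lowering a function by a small
  constant (lemma \<open>truncate\<close>) supplies a closed set inside \<open>U\<close> at an arbitrarily small cost.
\<close>

definition below :: "'x set \<Rightarrow> ('x \<Rightarrow> real) set" where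
  "below U = {f. cont X f \<and> (\<forall>x\<in>topspace X. 0 \<le> f x \<and> f x \<le> 1) \<and> (\<forall>x\<in>topspace X - U. f x = 0)}"

definition content :: "'x set \<Rightarrow> ennreal" where
  "content U = (SUP f\<in>below U. ennreal (integ X \<Lambda> f))"

definition outer :: "'x set \<Rightarrow> ennreal" where
  "outer A = (INF U\<in>{U. openin X U \<and> A \<subseteq> U}. content U)"

lemma normal: "normal_space X"
  using compact Hausdorff by (simp add: compact_Hausdorff_or_regular_imp_normal_space)

lemma content_upper: "f \<in> below U \<Longrightarrow> ennreal (integ X \<Lambda> f) \<le> content U"
  unfolding content_def by (rule SUP_upper)

lemma below_nonneg: "f \<in> below U \<Longrightarrow> 0 \<le> integ X \<Lambda> f"
  by (auto simp: below_def intro: integ_nonneg[OF state])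

lemma zero_below: "(\<lambda>_. 0) \<in> below U"
  by (simp add: below_def)

lemma content_mono: "U \<subseteq> V \<Longrightarrow> content U \<le> content V"
  unfolding content_def by (rule SUP_subset_mono) (auto simp: below_def)

lemma content_empty: "content {} = 0"
proof -
  have "integ X \<Lambda> f = 0" if "f \<in> below {}" for f
    using that integ_cong[of X f "\<lambda>_. 0"] integ_const[OF state] by (simp add: below_def)
  then have "content {} \<le> 0" unfolding content_def by (intro SUP_least) simp
  then show ?thesis by simp
qed

lemma content_space: "content (topspace X) = 1"
proof (rule antisym)
  show "content (topspace X) \<le> 1" unfolding content_def
  proof (rule SUP_least)
    fix f assume "f \<in> below (topspace X)"
    then have "integ X \<Lambda> f \<le> integ X \<Lambda> (\<lambda>_. 1)"
      by (intro integ_mono[OF state]) (auto simp: below_def)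
    then show "ennreal (integ X \<Lambda> f) \<le> 1" by (simp add: integ_const[OF state])
  qed
  show "1 \<le> content (topspace X)"
    using content_upper[of "\<lambda>_. 1" "topspace X"] by (simp add: below_def integ_const[OF state])
qed

lemma truncate:
  assumes "f \<in> below U" "e > 0"
  obtains f' C where "f' \<in> below U" "integ X \<Lambda> f \<le> integ X \<Lambda> f' + e" "closedin X C" "C \<subseteq> U"
    "\<And>x. x \<in> topspace X - C \<Longrightarrow> f' x = 0"
proof
  let ?f' = "\<lambda>x. max (f x - e) 0"
  have f: "cont X f" using assms by (simp add: below_def)
  then have f': "cont X ?f'" by (intro continuous_intros)
  show "?f' \<in> below U" using assms f' by (auto simp: below_def max_def)
  have "integ X \<Lambda> f \<le> integ X \<Lambda> (\<lambda>x. ?f' x + e)"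
    using f f' by (intro integ_mono[OF state] continuous_intros) auto
  then show "integ X \<Lambda> f \<le> integ X \<Lambda> ?f' + e"
    using integ_add[OF state f', of "\<lambda>_. e"] by (simp add: integ_const[OF state])
  show "closedin X {x\<in>topspace X. f x \<in> {e..}}"
    by (rule closedin_continuous_map_preimage[OF f]) simp
  show "{x\<in>topspace X. f x \<in> {e..}} \<subseteq> U" using assms by (force simp: below_def)
qed auto

text \<open>
  After truncation only a closed set \<open>C \<subseteq> U \<union> V\<close> matters. A Urysohn function \<open>g\<close> that is \<open>1\<close> on
  \<open>C - V\<close> and \<open>0\<close> off \<open>U\<close> splits \<open>f'\<close> into \<open>f' g\<close>, which lives on \<open>U\<close>, and \<open>f' (1 - g)\<close>, which
  lives on \<open>V\<close>.
\<close>

lemma content_Un: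
  assumes "openin X U" "openin X V"
  shows "content (U \<union> V) \<le> content U + content V"
  unfolding content_def[of "U \<union> V"]
proof (rule SUP_least)
  fix f assume f: "f \<in> below (U \<union> V)"
  show "ennreal (integ X \<Lambda> f) \<le> content U + content V"
  proof (rule ennreal_le_epsilon)
    fix e :: real assume "0 < e"
    obtain f' C where f': "f' \<in> below (U \<union> V)" "integ X \<Lambda> f \<le> integ X \<Lambda> f' + e" "closedin X C"
        "C \<subseteq> U \<union> V" "\<And>x. x \<in> topspace X - C \<Longrightarrow> f' x = 0"
      using truncate[OF f \<open>0 < e\<close>] by blast
    have "closedin X (topspace X - U)" "closedin X (C - V)"
      using assms f'(3) by (auto intro: closedin_diff)
    moreover have "disjnt (topspace X - U) (C - V)" using f'(4) by (auto simp: disjnt_def)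
    ultimately obtain g where g: "continuous_map X (top_of_set {0..1}) g"
        "g ` (topspace X - U) \<subseteq> {0::real}" "g ` (C - V) \<subseteq> {1}"
      by (rule Urysohn_lemma[OF normal, where a=0 and b=1]) simp_all
    have g': "cont X g" "\<And>x. x \<in> topspace X \<Longrightarrow> 0 \<le> g x \<and> g x \<le> 1"
      using g(1) by (auto simp: continuous_map_in_subtopology)
    have cf': "cont X f'" using f'(1) by (simp add: below_def)
    have 1: "(\<lambda>x. f' x * g x) \<in> below U"
      using f'(1) g' g(2) by (auto simp: below_def mult_le_one intro!: continuous_intros)
    have 2: "(\<lambda>x. f' x * (1 - g x)) \<in> below V"
    proof -
      have "f' x * (1 - g x) = 0" if "x \<in> topspace X - V" for x
        using that g(3) f'(5)[of x] by (cases "x \<in> C") auto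
      then show ?thesis
        using f'(1) g' by (auto simp: below_def mult_le_one intro!: continuous_intros)
    qed
    have "integ X \<Lambda> f' = integ X \<Lambda> (\<lambda>x. f' x * g x + f' x * (1 - g x))"
      by (simp add: algebra_simps)
    also have "\<dots> = integ X \<Lambda> (\<lambda>x. f' x * g x) + integ X \<Lambda> (\<lambda>x. f' x * (1 - g x))"
      using 1 2 by (intro integ_add[OF state]) (auto simp: below_def)
    finally have "ennreal (integ X \<Lambda> f) \<le>
        ennreal (integ X \<Lambda> (\<lambda>x. f' x * g x)) + ennreal (integ X \<Lambda> (\<lambda>x. f' x * (1 - g x))) + ennreal e"
      using f'(2) below_nonneg[OF 1] below_nonneg[OF 2] \<open>0 < e\<close>
      by (simp add: ennreal_leI flip: ennreal_plus)
    also have "\<dots> \<le> content U + content V + ennreal e"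
      by (intro add_mono content_upper 1 2 order_refl)
    finally show "ennreal (integ X \<Lambda> f) \<le> content U + content V + ennreal e" .
  qed
qed

lemma content_finite_UN:
  fixes N :: nat
  assumes "\<And>n. openin X (U n)"
  shows "content (\<Union>n<N. U n) \<le> (\<Sum>n<N. content (U n))"
proof (induction N)
  case 0
  then show ?case by (simp add: content_empty)
next
  case (Suc N)
  have "content (\<Union>n<Suc N. U n) = content (U N \<union> (\<Union>n<N. U n))"
    by (simp add: lessThan_Suc)
  also have "\<dots> \<le> content (U N) + content (\<Union>n<N. U n)"
    using assms by (intro content_Un) auto
  also have "\<dots> \<le> (\<Sum>n<Suc N. content (U n))" using Suc by (simp add: add.commute add_left_mono)
  finally show ?case .
qed

text \<open>
  Compactness of the set left over by the truncation reduces countable to finite subadditivity.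
\<close>

lemma content_UN:
  fixes U :: "nat \<Rightarrow> 'x set"
  assumes "\<And>n. openin X (U n)"
  shows "content (\<Union>n. U n) \<le> (\<Sum>n. content (U n))"
  unfolding content_def[of "\<Union>n. U n"]
proof (rule SUP_least)
  fix f assume f: "f \<in> below (\<Union>n. U n)"
  show "ennreal (integ X \<Lambda> f) \<le> (\<Sum>n. content (U n))"
  proof (rule ennreal_le_epsilon)
    fix e :: real assume "0 < e"
    obtain f' C where f': "f' \<in> below (\<Union>n. U n)" "integ X \<Lambda> f \<le> integ X \<Lambda> f' + e" "closedin X C"
        "C \<subseteq> (\<Union>n. U n)" "\<And>x. x \<in> topspace X - C \<Longrightarrow> f' x = 0"
      using truncate[OF f \<open>0 < e\<close>] by blast
    have "compactin X C" using closedin_compact_space[OF compact f'(3)] .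
    then obtain \<F> where \<F>: "finite \<F>" "\<F> \<subseteq> range U" "C \<subseteq> \<Union>\<F>"
      using compactinD[of X C "range U"] assms f'(4) by blast
    then obtain I where I: "finite I" "C \<subseteq> (\<Union>n\<in>I. U n)"
      using finite_subset_image[OF \<F>(1,2)] by blast
    then obtain N where "I \<subseteq> {..<N}" using finite_nat_iff_bounded by blast
    then have C: "C \<subseteq> (\<Union>n<N. U n)" using I(2) by blast
    have "f' \<in> below (\<Union>n<N. U n)" using f'(1,5) C by (force simp: below_def)
    then have "ennreal (integ X \<Lambda> f') \<le> (\<Sum>n<N. content (U n))"
      using content_upper content_finite_UN[of U N, OF assms] order_trans by blast
    also have "\<dots> \<le> (\<Sum>n. content (U n))" by (rule sum_le_suminf) auto
    finally have "ennreal (integ X \<Lambda> f') + ennreal e \<le> (\<Sum>n. content (U n)) + ennreal e"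
      by (rule add_right_mono)
    moreover have "ennreal (integ X \<Lambda> f) \<le> ennreal (integ X \<Lambda> f') + ennreal e"
      using f'(2) below_nonneg[OF f'(1)] \<open>0 < e\<close> by (simp add: ennreal_leI flip: ennreal_plus)
    ultimately show "ennreal (integ X \<Lambda> f) \<le> (\<Sum>n. content (U n)) + ennreal e"
      by (rule order_trans[rotated])
  qed
qed

lemma outer_open: "openin X U \<Longrightarrow> outer U = content U"
  unfolding outer_def by (rule antisym) (auto intro!: INF_lower INF_greatest content_mono)

lemma outer_mono: "A \<subseteq> B \<Longrightarrow> outer A \<le> outer B"
  unfolding outer_def by (rule INF_superset_mono) auto

lemma outer_le_1: "A \<subseteq> topspace X \<Longrightarrow> outer A \<le> 1"
  using outer_mono[of A "topspace X"] by (simp add: outer_open content_space)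

lemma outer_UN:
  fixes A :: "nat \<Rightarrow> 'x set"
  assumes "\<And>n. A n \<subseteq> topspace X"
  shows "outer (\<Union>n. A n) \<le> (\<Sum>n. outer (A n))"
proof (rule ennreal_le_epsilon)
  fix e :: real assume "0 < e"
  have "\<exists>U. openin X U \<and> A n \<subseteq> U \<and> content U \<le> outer (A n) + ennreal (e * (1/2) ^ Suc n)" for n
  proof -
    have "outer (A n) < outer (A n) + ennreal (e * (1/2) ^ Suc n)"
      using outer_le_1[OF assms[of n]] \<open>0 < e\<close>
      by (auto simp: ennreal_add_left_cancel_less top_unique zero_less_mult_iff)
    then show ?thesis unfolding outer_def[of "A n"] INF_less_iff by (auto intro: less_imp_le)
  qed
  then obtain U where U: "\<And>n. openin X (U n)" "\<And>n. A n \<subseteq> U n"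
      "\<And>n. content (U n) \<le> outer (A n) + ennreal (e * (1/2) ^ Suc n)"
    by metis
  have "outer (\<Union>n. A n) \<le> content (\<Union>n. U n)"
    unfolding outer_def using U by (intro INF_lower) blast
  also have "\<dots> \<le> (\<Sum>n. content (U n))" using U(1) by (rule content_UN)
  also have "\<dots> \<le> (\<Sum>n. outer (A n) + ennreal (e * (1/2) ^ Suc n))"
    by (intro suminf_le U(3) summableI)
  also have "\<dots> = (\<Sum>n. outer (A n)) + (\<Sum>n. ennreal e * ennreal ((1/2) ^ Suc n))"
    using \<open>0 < e\<close> by (subst suminf_add[symmetric]) (simp_all add: ennreal_mult'[symmetric])
  also have "(\<Sum>n. ennreal e * ennreal ((1/2) ^ Suc n)) = ennreal e"
    unfolding ennreal_suminf_cmult by (subst suminf_ennreal_eq[OF _ power_half_series]) auto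
  finally show "outer (\<Union>n. A n) \<le> (\<Sum>n. outer (A n)) + ennreal e" .
qed

lemma outer_measure_space_outer: "outer_measure_space (Pow (topspace X)) outer"
  unfolding outer_measure_space_def positive_def increasing_def countably_subadditive_def
  using outer_open[of "{}"] content_empty outer_mono outer_UN by (simp add: image_subset_iff)

text \<open>
  This is the condition of Caratheodory for \<open>U\<close>, tested on an open set. A nearly optimal function for
  \<open>U \<inter> W\<close> lives on a closed set \<open>C\<close>, so that it can be added to any function below \<open>W - C\<close> without
  exceeding \<open>1\<close>, and \<open>W - C\<close> is an open superset of \<open>W - U\<close>.
\<close>

lemma content_split:
  assumes "openin X U" "openin X W"
  shows "content (U \<inter> W) + outer (W - U) \<le> content W"
proof -
  have "ennreal (integ X \<Lambda> f) + outer (W - U) \<le> content W" if f: "f \<in> below (U \<inter> W)" for f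
  proof (rule ennreal_le_epsilon)
    fix e :: real assume "0 < e"
    obtain f' C where f': "f' \<in> below (U \<inter> W)" "integ X \<Lambda> f \<le> integ X \<Lambda> f' + e" "closedin X C"
        "C \<subseteq> U \<inter> W" "\<And>x. x \<in> topspace X - C \<Longrightarrow> f' x = 0"
      using truncate[OF f \<open>0 < e\<close>] by blast
    have "ennreal (integ X \<Lambda> g) + ennreal (integ X \<Lambda> f') \<le> content W" if g: "g \<in> below (W - C)" for g
    proof -
      have "g x + f' x \<le> 1 \<and> 0 \<le> g x + f' x \<and> (x \<notin> W \<longrightarrow> g x + f' x = 0)" if "x \<in> topspace X" for x
        using f'(1,5) g that f'(4) by (cases "x \<in> C") (auto simp: below_def)
      then have "(\<lambda>x. g x + f' x) \<in> below W"
        using f'(1) g by (auto simp: below_def intro!: continuous_intros)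
      then have "ennreal (integ X \<Lambda> (\<lambda>x. g x + f' x)) \<le> content W" by (rule content_upper)
      moreover have "integ X \<Lambda> (\<lambda>x. g x + f' x) = integ X \<Lambda> g + integ X \<Lambda> f'"
        using f'(1) g by (intro integ_add[OF state]) (auto simp: below_def)
      ultimately show ?thesis using below_nonneg[OF g] below_nonneg[OF f'(1)] by simp
    qed
    then have "(SUP g\<in>below (W - C). ennreal (integ X \<Lambda> g) + ennreal (integ X \<Lambda> f')) \<le> content W"
      by (rule SUP_least)
    moreover have "(SUP g\<in>below (W - C). ennreal (integ X \<Lambda> g) + ennreal (integ X \<Lambda> f')) =
        content (W - C) + ennreal (integ X \<Lambda> f')"
      unfolding content_def using zero_below by (intro ennreal_SUP_add_left) auto
    ultimately have 1: "content (W - C) + ennreal (integ X \<Lambda> f') \<le> content W" by simp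
    have "outer (W - U) \<le> content (W - C)"
      unfolding outer_def using f'(3,4) assms by (intro INF_lower) (auto intro: openin_diff)
    moreover have "ennreal (integ X \<Lambda> f) \<le> ennreal (integ X \<Lambda> f') + ennreal e"
      using f'(2) below_nonneg[OF f'(1)] \<open>0 < e\<close> by (simp add: ennreal_leI flip: ennreal_plus)
    ultimately have "ennreal (integ X \<Lambda> f) + outer (W - U) \<le>
        ennreal (integ X \<Lambda> f') + ennreal e + content (W - C)" by (rule add_mono[rotated])
    also have "\<dots> = (content (W - C) + ennreal (integ X \<Lambda> f')) + ennreal e" by (simp add: ac_simps)
    also have "\<dots> \<le> content W + ennreal e" by (rule add_right_mono[OF 1])
    finally show "ennreal (integ X \<Lambda> f) + outer (W - U) \<le> content W + ennreal e" .
  qed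
  then have "(SUP f\<in>below (U \<inter> W). ennreal (integ X \<Lambda> f) + outer (W - U)) \<le> content W"
    by (rule SUP_least)
  moreover have "(SUP f\<in>below (U \<inter> W). ennreal (integ X \<Lambda> f) + outer (W - U)) =
      content (U \<inter> W) + outer (W - U)"
    unfolding content_def using zero_below by (intro ennreal_SUP_add_left) auto
  ultimately show ?thesis by simp
qed

lemma open_in_lambda_system:
  assumes "openin X U"
  shows "U \<in> lambda_system (topspace X) (Pow (topspace X)) outer"
  unfolding lambda_system_def mem_Collect_eq
proof (intro conjI ballI)
  show "U \<in> Pow (topspace X)" using openin_subset[OF assms] by simp
  fix A assume A: "A \<in> Pow (topspace X)"
  show "outer (U \<inter> A) + outer ((topspace X - U) \<inter> A) = outer A"
  proof (rule antisym)
    show "outer (U \<inter> A) + outer ((topspace X - U) \<inter> A) \<le> outer A"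
      unfolding outer_def[of A]
    proof (rule INF_greatest)
      fix W assume W: "W \<in> {W. openin X W \<and> A \<subseteq> W}"
      have "outer (U \<inter> A) \<le> outer (U \<inter> W)" "outer ((topspace X - U) \<inter> A) \<le> outer (W - U)"
        using W by (auto intro!: outer_mono)
      then have "outer (U \<inter> A) + outer ((topspace X - U) \<inter> A) \<le> content (U \<inter> W) + outer (W - U)"
        using W assms by (intro add_mono) (auto simp: outer_open openin_Int)
      also have "\<dots> \<le> content W" using W assms by (intro content_split) auto
      finally show "outer (U \<inter> A) + outer ((topspace X - U) \<inter> A) \<le> content W" .
    qed
    let ?B = "\<lambda>n::nat. if n = 0 then U \<inter> A else if n = 1 then (topspace X - U) \<inter> A else {}"
    have "A = (\<Union>n. ?B n)"
    proof (intro equalityI subsetI)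
      fix x assume "x \<in> A"
      then have "x \<in> ?B 0 \<or> x \<in> ?B 1" using A by auto
      then show "x \<in> (\<Union>n. ?B n)" by blast
    qed (auto split: if_splits)
    then have "outer A \<le> (\<Sum>n. outer (?B n))"
      using outer_UN[of ?B] A openin_subset[OF assms] by (simp add: le_infI2 inf.coboundedI2)
    also have "\<dots> = (\<Sum>n<2. outer (?B n))"
      by (rule suminf_finite) (auto simp: outer_open content_empty)
    also have "\<dots> = outer (U \<inter> A) + outer ((topspace X - U) \<inter> A)" by (simp add: numeral_2_eq_2)
    finally show "outer A \<le> outer (U \<inter> A) + outer ((topspace X - U) \<inter> A)" .
  qed
qed

definition meas :: "'x measure" where
  "meas = measure_of (topspace X) {U. openin X U} outer"

lemma open_Pow: "{U. openin X U} \<subseteq> Pow (topspace X)"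
  by (auto dest: openin_subset)

lemma space_meas: "space meas = topspace X"
  and sets_meas: "sets meas = sigma_sets (topspace X) {U. openin X U}"
  unfolding meas_def using open_Pow by (simp_all add: space_measure_of sets_measure_of)

lemma emeasure_meas:
  assumes "A \<in> sets meas"
  shows "emeasure meas A = outer A"
proof -
  interpret P: sigma_algebra "topspace X" "Pow (topspace X)" by (rule sigma_algebra_Pow)
  have L: "measure_space (topspace X) (lambda_system (topspace X) (Pow (topspace X)) outer) outer"
    by (rule P.caratheodory_lemma[OF outer_measure_space_outer])
  then interpret L: sigma_algebra "topspace X" "lambda_system (topspace X) (Pow (topspace X)) outer"
    by (simp add: measure_space_def)
  have "sigma_sets (topspace X) {U. openin X U} \<subseteq> lambda_system (topspace X) (Pow (topspace X)) outer"
    using open_in_lambda_system by (intro L.sigma_sets_subset) auto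
  then have "measure_space (topspace X) (sigma_sets (topspace X) {U. openin X U}) outer"
    by (rule measure_down[OF L sigma_algebra_sigma_sets[OF open_Pow]])
  then show ?thesis
    using assms unfolding measure_space_def sets_meas[symmetric]
    by (intro emeasure_measure_of[OF meas_def open_Pow]) auto
qed

lemma emeasure_open: "openin X U \<Longrightarrow> emeasure meas U = content U"
  by (subst emeasure_meas) (auto simp: sets_meas outer_open sigma_sets.Basic)

lemma prob_meas: "prob_space meas"
  by (rule prob_spaceI) (simp add: space_meas emeasure_open content_space)

lemma meas_regular: "meas \<in> regular_borel_probs X"
proof -
  interpret prob_space meas by (rule prob_meas)
  have out: "emeasure meas A = (INF U\<in>{U. openin X U \<and> A \<subseteq> U}. emeasure meas U)" if "A \<in> sets meas" for A
    unfolding emeasure_meas[OF that] outer_def by (rule INF_cong) (auto simp: emeasure_open)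
  have comp_sets: "C \<in> sets meas" if "compactin X C" for C
  proof -
    have "openin X (topspace X - C)" "C \<subseteq> topspace X"
      using compactin_imp_closedin[OF Hausdorff that] by (auto simp: closedin_def)
    then have "topspace X - (topspace X - C) \<in> sets meas"
      unfolding sets_meas by (intro sigma_sets.Compl sigma_sets.Basic) simp
    then show ?thesis using \<open>C \<subseteq> topspace X\<close> by (simp add: double_diff)
  qed
  have "emeasure meas A = (SUP C\<in>{C. compactin X C \<and> C \<subseteq> A}. emeasure meas C)" if A: "A \<in> sets meas" for A
  proof (rule antisym)
    show "(SUP C\<in>{C. compactin X C \<and> C \<subseteq> A}. emeasure meas C) \<le> emeasure meas A"
      using A by (intro SUP_least emeasure_mono) auto
    show "emeasure meas A \<le> (SUP C\<in>{C. compactin X C \<and> C \<subseteq> A}. emeasure meas C)"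
    proof (rule ennreal_le_epsilon)
      fix e :: real assume "0 < e"
      have sub: "A \<subseteq> topspace X" using sets.sets_into_space[OF A] by (simp add: space_meas)
      have B: "topspace X - A \<in> sets meas" using sets.compl_sets[OF A] by (simp add: space_meas)
      have "emeasure meas (topspace X - A) < emeasure meas (topspace X - A) + ennreal e"
        using \<open>0 < e\<close> by (simp add: ennreal_add_left_cancel_less less_top[symmetric])
      then obtain U where U: "openin X U" "topspace X - A \<subseteq> U"
          "emeasure meas U < emeasure meas (topspace X - A) + ennreal e"
        unfolding INF_less_iff[of "emeasure meas" "{U. openin X U \<and> topspace X - A \<subseteq> U}", folded out[OF B]]
        by blast
      have Us: "U \<in> sets meas" using U(1) by (simp add: sets_meas sigma_sets.Basic)
      have C: "compactin X (topspace X - U)" "topspace X - U \<subseteq> A"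
        using U compact by (auto intro!: closedin_compact_space)
      have "prob U < prob (topspace X - A) + e"
        using U(3) \<open>0 < e\<close> unfolding emeasure_eq_measure
        by (simp add: ennreal_less_iff flip: ennreal_plus)
      then have "prob A \<le> prob (topspace X - U) + e"
        using prob_compl[OF Us] prob_compl[OF A] by (simp add: space_meas)
      then have "emeasure meas A \<le> emeasure meas (topspace X - U) + ennreal e"
        using \<open>0 < e\<close> unfolding emeasure_eq_measure by (simp add: ennreal_leI flip: ennreal_plus)
      also have "\<dots> \<le> (SUP C\<in>{C. compactin X C \<and> C \<subseteq> A}. emeasure meas C) + ennreal e"
        using C by (intro add_right_mono SUP_upper) auto
      finally show "emeasure meas A \<le> (SUP C\<in>{C. compactin X C \<and> C \<subseteq> A}. emeasure meas C) + ennreal e" .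
    qed
  qed
  then show ?thesis
    using out prob_meas space_meas sets_meas unfolding regular_borel_probs_def by blast
qed

text \<open>
  The number of levels \<open>k / N\<close> below \<open>y\<close>, the discrete form of the layer cake formula.
\<close>

lemma count_levels:
  assumes "0 \<le> (y::real)" "0 < N"
  shows "(\<Sum>k<N. if real k / N < y then 1 else 0 :: real) \<le> N * y + 1"
proof -
  have "{k\<in>{..<N}. real k / N < y} \<subseteq> {..<nat \<lceil>N * y\<rceil>}"
    using assms by (auto simp: field_simps zless_nat_eq_int_zless less_ceiling_iff)
  then have "card {k\<in>{..<N}. real k / N < y} \<le> nat \<lceil>N * y\<rceil>"
    using card_mono[of "{..<nat \<lceil>N * y\<rceil>}"] by fastforce
  moreover have "real (nat \<lceil>N * y\<rceil>) \<le> N * y + 1" using assms by simp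
  moreover have "(\<Sum>k<N. if real k / N < y then 1 else 0 :: real) = card {k\<in>{..<N}. real k / N < y}"
    by (simp add: sum.If_cases Int_def)
  ultimately show ?thesis by linarith
qed

lemma integ_le_integral:
  assumes f: "cont X f" and f01: "\<And>x. x \<in> topspace X \<Longrightarrow> 0 \<le> f x \<and> f x \<le> 1"
  shows "integ X \<Lambda> f \<le> (\<integral>x. f x \<partial>meas)"
proof (rule field_le_epsilon)
  fix e :: real assume "0 < e"
  then obtain N :: nat where N: "0 < N" "1 / N < e"
    using nat_approx_posE[of e] by (metis zero_less_Suc)
  interpret prob_space meas by (rule prob_meas)
  \<comment> \<open>The function \<open>f\<close> is the sum of its slices \<open>?f k\<close> between the levels \<open>k / N\<close> and \<open>Suc k / N\<close>.
    The multiple \<open>N * ?f k\<close> is below \<open>?U k\<close>, and the indicators of the sets \<open>?U k\<close> add up to at most \<open>N * f + 1\<close>.\<close>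
  let ?U = "\<lambda>k::nat. {x\<in>topspace X. f x \<in> {real k / N<..}}"
  let ?f = "\<lambda>(k::nat) x. min (f x) (Suc k / N) - min (f x) (k / N)"
  have U: "openin X (?U k)" for k
    by (rule openin_continuous_map_preimage[OF f]) simp
  have Us: "?U k \<in> sets meas" for k using U by (simp add: sets_meas sigma_sets.Basic)
  have cf: "cont X (?f k)" for k using f by (intro continuous_intros)
  have "(\<lambda>x. N * ?f k x) \<in> below (?U k)" for k
  proof -
    have "N * ?f k x \<le> 1 \<and> 0 \<le> N * ?f k x \<and> (x \<notin> ?U k \<longrightarrow> N * ?f k x = 0)" if "x \<in> topspace X" for x
      using that N(1) by (auto simp: min_def field_simps)
    moreover have "cont X (\<lambda>x. N * ?f k x)" using cf by (intro continuous_map_real_mult_left)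
    ultimately show ?thesis unfolding below_def by blast
  qed
  then have "ennreal (integ X \<Lambda> (\<lambda>x. N * ?f k x)) \<le> emeasure meas (?U k)" for k
    unfolding emeasure_open[OF U] by (rule content_upper)
  then have "integ X \<Lambda> (\<lambda>x. N * ?f k x) \<le> prob (?U k)" for k
    unfolding emeasure_eq_measure by (simp add: ennreal_le_iff)
  then have le: "N * integ X \<Lambda> (?f k) \<le> prob (?U k)" for k
    unfolding integ_scale[OF state cf] .
  have "integ X \<Lambda> f = integ X \<Lambda> (\<lambda>x. \<Sum>k<N. ?f k x)"
  proof (rule integ_cong)
    fix x assume "x \<in> topspace X"
    then show "f x = (\<Sum>k<N. ?f k x)"
      using sum_lessThan_telescope[of "\<lambda>k. min (f x) (real k / N)" N] f01[of x] N(1) by simp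
  qed
  also have "\<dots> = (\<Sum>k<N. integ X \<Lambda> (?f k))" by (intro integ_sum[OF state] cf) auto
  finally have "N * integ X \<Lambda> f \<le> (\<Sum>k<N. prob (?U k))"
    using le by (simp add: sum_distrib_left sum_mono)
  also have "\<dots> = (\<Sum>k<N. \<integral>x. indicator (?U k) x \<partial>meas)"
    using Us by (intro sum.cong refl) (simp add: measure_def)
  also have "\<dots> = (\<integral>x. (\<Sum>k<N. indicator (?U k) x) \<partial>meas)"
    using Us by (intro Bochner_Integration.integral_sum[symmetric])
      (simp add: integrable_indicator_iff emeasure_eq_measure)
  also have "\<dots> \<le> (\<integral>x. N * f x + 1 \<partial>meas)"
  proof (rule integral_mono)
    note int = integrable_cont[OF compact space_meas sets_meas prob_meas f]
    show "integrable meas (\<lambda>x. \<Sum>k<N. indicator (?U k) x :: real)"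
      using Us by (intro Bochner_Integration.integrable_sum)
        (simp add: integrable_indicator_iff emeasure_eq_measure)
    show "integrable meas (\<lambda>x. N * f x + 1)" using int by simp
    fix x assume "x \<in> space meas"
    then have x: "x \<in> topspace X" by (simp add: space_meas)
    have "(\<Sum>k<N. indicator (?U k) x :: real) = (\<Sum>k<N. if real k / N < f x then 1 else 0)"
      using x by (intro sum.cong) (auto simp: indicator_def)
    then show "(\<Sum>k<N. indicator (?U k) x) \<le> N * f x + 1"
      using count_levels[of "f x" N] f01[OF x] N(1) by simp
  qed
  also have "\<dots> = N * (\<integral>x. f x \<partial>meas) + 1"
    using integrable_cont[OF compact space_meas sets_meas prob_meas f] by (simp add: prob_space)
  finally have "integ X \<Lambda> f \<le> (\<integral>x. f x \<partial>meas) + 1 / N" using N(1) by (simp add: field_simps)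
  then show "integ X \<Lambda> f \<le> (\<integral>x. f x \<partial>meas) + e" using N(2) by simp
qed

lemma integ_eq_integral:
  assumes f: "cont X f"
  shows "integ X \<Lambda> f = (\<integral>x. f x \<partial>meas)"
proof -
  interpret prob_space meas by (rule prob_meas)
  note int = integrable_cont[OF compact space_meas sets_meas prob_meas]
  obtain B where B: "B > 0" "\<And>x. x \<in> topspace X \<Longrightarrow> \<bar>f x\<bar> \<le> B" using cont_bounded[OF compact f] by blast
  \<comment> \<open>The inequality of the previous lemma, applied to \<open>(B + f) / (2 B)\<close> and to \<open>(B - f) / (2 B)\<close>,
    gives both directions.\<close>
  have "- B \<le> f x \<and> f x \<le> B" if "x \<in> topspace X" for x using B(2)[OF that] by linarith
  then have 1: "integ X \<Lambda> (\<lambda>x. 1 / (2 * B) * (f x + B)) \<le> (\<integral>x. 1 / (2 * B) * (f x + B) \<partial>meas)"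
    "integ X \<Lambda> (\<lambda>x. 1 / (2 * B) * (B - f x)) \<le> (\<integral>x. 1 / (2 * B) * (B - f x) \<partial>meas)"
    using B(1) f by (intro integ_le_integral continuous_intros; force simp: field_simps)+
  have c: "cont X (\<lambda>x. f x + B)" "cont X (\<lambda>x. B - f x)" using f by (intro continuous_intros; simp)+
  have "integ X \<Lambda> (\<lambda>x. f x + B) = integ X \<Lambda> f + B" "integ X \<Lambda> (\<lambda>x. B - f x) = B - integ X \<Lambda> f"
    using integ_add[OF state f, of "\<lambda>_. B"] integ_diff[OF state _ f, of "\<lambda>_. B"]
    by (simp_all add: integ_const[OF state])
  moreover have "(\<integral>x. f x + B \<partial>meas) = (\<integral>x. f x \<partial>meas) + B" "(\<integral>x. B - f x \<partial>meas) = B - (\<integral>x. f x \<partial>meas)"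
    using int[OF f] by (simp_all add: prob_space)
  moreover have "0 < 1 / (2 * B)" using B(1) by simp
  ultimately show ?thesis
    using 1 unfolding integ_scale[OF state c(1)] integ_scale[OF state c(2)] integral_mult_right_zero
    by (simp only: mult_le_cancel_left_pos)
qed

end

text \<open>
  The Riesz representation theorem. From here on measures appear only as states.
\<close>

theorem Prob_eq_states:
  assumes "compact_space X" "Hausdorff_space X"
  shows "Prob X = states X"
proof (intro equalityI subsetI)
  fix \<Lambda> assume "\<Lambda> \<in> Prob X"
  then show "\<Lambda> \<in> states X"
    using integration_functional_in_states[OF assms(1) regular_borel_probsD(1-3)]
    by (auto simp: Prob_def)
next
  fix \<Lambda> assume L: "\<Lambda> \<in> states X"
  then interpret state_on_compact X \<Lambda> using assms by unfold_locales
  have "\<Lambda> = integration_functional X meas"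
  proof (rule states_eqI[OF L integration_functional_in_states[OF assms(1) space_meas sets_meas prob_meas]])
    fix f assume f: "cont X f"
    then show "integ X \<Lambda> f = integ X (integration_functional X meas) f"
      using integ_eq_integral[OF f] 
      by (auto simp: integ_def integration_functional_def space_meas intro!: Bochner_Integration.integral_cong)
  qed
  then show "\<Lambda> \<in> Prob X" using meas_regular by (auto simp: Prob_def)
qed

section \<open>Flows and their spaces of measures\<close>

lemma cont_iff:
  "cont X f \<longleftrightarrow> (\<forall>x\<in>topspace X. \<forall>e>0. \<exists>U. openin X U \<and> x \<in> U \<and> (\<forall>y\<in>U. \<bar>f y - f x\<bar> < e))"
  using Met_TC.continuous_map_to_metric[of X f]
  by (simp add: mtopology_is_euclidean dist_real_def abs_minus_commute)

lemma group_actionI: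
  assumes "group G"
    and "\<And>g. g \<in> carrier G \<Longrightarrow> act g \<in> extensional E"
    and closed: "\<And>g x. \<lbrakk>g \<in> carrier G; x \<in> E\<rbrakk> \<Longrightarrow> act g x \<in> E"
    and one: "\<And>x. x \<in> E \<Longrightarrow> act \<one>\<^bsub>G\<^esub> x = x"
    and mult: "\<And>g h x. \<lbrakk>g \<in> carrier G; h \<in> carrier G; x \<in> E\<rbrakk> \<Longrightarrow> act (g \<otimes>\<^bsub>G\<^esub> h) x = act g (act h x)"
  shows "group_action G E act"
proof -
  interpret group G by fact
  have bij: "act g \<in> Bij E" if g: "g \<in> carrier G" for g
  proof -
    have "act (inv\<^bsub>G\<^esub> g) (act g x) = x" "act g (act (inv\<^bsub>G\<^esub> g) x) = x" if "x \<in> E" for x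
      using mult[of "inv\<^bsub>G\<^esub> g" g x] mult[of g "inv\<^bsub>G\<^esub> g" x] g one that by simp_all
    then have "bij_betw (act g) E E"
      using closed g by (intro bij_betwI[of _ _ _ "act (inv\<^bsub>G\<^esub> g)"]) auto
    then show ?thesis using assms(2)[OF g] by (simp add: Bij_def)
  qed
  have "act \<in> hom G (BijGroup E)"
  proof (rule homI)
    show "act g \<in> carrier (BijGroup E)" if "g \<in> carrier G" for g
      using bij[OF that] by (simp add: BijGroup_def)
    fix g h assume gh: "g \<in> carrier G" "h \<in> carrier G"
    have "act (g \<otimes>\<^bsub>G\<^esub> h) = compose E (act g) (act h)"
    proof (rule extensionalityI[of _ E])
      show "act (g \<otimes>\<^bsub>G\<^esub> h) \<in> extensional E" using gh assms(2) by simp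
    qed (use gh mult in \<open>auto simp: compose_def\<close>)
    then show "act (g \<otimes>\<^bsub>G\<^esub> h) = act g \<otimes>\<^bsub>BijGroup E\<^esub> act h"
      using bij gh by (simp add: BijGroup_def)
  qed
  then show ?thesis
    using group_BijGroup[of E] assms(1)
    by (auto simp: group_action_def group_hom_def group_hom_axioms_def)
qed

lemma flowI:
  assumes "group G" "topspace X \<noteq> {}" "compact_space X" "Hausdorff_space X"
    and "\<And>g. g \<in> carrier G \<Longrightarrow> act g \<in> extensional (topspace X)"
    and "\<And>g x. \<lbrakk>g \<in> carrier G; x \<in> topspace X\<rbrakk> \<Longrightarrow> act g x \<in> topspace X"
    and "\<And>x. x \<in> topspace X \<Longrightarrow> act \<one>\<^bsub>G\<^esub> x = x"
    and "\<And>g h x. \<lbrakk>g \<in> carrier G; h \<in> carrier G; x \<in> topspace X\<rbrakk> \<Longrightarrow> act (g \<otimes>\<^bsub>G\<^esub> h) x = act g (act h x)"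
    and "continuous_map (prod_topology T X) X (\<lambda>(g, x). act g x)"
  shows "flow G T X act"
  unfolding flow_def using group_actionI[OF assms(1), of act "topspace X"] assms by blast

lemma flow_compact: "flow G T X act \<Longrightarrow> compact_space X"
  and flow_Hausdorff: "flow G T X act \<Longrightarrow> Hausdorff_space X"
  and flow_nonempty: "flow G T X act \<Longrightarrow> topspace X \<noteq> {}"
  and flow_continuous: "flow G T X act \<Longrightarrow> continuous_map (prod_topology T X) X (\<lambda>(g, x). act g x)"
  by (simp_all add: flow_def)

lemma flow_closed:
  assumes "flow G T X act" "g \<in> carrier G" "x \<in> topspace X"
  shows "act g x \<in> topspace X"
proof -
  interpret group_action G "topspace X" act using assms by (simp add: flow_def)
  show ?thesis using element_image assms by blast
qed

lemma flow_one:
  assumes "flow G T X act" "x \<in> topspace X"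
  shows "act \<one>\<^bsub>G\<^esub> x = x"
proof -
  interpret group_action G "topspace X" act using assms by (simp add: flow_def)
  show ?thesis using id_eq_one assms by (metis restrict_apply')
qed

lemma flow_mult:
  assumes "flow G T X act" "g \<in> carrier G" "h \<in> carrier G" "x \<in> topspace X"
  shows "act (g \<otimes>\<^bsub>G\<^esub> h) x = act g (act h x)"
proof -
  interpret group_action G "topspace X" act using assms by (simp add: flow_def)
  show ?thesis using composition_rule assms by blast
qed

lemma flow_extensional:
  assumes "flow G T X act" "g \<in> carrier G"
  shows "act g \<in> extensional (topspace X)"
proof -
  interpret group_action G "topspace X" act using assms by (simp add: flow_def)
  show ?thesis using bij_prop0 assms by (auto simp: Bij_def)
qed

lemma flow_continuous_act:
  assumes "topological_group G T" "flow G T X act" "g \<in> carrier G"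
  shows "continuous_map X X (act g)"
  using flow_homeomorphic[OF assms] homeomorphic_imp_continuous_map by blast

lemma flow_cont_act:
  assumes "topological_group G T" "flow G T X act" "g \<in> carrier G" "cont X f"
  shows "cont X (\<lambda>x. f (act g x))"
  using continuous_map_compose[OF flow_continuous_act[OF assms(1-3)] assms(4)] by (simp add: comp_def)

text \<open>
  By compactness of \<open>X\<close> (the tube lemma) the translates of a continuous function vary uniformly
  continuously with the group element. This one fact gives the continuity of the action on measures
  and the uniform continuity of the orbit functions.
\<close>

lemma flow_uniform:
  assumes TG: "topological_group G T" and fl: "flow G T X act" and f: "cont X f"
    and g: "g \<in> carrier G" and e: "e > 0"
  obtains U where "openin T U" "g \<in> U" "\<And>k x. \<lbrakk>k \<in> U; x \<in> topspace X\<rbrakk> \<Longrightarrow> \<bar>f (act k x) - f (act g x)\<bar> < e"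
proof -
  interpret topological_group G T by fact
  let ?F = "\<lambda>p. f (act (fst p) (snd p)) - f (act g (snd p))"
  let ?W = "{p \<in> topspace (prod_topology T X). ?F p \<in> {-e<..<e}}"
  have "cont (prod_topology T X) (\<lambda>p. f (act (fst p) (snd p)))"
    using continuous_map_compose[OF flow_continuous[OF fl] f] by (simp add: comp_def case_prod_beta)
  moreover have "cont (prod_topology T X) (\<lambda>p. f (act g (snd p)))"
    using continuous_map_compose[OF continuous_map_snd flow_cont_act[OF TG fl g f]] by (simp add: comp_def)
  ultimately have "openin (prod_topology T X) ?W"
    by (intro openin_continuous_map_preimage[of _ euclideanreal] continuous_intros) simp_all
  moreover have "{g} \<times> topspace X \<subseteq> ?W" using g e by (auto simp: topspace_eq)
  ultimately obtain U V where UV: "openin T U" "openin X V" "g \<in> U" "topspace X \<subseteq> V" "U \<times> V \<subseteq> ?W"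
    using tube_lemma_right[of T X ?W "topspace X" g] flow_compact[OF fl] g
    by (auto simp: topspace_eq compact_space_def)
  have "\<bar>f (act k x) - f (act g x)\<bar> < e" if "k \<in> U" "x \<in> topspace X" for k x
  proof -
    have "(k, x) \<in> ?W" using UV(4,5) that by blast
    then show ?thesis by auto
  qed
  then show ?thesis using that UV by blast
qed

lemma compact_space_top_of_set [simp]: "compact_space (top_of_set S) \<longleftrightarrow> compact S"
  by (metis compactin_euclidean_iff compactin_subspace subset_UNIV topspace_euclidean)

lemma Hausdorff_top_of_set_lcs: "Hausdorff_space (top_of_set (K :: 'v::locally_convex_space set))"
proof (rule Hausdorff_space_subtopology)
  show "Hausdorff_space (euclidean :: 'v topology)"
    unfolding Hausdorff_space_def using separated by (auto simp: disjnt_def)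
qed

lemma continuous_map_into_states:
  assumes "\<And>z. z \<in> topspace Z \<Longrightarrow> F z \<in> states Y"
    and "\<And>f. cont Y f \<Longrightarrow> cont Z (\<lambda>z. integ Y (F z) f)"
  shows "continuous_map Z (top_of_set (states Y)) F"
proof -
  have "cont Z (\<lambda>z. F z f)" for f
  proof (cases "f \<in> continuous_functions Y")
    case True
    then have "cont Y f" "restrict f (topspace Y) = f"
      by (auto simp: continuous_functions_def extensional_restrict)
    then show ?thesis using assms(2)[of f] by (simp add: integ_def)
  next
    case False
    then have "0 = F z f" if "z \<in> topspace Z" for z using assms(1)[OF that] by (simp add: states_def)
    moreover have "cont Z (\<lambda>_. 0)" by simp
    ultimately show ?thesis by (rule continuous_map_eq[rotated])
  qed
  then have "continuous_map Z euclidean F"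
    by (simp add: continuous_map_componentwise_UNIV flip: euclidean_product_topology)
  then show ?thesis using assms(1) by (simp add: continuous_map_in_subtopology image_subset_iff)
qed

lemma cont_integ:
  assumes "cont Y f"
  shows "cont (top_of_set S) (\<lambda>\<Lambda>. integ Y \<Lambda> f)"
  unfolding integ_def
  by (simp, rule continuous_on_subset[OF continuous_on_product_coordinates], simp)

lemma closed_states: "closed (states X)"
proof -
  have c: "continuous_on UNIV (\<lambda>\<Lambda>. integ X \<Lambda> f)" for f
    unfolding integ_def by (rule continuous_on_product_coordinates)
  show ?thesis
    unfolding states_def
    by (intro closed_Collect_conj closed_Collect_all closed_Collect_imp closed_Collect_eq
        closed_Collect_le c continuous_on_product_coordinates continuous_intros open_Collect_const)
qed

text \<open>
  A state is bounded on each function by the bound of the function, and the conditions that define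
  states are closed for the topology of pointwise convergence, so Tychonoff's theorem applies.
\<close>

lemma compact_states:
  assumes "compact_space X"
  shows "compact (states X)"
proof -
  have "\<exists>B. \<forall>x\<in>topspace X. cont X f \<longrightarrow> \<bar>f x\<bar> \<le> B" for f
    using cont_bounded[OF assms, of f] by metis
  then obtain B where B: "\<And>f x. \<lbrakk>cont X f; x \<in> topspace X\<rbrakk> \<Longrightarrow> \<bar>f x\<bar> \<le> B f" by metis
  let ?P = "Pi\<^sub>E UNIV (\<lambda>f. if f \<in> continuous_functions X then {- B f..B f} else {0})"
  have "compact ?P"
    unfolding compactin_euclidean_iff[symmetric] euclidean_product_topology[symmetric] compactin_PiE
    by simp
  moreover have "states X \<subseteq> ?P"
  proof
    fix \<Lambda> assume L: "\<Lambda> \<in> states X"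
    have "\<Lambda> f \<in> {- B f..B f}" if "f \<in> continuous_functions X" for f
    proof -
      have f: "cont X f" "restrict f (topspace X) = f"
        using that by (auto simp: continuous_functions_def extensional_restrict)
      then have "\<bar>integ X \<Lambda> f\<bar> \<le> B f" using B by (intro integ_abs_bound[OF L]) auto
      then show ?thesis using f by (auto simp: integ_def)
    qed
    then show "\<Lambda> \<in> ?P" using L by (auto simp: states_def)
  qed
  then have "?P \<inter> states X = states X" by blast
  ultimately show ?thesis using compact_Int_closed[of ?P, OF _ closed_states[of X]] by simp
qed

lemma integ_combination:
  "integ X (u *\<^sub>R \<Lambda> + v *\<^sub>R \<Lambda>') f = u * integ X \<Lambda> f + v * integ X \<Lambda>' f"
  by (simp add: integ_def)

lemma convex_states: "convex (states X)"
proof (rule convexI)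
  fix \<Lambda> \<Lambda>' :: "('a \<Rightarrow> real) \<Rightarrow> real" and u v :: real
  assume L: "\<Lambda> \<in> states X" "\<Lambda>' \<in> states X" and uv: "0 \<le> u" "0 \<le> v" "u + v = 1"
  have "\<forall>f. f \<notin> continuous_functions X \<longrightarrow> (u *\<^sub>R \<Lambda> + v *\<^sub>R \<Lambda>') f = 0"
    using L by (simp add: states_def)
  then show "u *\<^sub>R \<Lambda> + v *\<^sub>R \<Lambda>' \<in> states X"
    using uv
    by (auto simp: states_def[of X] integ_combination integ_add[OF L(1)] integ_add[OF L(2)]
        integ_scale[OF L(1)] integ_scale[OF L(2)] integ_const[OF L(1)] integ_const[OF L(2)]
        algebra_simps integ_nonneg[OF L(1)] integ_nonneg[OF L(2)])
qed

definition dirac :: "'x topology \<Rightarrow> 'x \<Rightarrow> ('x \<Rightarrow> real) \<Rightarrow> real" where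
  "dirac X x = (\<lambda>f. if f \<in> continuous_functions X then f x else 0)"

lemma integ_dirac [simp]: "\<lbrakk>x \<in> topspace X; cont X f\<rbrakk> \<Longrightarrow> integ X (dirac X x) f = f x"
  by (simp add: integ_def dirac_def)

lemma dirac_state: "x \<in> topspace X \<Longrightarrow> dirac X x \<in> states X"
  unfolding states_def mem_Collect_eq by (auto simp: continuous_intros) (simp add: dirac_def)

lemma continuous_dirac: "continuous_map X (top_of_set (states X)) (dirac X)"
  by (rule continuous_map_into_states) (auto simp: dirac_state intro: continuous_map_eq)

text \<open>
  The push-forward of a measure, in terms of integrals.
\<close>

definition push :: "'x topology \<Rightarrow> 'y topology \<Rightarrow> ('x \<Rightarrow> 'y) \<Rightarrow> (('x \<Rightarrow> real) \<Rightarrow> real) \<Rightarrow> (('y \<Rightarrow> real) \<Rightarrow> real)" where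
  "push X Y p \<Lambda> = (\<lambda>f. if f \<in> continuous_functions Y then integ X \<Lambda> (\<lambda>x. f (p x)) else 0)"

lemma integ_push:
  assumes "continuous_map X Y p" "cont Y f"
  shows "integ Y (push X Y p \<Lambda>) f = integ X \<Lambda> (\<lambda>x. f (p x))"
proof -
  have "p x \<in> topspace Y" if "x \<in> topspace X" for x
    using that continuous_map_funspace[OF assms(1)] by auto
  then show ?thesis
    using assms(2) integ_cong[of X "\<lambda>x. restrict f (topspace Y) (p x)" "\<lambda>x. f (p x)"]
    by (simp add: integ_def[of Y] push_def)
qed

lemma cont_compose: "\<lbrakk>continuous_map X Y p; cont Y f\<rbrakk> \<Longrightarrow> cont X (\<lambda>x. f (p x))"
  using continuous_map_compose[of X Y p euclideanreal f] by (simp add: comp_def)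

lemma push_state:
  assumes p: "continuous_map X Y p" and L: "\<Lambda> \<in> states X"
  shows "push X Y p \<Lambda> \<in> states Y"
proof -
  have "p x \<in> topspace Y" if "x \<in> topspace X" for x
    using that continuous_map_funspace[OF p] by auto
  then show ?thesis
    unfolding states_def[of Y] mem_Collect_eq
    by (auto simp: integ_push[OF p] continuous_intros integ_const[OF L] cont_compose[OF p]
        integ_add[OF L] integ_scale[OF L] integ_nonneg[OF L]) (simp add: push_def)
qed

lemma continuous_push:
  assumes p: "continuous_map X Y p"
  shows "continuous_map (top_of_set (states X)) (top_of_set (states Y)) (push X Y p)"
  by (rule continuous_map_into_states)
    (auto simp: push_state[OF p] integ_push[OF p] simp del: continuous_map_iff_continuous continuous_map_iff_continuous2 intro!: cont_integ cont_compose[OF p])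

lemma push_combination:
  "push X Y p (u *\<^sub>R \<Lambda> + v *\<^sub>R \<Lambda>') = u *\<^sub>R push X Y p \<Lambda> + v *\<^sub>R push X Y p \<Lambda>'"
  by (auto simp: push_def integ_combination fun_eq_iff)

lemma push_dirac:
  assumes p: "continuous_map X Y p" and x: "x \<in> topspace X"
  shows "push X Y p (dirac X x) = dirac Y (p x)"
proof -
  have "p x \<in> topspace Y" using x continuous_map_funspace[OF p] by auto
  then show ?thesis
    using x by (intro states_eqI[of _ Y]) (auto simp: push_state[OF p] dirac_state integ_push[OF p] cont_compose[OF p])
qed

lemma Prob_action_eq_push:
  "\<Lambda> \<in> Prob X \<Longrightarrow> Prob_action X act g \<Lambda> = push X X (act g) \<Lambda>"
  by (auto simp: Prob_action_def push_def integ_def fun_eq_iff)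

lemma flow_Prob_eq_states: "flow G T X act \<Longrightarrow> Prob X = states X"
  using Prob_eq_states flow_compact flow_Hausdorff by blast

lemma integ_Prob_action:
  assumes "topological_group G T" "flow G T X act" "g \<in> carrier G" "\<Lambda> \<in> Prob X" "cont X f"
  shows "integ X (Prob_action X act g \<Lambda>) f = integ X \<Lambda> (\<lambda>x. f (act g x))"
  using assms by (simp add: Prob_action_eq_push integ_push[OF flow_continuous_act])

lemma Prob_action_closed:
  assumes "topological_group G T" "flow G T X act" "g \<in> carrier G" "\<Lambda> \<in> Prob X"
  shows "Prob_action X act g \<Lambda> \<in> Prob X"
  using assms push_state[OF flow_continuous_act[OF assms(1-3)]]
  by (simp add: Prob_action_eq_push flow_Prob_eq_states)

lemma affine_flow_Prob:
  assumes TG: "topological_group G T" and fl: "flow G T X act"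
  shows "affine_flow G T (Prob X) (Prob_action X act)"
proof -
  interpret topological_group G T by fact
  let ?a = "Prob_action X act"
  note P = flow_Prob_eq_states[OF fl]
  note ia = integ_Prob_action[OF TG fl] and ac = Prob_action_closed[OF TG fl]
  have "flow G T (top_of_set (Prob X)) ?a"
  proof (rule flowI)
    show "group G" by (rule is_group)
    obtain x where "x \<in> topspace X" using flow_nonempty[OF fl] by blast
    then show "topspace (top_of_set (Prob X)) \<noteq> {}" using dirac_state[of x X] by (auto simp: P)
    show "compact_space (top_of_set (Prob X))" using compact_states[OF flow_compact[OF fl]] by (simp add: P)
    show "Hausdorff_space (top_of_set (Prob X))" by (rule Hausdorff_top_of_set_lcs)
    show "?a g \<in> extensional (topspace (top_of_set (Prob X)))" for g by (simp add: Prob_action_def)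
    show "?a g \<Lambda> \<in> topspace (top_of_set (Prob X))"
      if "g \<in> carrier G" "\<Lambda> \<in> topspace (top_of_set (Prob X))" for g \<Lambda> using that ac by simp
    fix \<Lambda> assume "\<Lambda> \<in> topspace (top_of_set (Prob X))"
    then have L: "\<Lambda> \<in> Prob X" by simp
    show "?a \<one>\<^bsub>G\<^esub> \<Lambda> = \<Lambda>"
    proof (rule states_eqI[of _ X])
      fix f assume "cont X f"
      then show "integ X (?a \<one>\<^bsub>G\<^esub> \<Lambda>) f = integ X \<Lambda> f"
        using L by (subst ia) (auto intro!: integ_cong simp: flow_one[OF fl])
    qed (use L ac[OF one_closed L] in \<open>auto simp: P\<close>)
    fix g h assume gh: "g \<in> carrier G" "h \<in> carrier G"
    show "?a (g \<otimes>\<^bsub>G\<^esub> h) \<Lambda> = ?a g (?a h \<Lambda>)"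
    proof (rule states_eqI[of _ X])
      fix f assume f: "cont X f"
      have "integ X (?a (g \<otimes>\<^bsub>G\<^esub> h) \<Lambda>) f = integ X \<Lambda> (\<lambda>x. f (act g (act h x)))"
        using L f gh by (subst ia) (auto intro!: integ_cong simp: flow_mult[OF fl])
      then show "integ X (?a (g \<otimes>\<^bsub>G\<^esub> h) \<Lambda>) f = integ X (?a g (?a h \<Lambda>)) f"
        using ia[OF gh(1) ac[OF gh(2) L] f] ia[OF gh(2) L flow_cont_act[OF TG fl gh(1) f]] by simp
    qed (use L gh ac in \<open>auto simp: P[symmetric]\<close>)
  next
    have "continuous_map (prod_topology T (top_of_set (Prob X))) (top_of_set (states X)) (\<lambda>p. ?a (fst p) (snd p))"
    proof (rule continuous_map_into_states)
      fix p assume "p \<in> topspace (prod_topology T (top_of_set (Prob X)))"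
      then show "?a (fst p) (snd p) \<in> states X" using ac by (auto simp: P[symmetric] topspace_eq)
    next
      fix f assume f: "cont X f"
      show "cont (prod_topology T (top_of_set (Prob X))) (\<lambda>p. integ X (?a (fst p) (snd p)) f)"
        unfolding cont_iff
      proof (intro ballI allI impI)
        fix p and e :: real assume p: "p \<in> topspace (prod_topology T (top_of_set (Prob X)))" and e: "0 < e"
        obtain g \<Lambda> where p_eq: "p = (g, \<Lambda>)" by fastforce
        have g: "g \<in> carrier G" and L: "\<Lambda> \<in> Prob X" using p p_eq by (auto simp: topspace_eq)
        let ?h = "\<lambda>x. f (act g x)"
        have h: "cont X ?h" by (rule flow_cont_act[OF TG fl g f])
        obtain U where U: "openin T U" "g \<in> U"
            "\<And>k x. \<lbrakk>k \<in> U; x \<in> topspace X\<rbrakk> \<Longrightarrow> \<bar>f (act k x) - f (act g x)\<bar> < e/2"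
          using flow_uniform[OF TG fl f g, of "e/2"] e by auto
        have "\<exists>V. openin (top_of_set (Prob X)) V \<and> \<Lambda> \<in> V \<and> (\<forall>M\<in>V. \<bar>integ X M ?h - integ X \<Lambda> ?h\<bar> < e/2)"
          using cont_integ[OF h, of "Prob X"] L e unfolding cont_iff by (metis half_gt_zero topspace_euclidean_subtopology)
        then obtain V where V: "openin (top_of_set (Prob X)) V" "\<Lambda> \<in> V"
            "\<And>M. M \<in> V \<Longrightarrow> \<bar>integ X M ?h - integ X \<Lambda> ?h\<bar> < e/2" by blast
        have "\<bar>integ X (?a k M) f - integ X (?a g \<Lambda>) f\<bar> < e" if kM: "k \<in> U" "M \<in> V" for k M
        proof -
          have k: "k \<in> carrier G" using openin_subset[OF U(1)] kM(1) by (auto simp: topspace_eq)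
          have M: "M \<in> Prob X" using openin_subset[OF V(1)] kM(2) by auto
          have "\<bar>integ X M (\<lambda>x. f (act k x)) - integ X M ?h\<bar> \<le> e/2"
            using U(3)[OF kM(1)] M f by (intro integ_uniform_bound flow_cont_act[OF TG fl] k g) (auto simp: P intro: less_imp_le)
          then show ?thesis using V(3)[OF kM(2)] ia[OF k M f] ia[OF g L f] by linarith
        qed
        then show "\<exists>W. openin (prod_topology T (top_of_set (Prob X))) W \<and> p \<in> W \<and>
            (\<forall>q\<in>W. \<bar>integ X (?a (fst q) (snd q)) f - integ X (?a (fst p) (snd p)) f\<bar> < e)"
          using U V p_eq by (intro exI[of _ "U \<times> V"]) (auto simp: openin_prod_Times_iff)
      qed
    qed
    then show "continuous_map (prod_topology T (top_of_set (Prob X))) (top_of_set (Prob X)) (\<lambda>(g, x). ?a g x)"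
      by (simp add: P case_prod_unfold)
  qed
  moreover have "affine_on (Prob X) (?a g)" if "g \<in> carrier G" for g
    unfolding affine_on_def
  proof (intro ballI)
    fix \<Lambda> M and t :: real assume L: "\<Lambda> \<in> Prob X" "M \<in> Prob X" and t: "t \<in> {0..1}"
    have "(1 - t) *\<^sub>R \<Lambda> + t *\<^sub>R M \<in> Prob X"
      using convexD[OF convex_states[of X]] L t by (simp add: P)
    then show "?a g ((1 - t) *\<^sub>R \<Lambda> + t *\<^sub>R M) = (1 - t) *\<^sub>R ?a g \<Lambda> + t *\<^sub>R ?a g M"
      using L by (simp add: Prob_action_eq_push push_combination)
  qed
  ultimately show ?thesis unfolding affine_flow_def using convex_states[of X] by (simp add: P)
qed

lemma push_equivariant:
  assumes TG: "topological_group G T" and X: "flow G T X a" and Y: "flow G T Y b"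
    and p: "continuous_map X Y p" and eq: "\<And>x. x \<in> topspace X \<Longrightarrow> p (a g x) = b g (p x)"
    and g: "g \<in> carrier G" and L: "\<Lambda> \<in> Prob X"
  shows "push X Y p (Prob_action X a g \<Lambda>) = Prob_action Y b g (push X Y p \<Lambda>)"
proof (rule states_eqI[of _ Y])
  have L': "push X Y p \<Lambda> \<in> Prob Y"
    using push_state[OF p] L by (simp add: flow_Prob_eq_states[OF X] flow_Prob_eq_states[OF Y])
  show "Prob_action Y b g (push X Y p \<Lambda>) \<in> states Y"
    using Prob_action_closed[OF TG Y g L'] by (simp add: flow_Prob_eq_states[OF Y])
  show "push X Y p (Prob_action X a g \<Lambda>) \<in> states Y"
    using push_state[OF p] Prob_action_closed[OF TG X g L] by (simp add: flow_Prob_eq_states[OF X])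
  fix f assume f: "cont Y f"
  show "integ Y (push X Y p (Prob_action X a g \<Lambda>)) f = integ Y (Prob_action Y b g (push X Y p \<Lambda>)) f"
    using integ_Prob_action[OF TG X g L cont_compose[OF p f]] integ_Prob_action[OF TG Y g L' f]
      integ_push[OF p f] integ_push[OF p flow_cont_act[OF TG Y g f]]
      integ_cong[of X "\<lambda>x. f (p (a g x))" "\<lambda>x. f (b g (p x))" \<Lambda>] eq by simp
qed

section \<open>Separation of points in locally convex spaces\<close>

text \<open>
  The inequality \<open>p (c x) \<le> c p x\<close> is equivalent to homogeneity (lemma \<open>sublinear_scale_eq\<close>) and easier
  to establish for infima.
\<close>

definition sublinear :: "('v::real_vector \<Rightarrow> real) \<Rightarrow> bool" where
  "sublinear p \<longleftrightarrow> (\<forall>x y. p (x + y) \<le> p x + p y) \<and> (\<forall>c\<ge>0. \<forall>x. p (c *\<^sub>R x) \<le> c * p x)"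

lemma sublinear_add: "sublinear p \<Longrightarrow> p (x + y) \<le> p x + p y"
  and sublinear_scale: "sublinear p \<Longrightarrow> 0 \<le> c \<Longrightarrow> p (c *\<^sub>R x) \<le> c * p x"
  by (simp_all add: sublinear_def)

lemma sublinear_scale_eq:
  assumes "sublinear p" "0 \<le> c"
  shows "p (c *\<^sub>R x) = c * p x"
proof (cases "c = 0")
  case True
  have "p 0 \<le> p 0 + p 0" using sublinear_add[OF assms(1), of 0 0] by simp
  then show ?thesis using sublinear_scale[OF assms(1), of 0 x] True by simp
next
  case False
  then have "p x \<le> (1 / c) * p (c *\<^sub>R x)"
    using sublinear_scale[OF assms(1), of "1 / c" "c *\<^sub>R x"] assms(2) by simp
  then show ?thesis using sublinear_scale[OF assms, of x] False assms(2) by (simp add: field_simps)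
qed

lemma sublinear_zero: "sublinear p \<Longrightarrow> p 0 = 0"
  using sublinear_scale_eq[of p 0 0] by simp

lemma sublinear_minus: "sublinear p \<Longrightarrow> - p (- x) \<le> p x"
  using sublinear_add[of p x "- x"] sublinear_zero[of p] by simp

text \<open>
  Among the sublinear functionals below \<open>q\<close> this is the one obtained by making \<open>q\<close> as linear as
  possible in the direction \<open>y\<close>: it is below \<open>q\<close>, and its value at \<open>- y\<close> is at most \<open>- q y\<close>.
\<close>

definition directional :: "('v::real_vector \<Rightarrow> real) \<Rightarrow> 'v \<Rightarrow> 'v \<Rightarrow> real" where
  "directional q y x = (INF t\<in>{0..}. q (x + t *\<^sub>R y) - t * q y)"

lemma directional_le:
  assumes "sublinear q" "0 \<le> t"
  shows "directional q y x \<le> q (x + t *\<^sub>R y) - t * q y"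
  unfolding directional_def
proof (rule cINF_lower)
  show "bdd_below ((\<lambda>t. q (x + t *\<^sub>R y) - t * q y) ` {0..})"
  proof (rule bdd_belowI2)
    fix t :: real assume "t \<in> {0..}"
    then show "- q (- x) \<le> q (x + t *\<^sub>R y) - t * q y"
      using sublinear_add[OF assms(1), of "x + t *\<^sub>R y" "- x"] sublinear_scale_eq[OF assms(1), of t y]
      by simp
  qed
qed (use assms in auto)

lemma directional_greatest:
  "(\<And>t. 0 \<le> t \<Longrightarrow> c \<le> q (x + t *\<^sub>R y) - t * q y) \<Longrightarrow> c \<le> directional q y x"
  unfolding directional_def by (rule cINF_greatest) auto

lemma directional_le_self: "sublinear q \<Longrightarrow> directional q y x \<le> q x"
  using directional_le[of q 0 y x] by simp

lemma sublinear_directional: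
  assumes q: "sublinear q"
  shows "sublinear (directional q y)"
  unfolding sublinear_def
proof (intro conjI allI impI)
  fix x x' :: 'a
  have *: "directional q y (x + x') \<le> (q (x + t *\<^sub>R y) - t * q y) + (q (x' + t' *\<^sub>R y) - t' * q y)"
    if "0 \<le> t" "0 \<le> t'" for t t'
    using directional_le[OF q, of "t + t'" y "x + x'"] that
      sublinear_add[OF q, of "x + t *\<^sub>R y" "x' + t' *\<^sub>R y"] by (simp add: algebra_simps)
  have "directional q y (x + x') - (q (x + t *\<^sub>R y) - t * q y) \<le> directional q y x'" if "0 \<le> t" for t
    using *[OF that] by (intro directional_greatest) (simp add: algebra_simps)
  then have "directional q y (x + x') - directional q y x' \<le> directional q y x"
    by (intro directional_greatest) (simp add: algebra_simps)
  then show "directional q y (x + x') \<le> directional q y x + directional q y x'" by simp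
next
  fix c :: real and x :: 'a assume c: "0 \<le> c"
  show "directional q y (c *\<^sub>R x) \<le> c * directional q y x"
  proof (cases "c = 0")
    case True
    then show ?thesis using directional_le_self[OF q, of y 0] sublinear_zero[OF q] by simp
  next
    case False
    have "directional q y (c *\<^sub>R x) / c \<le> directional q y x"
    proof (rule directional_greatest)
      fix t :: real assume t: "0 \<le> t"
      have "directional q y (c *\<^sub>R x) \<le> q (c *\<^sub>R (x + t *\<^sub>R y)) - c * t * q y"
        using directional_le[OF q, of "c * t" y "c *\<^sub>R x"] c t by (simp add: algebra_simps)
      also have "\<dots> = c * (q (x + t *\<^sub>R y) - t * q y)"
        unfolding sublinear_scale_eq[OF q c] by (simp add: algebra_simps)
      finally show "directional q y (c *\<^sub>R x) / c \<le> q (x + t *\<^sub>R y) - t * q y"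
        using False c by (simp add: field_simps)
    qed
    then show ?thesis using False c by (simp add: field_simps)
  qed
qed

lemma sublinear_INF_chain:
  assumes C: "C \<noteq> {}" "\<And>q. q \<in> C \<Longrightarrow> sublinear q \<and> q \<le> p"
    and chain: "\<And>q r. \<lbrakk>q \<in> C; r \<in> C\<rbrakk> \<Longrightarrow> q \<le> r \<or> r \<le> q"
  shows "sublinear (\<lambda>x. INF q\<in>C. q x)" "\<And>q x. q \<in> C \<Longrightarrow> (INF q\<in>C. q x) \<le> q x"
proof -
  let ?m = "\<lambda>x. INF q\<in>C. q x"
  have "bdd_below ((\<lambda>q. q x) ` C)" for x
  proof (rule bdd_belowI2)
    fix q assume q: "q \<in> C"
    then have "q (- x) \<le> p (- x)" using C(2) by (simp add: le_fun_def)
    then show "- p (- x) \<le> q x" using sublinear_minus[of q x] C(2)[OF q] by linarith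
  qed
  then show lower: "?m x \<le> q x" if "q \<in> C" for q x using that by (intro cINF_lower)
  have greatest: "c \<le> ?m x" if "\<And>q. q \<in> C \<Longrightarrow> c \<le> q x" for c x
    using C(1) that by (rule cINF_greatest)
  show "sublinear ?m"
    unfolding sublinear_def
  proof (intro conjI allI impI)
    fix x y
    have *: "?m (x + y) \<le> q x + r y" if qr: "q \<in> C" "r \<in> C" for q r
    proof -
      obtain s where s: "s \<in> C" "s \<le> q" "s \<le> r" using chain[OF qr] qr by blast
      have "?m (x + y) \<le> s (x + y)" by (rule lower[OF s(1)])
      also have "\<dots> \<le> s x + s y" using C(2)[OF s(1)] sublinear_add by blast
      also have "\<dots> \<le> q x + r y" using s(2,3) by (simp add: le_fun_def add_mono)
      finally show ?thesis .
    qed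
    have "?m (x + y) - q x \<le> ?m y" if "q \<in> C" for q
      using *[OF that] by (intro greatest) (simp add: algebra_simps)
    then have "?m (x + y) - ?m y \<le> ?m x" by (intro greatest) (simp add: algebra_simps)
    then show "?m (x + y) \<le> ?m x + ?m y" by simp
  next
    fix c :: real and x assume c: "0 \<le> c"
    have le: "?m (c *\<^sub>R x) \<le> c * q x" if "q \<in> C" for q
      using lower[OF that] sublinear_scale[of q c x] C(2)[OF that] c order_trans by blast
    show "?m (c *\<^sub>R x) \<le> c * ?m x"
    proof (cases "c = 0")
      case True
      then show ?thesis using le C(1) by fastforce
    next
      case False
      then have "?m (c *\<^sub>R x) / c \<le> ?m x"
        using le c by (intro greatest) (simp add: field_simps)
      then show ?thesis using False c by (simp add: field_simps)
    qed
  qed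
qed

text \<open>
  The Hahn-Banach theorem. By Zorn's lemma there is a minimal sublinear functional below \<open>p\<close>. It
  coincides with its own modifications in all directions, and this says that it is additive.
\<close>

lemma linear_below_sublinear:
  assumes p: "sublinear p"
  obtains f where "linear f" "\<And>x. f x \<le> p x"
proof -
  let ?S = "{q. sublinear q \<and> q \<le> p}" and ?R = "\<lambda>q q' :: 'a \<Rightarrow> real. q' \<le> q"
  have "\<exists>m\<in>?S. \<forall>q\<in>?S. ?R m q \<longrightarrow> q = m"
  proof (rule predicate_Zorn)
    show "partial_order_on ?S (relation_of ?R ?S)"
      by (rule partial_order_on_relation_ofI) auto
    fix C assume C: "C \<in> Chains (relation_of ?R ?S)"
    then have *: "\<And>q. q \<in> C \<Longrightarrow> sublinear q \<and> q \<le> p" "\<And>q r. \<lbrakk>q \<in> C; r \<in> C\<rbrakk> \<Longrightarrow> q \<le> r \<or> r \<le> q"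
      by (fastforce simp: Chains_def relation_of_def)+
    show "\<exists>u\<in>?S. \<forall>a\<in>C. ?R a u"
    proof (cases "C = {}")
      case True
      then show ?thesis using p by blast
    next
      case False
      have m: "sublinear (\<lambda>x. INF q\<in>C. q x)" "\<And>q x. q \<in> C \<Longrightarrow> (INF q\<in>C. q x) \<le> q x"
        using sublinear_INF_chain[of C p] False * by blast+
      obtain q where q: "q \<in> C" using False by blast
      have "(INF q\<in>C. q x) \<le> p x" for x
        using m(2)[OF q] *(1)[OF q] by (meson le_funD order_trans)
      then show ?thesis
        using m by (intro bexI[of _ "\<lambda>x. INF q\<in>C. q x"]) (auto simp: le_fun_def)
    qed
  qed
  then obtain q where q: "sublinear q" "q \<le> p"
    and m: "\<And>r. \<lbrakk>sublinear r; r \<le> p; r \<le> q\<rbrakk> \<Longrightarrow> r = q" by blast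
  have min: "r = q" if "sublinear r" "r \<le> q" for r using m[of r] that order_trans[OF that(2) q(2)] by blast
  have add: "q (x + y) = q x + q y" for x y
  proof (rule antisym)
    have "directional q y = q"
      using sublinear_directional[OF q(1)] directional_le_self[OF q(1)] by (intro min) (auto simp: le_fun_def)
    then show "q x + q y \<le> q (x + y)" using directional_le[OF q(1), of 1 y x] by simp
  qed (rule sublinear_add[OF q(1)])
  have neg: "q (- x) = - q x" for x using add[of x "- x"] sublinear_zero[OF q(1)] by simp
  have "q (c *\<^sub>R x) = c * q x" for c x
  proof (cases "0 \<le> c")
    case True
    then show ?thesis by (rule sublinear_scale_eq[OF q(1)])
  next
    case False
    then show ?thesis using sublinear_scale_eq[OF q(1), of "- c" x] neg[of "c *\<^sub>R x"] by simp
  qed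
  then have "linear q" using add by (intro linearI) auto
  then show ?thesis using that q(2) by (auto simp: le_fun_def)
qed

lemma continuous_scaleR_lcs: "continuous_on UNIV (\<lambda>x :: 'v::locally_convex_space. c *\<^sub>R x)"
  unfolding continuous_on_def
proof
  fix x :: 'v
  have "((\<lambda>y. (c, y)) \<longlongrightarrow> (c, x)) (at x)" by (rule tendsto_Pair) auto
  then have "filterlim (\<lambda>y. (c, y)) (nhds c \<times>\<^sub>F nhds x) (at x)" by (simp add: nhds_prod)
  from filterlim_compose[OF tendsto_scaleR_Pair this]
  show "((\<lambda>x. c *\<^sub>R x) \<longlongrightarrow> c *\<^sub>R x) (at x within UNIV)" by simp
qed

lemma tendsto_scaleR_left_lcs: "((\<lambda>s. s *\<^sub>R x) \<longlongrightarrow> 0) (at_right (0::real))" for x :: "'v::locally_convex_space"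
proof -
  have "((\<lambda>s. (s, x)) \<longlongrightarrow> (0, x)) (at_right (0::real))" by (rule tendsto_Pair) auto
  then have "filterlim (\<lambda>s. (s, x)) (nhds 0 \<times>\<^sub>F nhds x) (at_right (0::real))" by (simp add: nhds_prod)
  from filterlim_compose[OF tendsto_scaleR_Pair this] show ?thesis by simp
qed

text \<open>
  The infimum of this set is the Minkowski functional of \<open>V\<close> at \<open>x\<close>.
\<close>

definition gauge_at :: "'v::real_vector set \<Rightarrow> 'v \<Rightarrow> real set" where
  "gauge_at V x = {t. 0 < t \<and> (1 / t) *\<^sub>R x \<in> V}"

lemma minkowski_gauge:
  fixes V :: "'v::locally_convex_space set"
  assumes V: "open V" "convex V" "0 \<in> V"
  shows "sublinear (\<lambda>x. Inf (gauge_at V x))" "\<And>x. x \<in> V \<Longrightarrow> Inf (gauge_at V x) \<le> 1"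
    "\<And>x. x \<notin> V \<Longrightarrow> 1 \<le> Inf (gauge_at V x)"
proof -
  let ?p = "\<lambda>x. Inf (gauge_at V x)"
  have ne: "gauge_at V x \<noteq> {}" for x
  proof -
    have "eventually (\<lambda>s. s *\<^sub>R x \<in> V) (at_right (0::real))"
      using topological_tendstoD[OF tendsto_scaleR_left_lcs V(1,3)] .
    then obtain b :: real where "b > 0" "\<And>s. \<lbrakk>0 < s; s < b\<rbrakk> \<Longrightarrow> s *\<^sub>R x \<in> V"
      unfolding eventually_at_right_field by auto
    then have "2 / b \<in> gauge_at V x" by (simp add: gauge_at_def)
    then show ?thesis by blast
  qed
  have bdd: "bdd_below (gauge_at V x)" for x by (rule bdd_belowI[of _ 0]) (auto simp: gauge_at_def)
  have lower: "?p x \<le> t" if "t \<in> gauge_at V x" for t x using cInf_lower[OF that bdd] .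
  have greatest: "c \<le> ?p x" if "\<And>t. t \<in> gauge_at V x \<Longrightarrow> c \<le> t" for c x
    using ne that by (rule cInf_greatest)
  show "?p x \<le> 1" if "x \<in> V" for x using that by (intro lower) (simp add: gauge_at_def)
  show "1 \<le> ?p x" if "x \<notin> V" for x
  proof (rule greatest, rule ccontr)
    fix t assume t: "t \<in> gauge_at V x" "\<not> 1 \<le> t"
    have "t *\<^sub>R ((1 / t) *\<^sub>R x) + (1 - t) *\<^sub>R 0 \<in> V"
      using t V by (intro convexD[OF V(2)]) (auto simp: gauge_at_def)
    then show False using that t by (simp add: gauge_at_def)
  qed
  show "sublinear ?p"
    unfolding sublinear_def
  proof (intro conjI allI impI)
    fix x y :: 'v
    have *: "?p (x + y) \<le> s + t" if "s \<in> gauge_at V x" "t \<in> gauge_at V y" for s t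
    proof (rule lower)
      have st: "0 < s" "0 < t" using that by (auto simp: gauge_at_def)
      have "(s / (s + t)) *\<^sub>R ((1 / s) *\<^sub>R x) + (t / (s + t)) *\<^sub>R ((1 / t) *\<^sub>R y) \<in> V"
        using that st by (intro convexD[OF V(2)]) (auto simp: gauge_at_def add_divide_distrib[symmetric])
      then show "s + t \<in> gauge_at V (x + y)"
        using st by (simp add: gauge_at_def scaleR_add_right)
    qed
    have "?p (x + y) - s \<le> ?p y" if "s \<in> gauge_at V x" for s
      using *[OF that] by (intro greatest) (simp add: algebra_simps)
    then have "?p (x + y) - ?p y \<le> ?p x" by (intro greatest) (simp add: algebra_simps)
    then show "?p (x + y) \<le> ?p x + ?p y" by simp
  next
    fix c :: real and x :: 'v assume c: "0 \<le> c"
    show "?p (c *\<^sub>R x) \<le> c * ?p x"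
    proof (cases "c = 0")
      case True
      have "?p 0 \<le> e" if "0 < e" for e using that V(3) by (intro lower) (simp add: gauge_at_def)
      then have "?p 0 \<le> 0" by (rule field_le_epsilon[of _ "0::real", simplified])
      then show ?thesis using True by simp
    next
      case False
      have "?p (c *\<^sub>R x) / c \<le> ?p x"
      proof (rule greatest)
        fix t assume "t \<in> gauge_at V x"
        then have "c * t \<in> gauge_at V (c *\<^sub>R x)" using c False by (simp add: gauge_at_def)
        then show "?p (c *\<^sub>R x) / c \<le> t" using lower c False by (fastforce simp: field_simps)
      qed
      then show ?thesis using c False by (simp add: field_simps)
    qed
  qed
qed

lemma continuous_linear_bounded_nhd:
  fixes f :: "'v::locally_convex_space \<Rightarrow> real"
  assumes f: "linear f" and W: "open W" "0 \<in> W" "\<And>x. x \<in> W \<Longrightarrow> f x \<le> 1"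
  shows "continuous_on UNIV f"
proof -
  have "cont euclidean f"
    unfolding cont_iff
  proof (intro ballI allI impI)
    fix x :: 'v and e :: real assume e: "0 < e"
    let ?h = "\<lambda>c y. c *\<^sub>R (y - x)"
    have h: "continuous_on UNIV (?h c)" for c
      by (rule continuous_on_compose2[OF continuous_scaleR_lcs[of c]]) (auto intro!: continuous_intros)
    have op: "open (?h c -` W)" for c
      using h[of c] W(1) by (auto simp: continuous_on_open_vimage)
    let ?U = "?h (2 / e) -` W \<inter> ?h (- 2 / e) -` W"
    have "\<bar>f y - f x\<bar> < e" if "y \<in> ?U" for y
    proof -
      have "(2 / e) * (f y - f x) \<le> 1" "(- 2 / e) * (f y - f x) \<le> 1"
        using that W(3)[of "?h (2 / e) y"] W(3)[of "?h (- 2 / e) y"]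
          linear_diff[OF f, of y x] linear_scale[OF f, of "2 / e" "y - x"] linear_scale[OF f, of "- 2 / e" "y - x"]
        by auto
      then have "f y - f x \<le> e / 2" "f x - f y \<le> e / 2" using e by (simp_all add: field_simps)
      then show ?thesis using e by linarith
    qed
    then show "\<exists>U. openin euclidean U \<and> x \<in> U \<and> (\<forall>y\<in>U. \<bar>f y - f x\<bar> < e)"
      using open_Int[OF op[of "2 / e"] op[of "- 2 / e"]] W(2) by (intro exI[of _ ?U]) auto
  qed
  then show ?thesis by simp
qed

text \<open>
  The gauge \<open>p\<close> of a convex neighbourhood of \<open>0\<close> that misses \<open>x - y\<close> is at least \<open>1\<close> at \<open>x - y\<close>. A
  linear functional below the modification of \<open>p\<close> in the direction \<open>x - y\<close> takes a value of at least \<open>1\<close>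
  there, and it is continuous because it is bounded by \<open>1\<close> on the neighbourhood.
\<close>

theorem separating_functional:
  fixes x y :: "'v::locally_convex_space"
  assumes "x \<noteq> y"
  obtains f :: "'v \<Rightarrow> real" where "linear f" "continuous_on UNIV f" "f x \<noteq> f y"
proof -
  let ?z = "x - y"
  have "?z \<noteq> 0" using assms by simp
  then obtain U where "open U" "0 \<in> U" "?z \<notin> U" using separated by (metis disjoint_iff)
  then obtain V where V: "open V" "convex V" "0 \<in> V" "?z \<notin> V" using locally_convex by (metis subsetD)
  note p = minkowski_gauge[OF V(1-3)]
  let ?p = "\<lambda>x. Inf (gauge_at V x)"
  obtain f where f: "linear f" "\<And>w. f w \<le> directional ?p ?z w"
    using linear_below_sublinear[OF sublinear_directional[OF p(1)]] by blast
  have "f (- ?z) \<le> - ?p ?z"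
    using f(2)[of "- ?z"] directional_le[OF p(1), of 1 ?z "- ?z"] sublinear_zero[OF p(1)] by simp
  then have "f ?z \<noteq> 0" using p(3)[OF V(4)] linear_neg[OF f(1), of ?z] by simp
  moreover have "continuous_on UNIV f"
    using f(2) directional_le_self[OF p(1)] p(2)
    by (intro continuous_linear_bounded_nhd[OF f(1) V(1,3)]) (meson order_trans)
  ultimately show ?thesis using that[OF f(1)] linear_diff[OF f(1), of x y] by simp
qed

lemma linear_imp_affine_on: "linear f \<Longrightarrow> affine_on K f"
  by (simp add: affine_on_def linear_add linear_scale)

corollary affine_functions_separate:
  fixes x y :: "'v::locally_convex_space"
  assumes "\<And>a :: 'v \<Rightarrow> real. \<lbrakk>continuous_on K a; affine_on K a\<rbrakk> \<Longrightarrow> a x = a y"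
  shows "x = y"
proof (rule ccontr)
  assume "x \<noteq> y"
  then obtain f :: "'v \<Rightarrow> real" where "linear f" "continuous_on UNIV f" "f x \<noteq> f y"
    by (rule separating_functional)
  then show False using assms linear_imp_affine_on continuous_on_subset by blast
qed

section \<open>Barycenters\<close>

text \<open>
  Here \<open>M\<close> is a state on \<open>K\<close>. Testing against affine functions, rather than restrictions of linear
  functionals, makes barycenters visibly compatible with affine maps.
\<close>

definition barycenter_of :: "'v::locally_convex_space set \<Rightarrow> (('v \<Rightarrow> real) \<Rightarrow> real) \<Rightarrow> 'v \<Rightarrow> bool" where
  "barycenter_of K M b \<longleftrightarrow> b \<in> K \<and>
     (\<forall>a. continuous_on K a \<longrightarrow> affine_on K a \<longrightarrow> integ (top_of_set K) M a = a b)"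

lemma barycenterD:
  "\<lbrakk>barycenter_of K M b; continuous_on K a; affine_on K a\<rbrakk> \<Longrightarrow> integ (top_of_set K) M a = a b"
  by (simp add: barycenter_of_def)

lemma nonneg_of_small_perturbation:
  fixes s q :: real
  assumes "\<And>t. \<lbrakk>0 < t; t \<le> 1\<rbrakk> \<Longrightarrow> 0 \<le> 2 * s + t * q" "0 \<le> q"
  shows "0 \<le> s"
proof (rule ccontr)
  assume s: "\<not> 0 \<le> s"
  let ?t = "min 1 (- s / (q + 1))"
  have "?t * q \<le> (- s / (q + 1)) * q" using assms(2) by (intro mult_right_mono) auto
  also have "\<dots> \<le> - s" using assms(2) s by (simp add: field_simps)
  finally have "2 * s + ?t * q < 0" using s by linarith
  then show False using assms(1)[of ?t] assms(2) s by (simp add: divide_neg_pos)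
qed

text \<open>
  For finitely many affine functions \<open>a\<close> let \<open>b\<close> minimize the sum of the squares of \<open>a b - M a\<close> over \<open>K\<close>,
  and put \<open>c a = a b - M a\<close>. Minimality says that the affine function \<open>\<Sum>a\<in>A. c a * (a y - a b)\<close> of \<open>y\<close> is
  nonnegative on \<open>K\<close>. Its integral, which is minus the minimum itself, is then nonnegative as well.
\<close>

lemma barycenter_finite:
  fixes K :: "'v::locally_convex_space set"
  assumes K: "compact K" "convex K" "K \<noteq> {}" and M: "M \<in> states (top_of_set K)"
    and A: "finite A" "\<And>a. a \<in> A \<Longrightarrow> continuous_on K a \<and> affine_on K a"
  obtains b where "b \<in> K" "\<And>a. a \<in> A \<Longrightarrow> integ (top_of_set K) M a = a b"
proof -
  let ?m = "integ (top_of_set K) M"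
  let ?\<Phi> = "\<lambda>b. \<Sum>a\<in>A. (a b - ?m a)\<^sup>2"
  have "continuous_on K ?\<Phi>" using A by (intro continuous_intros) auto
  then obtain b where b: "b \<in> K" "\<And>y. y \<in> K \<Longrightarrow> ?\<Phi> b \<le> ?\<Phi> y"
    using continuous_attains_inf[OF K(1,3)] by blast
  define c where "c a = a b - ?m a" for a
  have S1: "0 \<le> (\<Sum>a\<in>A. c a * (a y - a b))" if y: "y \<in> K" for y
  proof (rule nonneg_of_small_perturbation)
    let ?S2 = "\<Sum>a\<in>A. (a y - a b)\<^sup>2"
    show "0 \<le> ?S2" by (intro sum_nonneg) auto
    fix t :: real assume t: "0 < t" "t \<le> 1"
    have "(1 - t) *\<^sub>R b + t *\<^sub>R y \<in> K" using K(2) b(1) y t by (auto simp: convex_alt)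
    then have "?\<Phi> b \<le> ?\<Phi> ((1 - t) *\<^sub>R b + t *\<^sub>R y)" by (rule b(2))
    also have "\<dots> = (\<Sum>a\<in>A. (c a + t * (a y - a b))\<^sup>2)"
    proof (rule sum.cong)
      fix a assume "a \<in> A"
      then have eq: "a ((1 - t) *\<^sub>R b + t *\<^sub>R y) = (1 - t) * a b + t * a y"
        using A(2) b(1) y t by (auto simp: affine_on_def)
      show "(a ((1 - t) *\<^sub>R b + t *\<^sub>R y) - ?m a)\<^sup>2 = (c a + t * (a y - a b))\<^sup>2"
        unfolding eq by (simp add: c_def algebra_simps)
    qed simp
    also have "\<dots> = ?\<Phi> b + t * (2 * (\<Sum>a\<in>A. c a * (a y - a b)) + t * ?S2)"
      by (simp add: c_def power2_eq_square sum.distrib sum_distrib_left algebra_simps sum_subtractf)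
    finally have "0 \<le> t * (2 * (\<Sum>a\<in>A. c a * (a y - a b)) + t * ?S2)" by simp
    then show "0 \<le> 2 * (\<Sum>a\<in>A. c a * (a y - a b)) + t * ?S2"
      using t(1) by (simp add: zero_le_mult_iff)
  qed
  have ca: "cont (top_of_set K) (\<lambda>y. a y - a b)" if "a \<in> A" for a
    using A(2)[OF that] by (auto intro!: continuous_intros)
  have "0 \<le> ?m (\<lambda>y. \<Sum>a\<in>A. c a * (a y - a b))"
    using S1 by (intro integ_nonneg[OF M] continuous_map_sum[OF A(1)] continuous_map_real_mult_left ca) auto
  also have "\<dots> = (\<Sum>a\<in>A. ?m (\<lambda>y. c a * (a y - a b)))"
    by (intro integ_sum[OF M A(1)] continuous_map_real_mult_left ca)
  also have "\<dots> = (\<Sum>a\<in>A. - (c a)\<^sup>2)"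
  proof (rule sum.cong)
    fix a assume a: "a \<in> A"
    have "?m (\<lambda>y. c a * (a y - a b)) = c a * (?m a - a b)"
      using integ_scale[OF M ca[OF a]] integ_diff[OF M, of a "\<lambda>_. a b"] A(2)[OF a]
      by (simp add: integ_const[OF M])
    then show "?m (\<lambda>y. c a * (a y - a b)) = - (c a)\<^sup>2" by (simp add: c_def power2_eq_square algebra_simps)
  qed simp
  finally have "(\<Sum>a\<in>A. (c a)\<^sup>2) = 0"
    by (simp add: sum_negf sum_nonneg antisym)
  then have "c a = 0" if "a \<in> A" for a using sum_nonneg_eq_0_iff[of A "\<lambda>a. (c a)\<^sup>2"] A(1) that by simp
  then show ?thesis using that[OF b(1)] by (simp add: c_def)
qed

theorem barycenter_exists:
  fixes K :: "'v::locally_convex_space set"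
  assumes K: "compact K" "convex K" "K \<noteq> {}" and M: "M \<in> states (top_of_set K)"
  obtains b where "barycenter_of K M b"
proof -
  let ?A = "{a. continuous_on K a \<and> affine_on K a}"
  let ?E = "\<lambda>a. {b \<in> K. a b = integ (top_of_set K) M a}"
  let ?\<U> = "insert K (?E ` ?A)"
  have "\<Inter>?\<U> \<noteq> {}"
  proof (rule compact_space_fip[THEN iffD1, rule_format])
    show "compact_space (top_of_set K)" using K(1) by simp
    have "closedin (top_of_set K) (?E a)" if "continuous_on K a" for a
      using continuous_closedin_preimage_constant[OF that] .
    then show "(\<forall>C\<in>?\<U>. closedin (top_of_set K) C) \<and> (\<forall>\<F>. finite \<F> \<and> \<F> \<subseteq> ?\<U> \<longrightarrow> \<Inter>\<F> \<noteq> {})"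
    proof (intro conjI ballI allI impI; (elim conjE)?)
      fix \<F> assume F: "finite \<F>" "\<F> \<subseteq> ?\<U>"
      then have F': "finite (\<F> - {K})" "\<F> - {K} \<subseteq> ?E ` ?A" by auto
      then obtain A where A: "finite A" "A \<subseteq> ?A" "\<F> - {K} = ?E ` A"
        using finite_subset_image[OF F'] by blast
      obtain b where b: "b \<in> K" "\<And>a. a \<in> A \<Longrightarrow> integ (top_of_set K) M a = a b"
        using barycenter_finite[OF K M A(1)] A(2) by blast
      have "b \<in> C" if C: "C \<in> \<F>" for C
      proof (cases "C = K")
        case False
        then have "C \<in> ?E ` A" using C A(3) by blast
        then show ?thesis using b by auto
      qed (use b in simp)
      then show "\<Inter>\<F> \<noteq> {}" by blast
    qed auto
  qed
  then obtain b where "b \<in> \<Inter>?\<U>" by blast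
  then have "barycenter_of K M b" unfolding barycenter_of_def by simp
  then show ?thesis by (rule that)
qed

lemma affine_integ: "affine_on S (\<lambda>\<Lambda>. integ X \<Lambda> f)"
  by (simp add: affine_on_def integ_combination)

text \<open>
  A measure is the barycenter of the measure on the space of measures that it induces through the
  point masses. When \<open>C\<close> is a compact convex set that contains the point masses, this barycenter can be
  formed within \<open>C\<close>, and so every state lies in \<open>C\<close>.
\<close>

lemma barycenter_states_subset:
  assumes C: "compact C" "convex C" "C \<subseteq> states X" "\<And>x. x \<in> topspace X \<Longrightarrow> dirac X x \<in> C"
    and L: "\<Lambda> \<in> states X" and X: "topspace X \<noteq> {}"
  shows "barycenter_of C (push X (top_of_set C) (dirac X) \<Lambda>) \<Lambda>"
proof -
  have d: "continuous_map X (top_of_set C) (dirac X)"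
    using continuous_dirac[of X] C(4) by (auto simp: continuous_map_in_subtopology)
  have "C \<noteq> {}" using C(4) X by blast
  then obtain b where b: "barycenter_of C (push X (top_of_set C) (dirac X) \<Lambda>) b"
    using barycenter_exists[OF C(1,2) _ push_state[OF d L]] by blast
  have "b = \<Lambda>"
  proof (rule states_eqI[OF _ L])
    show "b \<in> states X" using b C(3) by (auto simp: barycenter_of_def)
    fix f assume f: "cont X f"
    have c: "cont (top_of_set C) (\<lambda>\<Lambda>. integ X \<Lambda> f)" by (rule cont_integ[OF f])
    then have "integ X b f = integ (top_of_set C) (push X (top_of_set C) (dirac X) \<Lambda>) (\<lambda>\<Lambda>. integ X \<Lambda> f)"
      using barycenterD[OF b _ affine_integ] by simp
    also have "\<dots> = integ X \<Lambda> (\<lambda>x. integ X (dirac X x) f)" by (rule integ_push[OF d c])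
    also have "\<dots> = integ X \<Lambda> f" using f by (intro integ_cong) simp
    finally show "integ X b f = integ X \<Lambda> f" .
  qed
  then show ?thesis using b by simp
qed

corollary closed_convex_with_diracs:
  assumes "compact C" "convex C" "C \<subseteq> states X" "\<And>x. x \<in> topspace X \<Longrightarrow> dirac X x \<in> C"
    and "topspace X \<noteq> {}"
  shows "C = states X"
  using barycenter_states_subset[OF assms(1-4) _ assms(5)] assms(3) by (auto simp: barycenter_of_def)

text \<open>
  A compact space carries the coarsest topology that makes a given separating family of continuous
  functions continuous. It is used with the affine functions, to see that barycenters depend
  continuously on the measure.
\<close>

lemma continuous_map_by_separating:
  assumes Y: "compact_space Y" and A: "\<And>a. a \<in> A \<Longrightarrow> cont Y a"
    and sep: "\<And>x y. \<lbrakk>x \<in> topspace Y; y \<in> topspace Y; \<And>a. a \<in> A \<Longrightarrow> a x = a y\<rbrakk> \<Longrightarrow> x = y"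
    and F: "\<And>z. z \<in> topspace Z \<Longrightarrow> F z \<in> topspace Y" "\<And>a. a \<in> A \<Longrightarrow> cont Z (\<lambda>z. a (F z))"
  shows "continuous_map Z Y F"
proof -
  let ?P = "product_topology (\<lambda>_. euclideanreal) A"
  let ?e = "\<lambda>y. \<lambda>a\<in>A. a y"
  have e: "continuous_map Y ?P ?e"
    using A by (auto simp: continuous_map_componentwise)
  have inj: "inj_on ?e (topspace Y)"
  proof (rule inj_onI)
    fix x y assume xy: "x \<in> topspace Y" "y \<in> topspace Y" "?e x = ?e y"
    have "a x = a y" if "a \<in> A" for a using fun_cong[OF xy(3), of a] that by simp
    then show "x = y" using sep xy by blast
  qed
  have "Hausdorff_space ?P" by (simp add: Hausdorff_space_product_topology)
  then have "embedding_map Y ?P ?e" using continuous_imp_embedding_map[OF e Y _ inj] by blast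
  then obtain k where k: "continuous_map (subtopology ?P (?e ` topspace Y)) Y k"
      "\<And>y. y \<in> topspace Y \<Longrightarrow> k (?e y) = y"
    unfolding embedding_map_def homeomorphic_map_maps homeomorphic_maps_def by blast
  have "continuous_map Z ?P (\<lambda>z. ?e (F z))"
    using F(2) by (auto simp: continuous_map_componentwise)
  then have "continuous_map Z (subtopology ?P (?e ` topspace Y)) (\<lambda>z. ?e (F z))"
    using F(1) by (auto simp: continuous_map_in_subtopology)
  from continuous_map_compose[OF this k(1)] show ?thesis
    using k(2) F(1) by (auto elim: continuous_map_eq)
qed

section \<open>Minimal closed sets and extreme points\<close>

lemma minimal_closed_member:
  assumes X: "compact_space X" and S0: "S0 \<in> \<F>"
    and closed: "\<And>A. A \<in> \<F> \<Longrightarrow> closedin X A \<and> A \<noteq> {}"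
    and Inter: "\<And>\<C>. \<lbrakk>\<C> \<subseteq> \<F>; \<C> \<noteq> {}; \<Inter>\<C> \<noteq> {}\<rbrakk> \<Longrightarrow> \<Inter>\<C> \<in> \<F>"
  obtains M where "M \<in> \<F>" "\<And>A. \<lbrakk>A \<in> \<F>; A \<subseteq> M\<rbrakk> \<Longrightarrow> A = M"
proof -
  have "\<exists>m\<in>\<F>. \<forall>a\<in>\<F>. a \<subseteq> m \<longrightarrow> a = m"
  proof (rule predicate_Zorn)
    show "partial_order_on \<F> (relation_of (\<lambda>x y. y \<subseteq> x) \<F>)"
      by (rule partial_order_on_relation_ofI) auto
    fix \<C> assume "\<C> \<in> Chains (relation_of (\<lambda>x y. y \<subseteq> x) \<F>)"
    then have C: "\<C> \<subseteq> \<F>" "\<And>A B. \<lbrakk>A \<in> \<C>; B \<in> \<C>\<rbrakk> \<Longrightarrow> A \<subseteq> B \<or> B \<subseteq> A"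
      by (fastforce simp: Chains_def relation_of_def)+
    show "\<exists>u\<in>\<F>. \<forall>a\<in>\<C>. u \<subseteq> a"
    proof (cases "\<C> = {}")
      case True
      then show ?thesis using S0 by blast
    next
      case False
      have chain: "subset.chain \<F> \<C>" unfolding subset_chain_def using C by blast
      have "\<Inter>\<C> \<noteq> {}"
      proof (rule compact_space_fip[THEN iffD1, rule_format, OF X], intro conjI ballI allI impI)
        fix A assume "A \<in> \<C>"
        then show "closedin X A" using C(1) closed by blast
      next
        fix \<G> assume G: "finite \<G> \<and> \<G> \<subseteq> \<C>"
        show "\<Inter>\<G> \<noteq> {}"
        proof (cases "\<G> = {}")
          case False
          have "subset.chain \<F> \<G>" using chain G unfolding subset_chain_def by blast
          then have "\<Inter>\<G> \<in> \<G>" using Inter_in_chain[of \<G> \<F>] G False by blast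
          then have "\<Inter>\<G> \<in> \<F>" using G C(1) by blast
          then show ?thesis using closed by blast
        qed simp
      qed
      then have "\<Inter>\<C> \<in> \<F>" by (rule Inter[OF C(1) False])
      then show ?thesis by blast
    qed
  qed
  then obtain m where "m \<in> \<F>" "\<forall>a\<in>\<F>. a \<subseteq> m \<longrightarrow> a = m" by (elim bexE)
  then show ?thesis by (intro that[of m]) blast+
qed

text \<open>
  The extremal sets \<open>E\<close> considered here contain both ends of every open segment in \<open>K\<close> that meets \<open>E\<close>. A
  minimal closed one is a singleton, since the set of maximizers of a continuous linear functional on
  \<open>E\<close> is again closed and extremal.
\<close>

theorem extreme_point_exists:
  fixes K :: "'v::locally_convex_space set"
  assumes K: "compact K" "K \<noteq> {}"
  obtains e where "e extreme_point_of K"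
proof -
  let ?ext = "\<lambda>E. \<forall>x\<in>K. \<forall>y\<in>K. \<forall>z\<in>E. z \<in> open_segment x y \<longrightarrow> x \<in> E \<and> y \<in> E"
  let ?\<F> = "{E. closedin (top_of_set K) E \<and> E \<noteq> {} \<and> ?ext E}"
  obtain E where E: "E \<in> ?\<F>" and min: "\<And>A. \<lbrakk>A \<in> ?\<F>; A \<subseteq> E\<rbrakk> \<Longrightarrow> A = E"
  proof (rule minimal_closed_member[of "top_of_set K" K ?\<F>])
    show "compact_space (top_of_set K)" using K by simp
    show "K \<in> ?\<F>" using K by auto
    fix \<C> assume C: "\<C> \<subseteq> ?\<F>" "\<C> \<noteq> {}" "\<Inter>\<C> \<noteq> {}"
    have "closedin (top_of_set K) (\<Inter>\<C>)" using C by (intro closedin_Inter) auto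
    then show "\<Inter>\<C> \<in> ?\<F>" using C by blast
  qed auto
  have EK: "E \<subseteq> K" and cE: "closedin (top_of_set K) E" using E closedin_subset by fastforce+
  obtain e where e: "e \<in> E" using E by blast
  have single: "x = e" if x: "x \<in> E" for x
  proof (rule ccontr)
    assume "x \<noteq> e"
    then obtain f :: "'v \<Rightarrow> real" where f: "linear f" "continuous_on UNIV f" "f x \<noteq> f e"
      by (rule separating_functional)
    have fE: "continuous_on E f" using f(2) continuous_on_subset by blast
    have "compact E" using closedin_compact[OF K(1) cE] .
    then obtain m where m: "m \<in> E" "\<And>y. y \<in> E \<Longrightarrow> f y \<le> f m"
      using continuous_attains_sup[of E f] e fE by blast
    let ?A = "{y \<in> E. f y = f m}"
    have "closedin (top_of_set E) ?A" using continuous_closedin_preimage_constant[OF fE] .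
    then have "closedin (top_of_set K) ?A" using cE closedin_trans by blast
    moreover have "?ext ?A"
    proof (intro ballI impI)
      fix a b z assume ab: "a \<in> K" "b \<in> K" and z: "z \<in> ?A" and seg: "z \<in> open_segment a b"
      have abE: "a \<in> E" "b \<in> E" using E ab z seg by blast+
      obtain u where u: "0 < u" "u < 1" "z = (1 - u) *\<^sub>R a + u *\<^sub>R b" using seg by (auto simp: in_segment)
      have "f m = (1 - u) * f a + u * f b"
        using z u(3) f(1) by (auto simp: linear_add linear_scale)
      then have "(1 - u) * (f m - f a) + u * (f m - f b) = 0" by (simp add: algebra_simps)
      moreover have "0 \<le> (1 - u) * (f m - f a)" "0 \<le> u * (f m - f b)" using m(2) abE u by simp_all
      ultimately have "(1 - u) * (f m - f a) = 0" "u * (f m - f b) = 0" by linarith+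
      then show "a \<in> ?A \<and> b \<in> ?A" using abE u by simp
    qed
    ultimately have "?A \<in> ?\<F>" using m(1) by blast
    then have "?A = E" using min[of ?A] by blast
    then have "f x = f m" "f e = f m" using x e by blast+
    then show False using f(3) by simp
  qed
  have "e extreme_point_of K"
    unfolding extreme_point_of_def
  proof (intro conjI ballI notI)
    show "e \<in> K" using e EK by blast
    fix a b assume "a \<in> K" "b \<in> K" "e \<in> open_segment a b"
    then have "a = e" "b = e" using E e single by blast+
    then show False using \<open>e \<in> open_segment a b\<close> by simp
  qed
  then show ?thesis by (rule that)
qed

lemma extreme_pointD:
  assumes "e extreme_point_of K" "a \<in> K" "b \<in> K" "0 < u" "u < 1" "e = u *\<^sub>R a + (1 - u) *\<^sub>R b"
  shows "a = e"
proof (rule ccontr)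
  assume "a \<noteq> e"
  have "a \<noteq> b"
  proof
    assume "a = b"
    then have "e = a" using assms(6) scaleR_add_left[of u "1 - u" a] by simp
    then show False using \<open>a \<noteq> e\<close> by simp
  qed
  then have "e \<in> open_segment a b"
    unfolding in_segment using assms(4-6) by (intro conjI exI[of _ "1 - u"]) auto
  then show False using assms(1-3) by (auto simp: extreme_point_of_def)
qed

section \<open>Subflows, copies and factors of flows\<close>

lemma flow_subflow:
  assumes fl: "flow G T X act" and G: "group G" and Y: "closedin X Y" "Y \<noteq> {}"
    and inv: "\<And>g y. \<lbrakk>g \<in> carrier G; y \<in> Y\<rbrakk> \<Longrightarrow> act g y \<in> Y" and T: "topspace T = carrier G"
  shows "flow G T (subtopology X Y) (\<lambda>g. restrict (act g) Y)"
proof (rule flowI)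
  have YX: "Y \<subseteq> topspace X" using Y(1) by (rule closedin_subset)
  have top: "topspace (subtopology X Y) = Y" using YX by (rule topspace_subtopology_subset)
  interpret group G by fact
  show "group G" by fact
  show "topspace (subtopology X Y) \<noteq> {}" using top Y by simp
  show "compact_space (subtopology X Y)"
    using closedin_compact_space[OF flow_compact[OF fl] Y(1)] compactin_subspace by blast
  show "Hausdorff_space (subtopology X Y)" by (rule Hausdorff_space_subtopology[OF flow_Hausdorff[OF fl]])
  show "restrict (act g) Y \<in> extensional (topspace (subtopology X Y))" for g unfolding top by simp
  show "restrict (act g) Y x \<in> topspace (subtopology X Y)"
    if "g \<in> carrier G" "x \<in> topspace (subtopology X Y)" for g x using that inv unfolding top by simp
  show "restrict (act \<one>\<^bsub>G\<^esub>) Y x = x" if "x \<in> topspace (subtopology X Y)" for x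
    using that flow_one[OF fl] YX by (auto simp: top)
  show "restrict (act (g \<otimes>\<^bsub>G\<^esub> h)) Y x = restrict (act g) Y (restrict (act h) Y x)"
    if "g \<in> carrier G" "h \<in> carrier G" "x \<in> topspace (subtopology X Y)" for g h x
    using that flow_mult[OF fl] YX inv by (auto simp: top)
  have "continuous_map (prod_topology T (subtopology X Y)) (prod_topology T X) (\<lambda>p. (fst p, snd p))"
    by (intro continuous_map_pairedI continuous_map_fst continuous_map_into_fulltopology[OF continuous_map_snd])
  from continuous_map_compose[OF this flow_continuous[OF fl]]
  have "continuous_map (prod_topology T (subtopology X Y)) X (\<lambda>(g, x). restrict (act g) Y x)"
    by (rule continuous_map_eq) (auto simp: top)
  then show "continuous_map (prod_topology T (subtopology X Y)) (subtopology X Y) (\<lambda>(g, x). restrict (act g) Y x)"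
    using inv by (auto simp: continuous_map_in_subtopology T top)
qed

text \<open>
  Any injection into another type carries a flow along, with the topology pulled back along the
  inverse.
\<close>

lemma flow_copy:
  fixes \<iota> :: "'x \<Rightarrow> 'z"
  assumes fl: "flow G T X act" and G: "group G" and inj: "inj_on \<iota> (topspace X)" and T: "topspace T = carrier G"
  obtains Z :: "'z topology" and act' where
    "flow G T Z act'" "continuous_map X Z \<iota>" "\<iota> ` topspace X = topspace Z"
    "\<And>g x. \<lbrakk>g \<in> carrier G; x \<in> topspace X\<rbrakk> \<Longrightarrow> \<iota> (act g x) = act' g (\<iota> x)"
proof -
  let ?A = "\<iota> ` topspace X" and ?k = "inv_into (topspace X) \<iota>"
  let ?Z = "pullback_topology ?A ?k X"
  let ?act = "\<lambda>g. \<lambda>z\<in>?A. \<iota> (act g (?k z))"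
  interpret group G by fact
  have k: "?k (\<iota> x) = x" if "x \<in> topspace X" for x using inj that by simp
  have top: "topspace ?Z = ?A" using k by (auto simp: topspace_pullback_topology)
  have \<iota>: "continuous_map X ?Z \<iota>"
    unfolding continuous_map_alt
  proof (intro conjI strip)
    fix U assume "openin ?Z U"
    then obtain V where V: "openin X V" "U = ?k -` V \<inter> ?A" by (auto simp: openin_pullback_topology)
    have "\<iota> x \<in> U \<longleftrightarrow> x \<in> V" if "x \<in> topspace X" for x using k[OF that] that by (simp add: V(2))
    then have "\<iota> -` U \<inter> topspace X = V" using openin_subset[OF V(1)] by blast
    then show "openin X (\<iota> -` U \<inter> topspace X)" using V by simp
  qed (simp add: top)
  have kc: "continuous_map ?Z X ?k" using continuous_map_pullback[OF continuous_map_id, of ?A ?k X] by (simp add: id_comp)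
  have act: "?act g (\<iota> x) = \<iota> (act g x)" if "x \<in> topspace X" for g x using that k by simp
  have "flow G T ?Z ?act"
  proof (rule flowI)
    show "group G" by fact
    show "topspace ?Z \<noteq> {}" using flow_nonempty[OF fl] by (simp add: top)
    have "compactin ?Z ?A" using image_compactin[OF _ \<iota>] flow_compact[OF fl] by (simp add: compact_space_def)
    then show "compact_space ?Z" by (simp add: compact_space_def top)
    show "Hausdorff_space ?Z"
      unfolding Hausdorff_space_def top
    proof (intro allI impI)
      fix x y assume xy: "x \<in> ?A \<and> y \<in> ?A \<and> x \<noteq> y"
      then have "?k x \<in> topspace X" "?k y \<in> topspace X" "?k x \<noteq> ?k y" using k by auto
      then obtain U V where UV: "openin X U" "openin X V" "?k x \<in> U" "?k y \<in> V" "disjnt U V"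
        using flow_Hausdorff[OF fl] unfolding Hausdorff_space_def by blast
      have "openin ?Z (?k -` U \<inter> ?A)" "openin ?Z (?k -` V \<inter> ?A)"
        using UV unfolding openin_pullback_topology by blast+
      then show "\<exists>U V. openin ?Z U \<and> openin ?Z V \<and> x \<in> U \<and> y \<in> V \<and> disjnt U V"
        using UV xy by (intro exI[of _ "?k -` U \<inter> ?A"] exI[of _ "?k -` V \<inter> ?A"]) (auto simp: disjnt_def)
    qed
    show "?act g \<in> extensional (topspace ?Z)" for g by (simp add: top)
    show "?act g z \<in> topspace ?Z" if "g \<in> carrier G" "z \<in> topspace ?Z" for g z
      using that flow_closed[OF fl] by (auto simp: top k)
    show "?act \<one>\<^bsub>G\<^esub> z = z" if "z \<in> topspace ?Z" for z
      using that flow_one[OF fl] by (auto simp: top k)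
    show "?act (g \<otimes>\<^bsub>G\<^esub> h) z = ?act g (?act h z)"
      if gh: "g \<in> carrier G" "h \<in> carrier G" and z: "z \<in> topspace ?Z" for g h z
    proof -
      obtain x where x: "x \<in> topspace X" "z = \<iota> x" using z unfolding top by blast
      show ?thesis
        unfolding x(2) act[OF x(1)] act[OF flow_closed[OF fl gh(2) x(1)]] flow_mult[OF fl gh x(1)] ..
    qed
    have "continuous_map (prod_topology T ?Z) (prod_topology T X) (\<lambda>p. (fst p, ?k (snd p)))"
      using continuous_map_compose[OF continuous_map_snd kc]
      by (intro continuous_map_pairedI continuous_map_fst) (simp add: comp_def)
    from continuous_map_compose[OF continuous_map_compose[OF this flow_continuous[OF fl]] \<iota>]
    show "continuous_map (prod_topology T ?Z) ?Z (\<lambda>(g, z). ?act g z)"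
      by (rule continuous_map_eq) (auto simp: top k)
  qed
  then show ?thesis using that[of ?Z ?act] \<iota> act top by simp
qed

lemma Urysohn_point:
  assumes X: "compact_space X" "Hausdorff_space X" and xy: "x \<in> topspace X" "y \<in> topspace X" "x \<noteq> y"
  obtains f where "cont X f" "f x \<noteq> f y"
proof -
  have "normal_space X" using X by (simp add: compact_Hausdorff_or_regular_imp_normal_space)
  moreover have "closedin X {x}" "closedin X {y}" using X(2) xy by (simp_all add: closedin_Hausdorff_sing_eq)
  moreover have "disjnt {x} {y}" using xy by simp
  ultimately obtain f where "continuous_map X (top_of_set {0..1}) f" "f ` {x} \<subseteq> {0::real}" "f ` {y} \<subseteq> {1}"
    by (rule Urysohn_lemma[where a=0 and b=1]) simp_all
  then show ?thesis using that[of f] by (auto simp: continuous_map_in_subtopology)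
qed

text \<open>
  A compact space with a dense orbit is not larger than the type of points of the Samuel
  compactification. A continuous function \<open>f\<close> is determined by its values along the orbit, that is, by a
  function \<open>?F f\<close> on (singletons of) the group. A point \<open>x\<close> is sent to the functional that evaluates at \<open>x\<close>
  the function encoded by its argument.
\<close>

lemma injection_of_transitive_space:
  fixes X :: "'x topology" and orb :: "'g \<Rightarrow> 'x"
  assumes X: "compact_space X" "Hausdorff_space X" and dense: "topspace X \<subseteq> X closure_of (orb ` S)"
  obtains \<iota> :: "'x \<Rightarrow> 'g sa_point" where "inj_on \<iota> (topspace X)"
proof
  let ?F = "\<lambda>f A. if (\<exists>g\<in>S. A = {g}) then complex_of_real (f (orb (the_elem A))) else 0"
  let ?\<iota> = "\<lambda>x F. complex_of_real ((SOME f. cont X f \<and> F = ?F f) x)"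
  have val: "?\<iota> x (?F f) = complex_of_real (f x)" if x: "x \<in> topspace X" and f: "cont X f" for x f
  proof -
    define f' where "f' = (SOME f'. cont X f' \<and> ?F f = ?F f')"
    have f': "cont X f' \<and> ?F f = ?F f'" unfolding f'_def by (rule someI[of _ f]) (use f in simp)
    have "f' x = f x"
    proof (rule forall_in_closure_of_eq[of x X "orb ` S" euclideanreal])
      fix y assume "y \<in> orb ` S"
      then obtain g where g: "g \<in> S" "y = orb g" by blast
      have "?F f {g} = ?F f' {g}" using f' by metis
      then show "f' y = f y" using g by simp
    qed (use f f' x dense in auto)
    then show ?thesis by (simp add: f'_def)
  qed
  show "inj_on ?\<iota> (topspace X)"
  proof (rule inj_onI, rule ccontr)
    fix x y assume xy: "x \<in> topspace X" "y \<in> topspace X" "?\<iota> x = ?\<iota> y" "x \<noteq> y"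
    then obtain f where f: "cont X f" "f x \<noteq> f y" using Urysohn_point[OF X] by blast
    have "?\<iota> x (?F f) = ?\<iota> y (?F f)" using xy(3) by (rule fun_cong)
    then show False using f unfolding val[OF xy(1) f(1)] val[OF xy(2) f(1)] by simp
  qed
qed

lemma proximal_factor:
  assumes prox: "proximal G X a" and p: "continuous_map X Y p" "p ` topspace X = topspace Y"
    and eq: "\<And>g x. \<lbrakk>g \<in> carrier G; x \<in> topspace X\<rbrakk> \<Longrightarrow> p (a g x) = b g (p x)"
  shows "proximal G Y b"
  unfolding proximal_def
proof (intro ballI)
  fix y y' assume "y \<in> topspace Y" "y' \<in> topspace Y"
  then obtain x x' where x: "x \<in> topspace X" "y = p x" and x': "x' \<in> topspace X" "y' = p x'"
    using p(2) by (metis imageE)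
  obtain F z where F: "F \<noteq> bot" "F \<le> principal (carrier G)" "limitin X (\<lambda>g. a g x) z F" "limitin X (\<lambda>g. a g x') z F"
    using prox x(1) x'(1) unfolding proximal_def by blast
  have ev: "eventually (\<lambda>g. g \<in> carrier G) F" using F(2) by (simp add: le_principal)
  have "limitin Y (\<lambda>g. b g (p w)) (p z) F" if "w \<in> topspace X" "limitin X (\<lambda>g. a g w) z F" for w
  proof (rule limitin_transform_eventually[OF _ continuous_map_limit[OF p(1) that(2)]])
    show "eventually (\<lambda>g. (p \<circ> (\<lambda>g. a g w)) g = b g (p w)) F"
      by (rule eventually_mono[OF ev]) (simp add: eq that(1))
  qed
  then show "\<exists>F z. F \<noteq> bot \<and> F \<le> principal (carrier G) \<and> limitin Y (\<lambda>g. b g y) z F \<and> limitin Y (\<lambda>g. b g y') z F"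
    using F x x' by blast
qed

text \<open>
  The image of the states is compact and convex and contains the point masses.
\<close>

lemma push_surj:
  assumes X: "compact_space X" and Y: "topspace Y \<noteq> {}" and p: "continuous_map X Y p" "p ` topspace X = topspace Y"
  shows "push X Y p ` states X = states Y"
proof (rule closed_convex_with_diracs)
  have "continuous_on (states X) (push X Y p)"
    using continuous_push[OF p(1)] by (simp add: continuous_map_in_subtopology)
  then show "compact (push X Y p ` states X)" using compact_states[OF X] by (rule compact_continuous_image)
  show "convex (push X Y p ` states X)"
  proof (rule convexI, elim imageE)
    fix L L' \<Lambda> \<Lambda>' and u v :: real
    assume *: "0 \<le> u" "0 \<le> v" "u + v = 1" "L = push X Y p \<Lambda>" "L' = push X Y p \<Lambda>'" "\<Lambda> \<in> states X" "\<Lambda>' \<in> states X"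
    then have "u *\<^sub>R \<Lambda> + v *\<^sub>R \<Lambda>' \<in> states X" using convexD[OF convex_states] by blast
    then show "u *\<^sub>R L + v *\<^sub>R L' \<in> push X Y p ` states X" using * push_combination by (metis image_eqI)
  qed
  show "push X Y p ` states X \<subseteq> states Y" using push_state[OF p(1)] by blast
  fix y assume "y \<in> topspace Y"
  then obtain x where x: "x \<in> topspace X" "p x = y" using p(2) by (metis imageE)
  then show "dirac Y y \<in> push X Y p ` states X"
    using push_dirac[OF p(1) x(1)] dirac_state[OF x(1)] by (metis image_eqI)
qed (rule Y)

lemma strongly_proximal_factor:
  assumes TG: "topological_group G T" and X: "flow G T X a" and Y: "flow G T Y b"
    and p: "continuous_map X Y p" "p ` topspace X = topspace Y"
    and eq: "\<And>g x. \<lbrakk>g \<in> carrier G; x \<in> topspace X\<rbrakk> \<Longrightarrow> p (a g x) = b g (p x)"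
    and sp: "strongly_proximal G X a"
  shows "strongly_proximal G Y b"
  unfolding strongly_proximal_def
proof (rule proximal_factor[OF sp[unfolded strongly_proximal_def]])
  note PX = flow_Prob_eq_states[OF X] and PY = flow_Prob_eq_states[OF Y]
  show "continuous_map (top_of_set (Prob X)) (top_of_set (Prob Y)) (push X Y p)"
    unfolding PX PY by (rule continuous_push[OF p(1)])
  show "push X Y p ` topspace (top_of_set (Prob X)) = topspace (top_of_set (Prob Y))"
    using push_surj[OF flow_compact[OF X] flow_nonempty[OF Y] p] by (simp add: PX PY)
  fix g \<Lambda> assume "g \<in> carrier G" "\<Lambda> \<in> topspace (top_of_set (Prob X))"
  then show "push X Y p (Prob_action X a g \<Lambda>) = Prob_action Y b g (push X Y p \<Lambda>)"
    using eq by (intro push_equivariant[OF TG X Y p(1)]) auto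
qed

section \<open>Recognizing point masses\<close>

text \<open>
  The functions in \<open>N\<close> are null functions of \<open>\<nu>\<close>, and they vanish simultaneously at most at \<open>e\<close>. By
  compactness a finite sum \<open>s\<close> of them is bounded below by some \<open>m > 0\<close> where \<open>g\<close> differs from \<open>g e\<close> by at
  least \<open>r\<close>. Hence \<open>\<bar>g - g e\<bar> \<le> r + (B / m) * s\<close>, whose integral is \<open>r\<close>.
\<close>

lemma state_eq_dirac:
  assumes X: "compact_space X" and \<nu>: "\<nu> \<in> states X" and e: "e \<in> topspace X"
    and N: "\<And>h. h \<in> N \<Longrightarrow> cont X h \<and> (\<forall>x\<in>topspace X. 0 \<le> h x) \<and> integ X \<nu> h = 0"
    and sep: "\<And>x. \<lbrakk>x \<in> topspace X; x \<noteq> e\<rbrakk> \<Longrightarrow> \<exists>h\<in>N. 0 < h x"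
  shows "\<nu> = dirac X e"
proof (rule states_eqI[OF \<nu> dirac_state[OF e]])
  fix g assume g: "cont X g"
  have "\<bar>integ X \<nu> g - g e\<bar> \<le> r" if r: "0 < r" for r
  proof -
    let ?d = "\<lambda>x. \<bar>g x - g e\<bar>"
    have d: "cont X ?d" using g by (intro continuous_intros) auto
    let ?D = "{x \<in> topspace X. ?d x \<in> {r..}}"
    have D: "compactin X ?D"
      by (intro closedin_compact_space[OF X] closedin_continuous_map_preimage[OF d]) simp
    let ?U = "\<lambda>h. {x \<in> topspace X. h x \<in> {0<..}}"
    have opU: "openin X (?U h)" if "h \<in> N" for h
      using N[OF that] by (intro openin_continuous_map_preimage[of X euclideanreal]) auto
    have cov: "?D \<subseteq> \<Union>(?U ` N)"
    proof
      fix x assume x: "x \<in> ?D"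
      then have "x \<noteq> e" using r by auto
      then show "x \<in> \<Union>(?U ` N)" using sep[of x] x by auto
    qed
    then obtain \<F> where F: "finite \<F>" "\<F> \<subseteq> ?U ` N" "?D \<subseteq> \<Union>\<F>"
      using compactinD[OF D, of "?U ` N"] opU by blast
    obtain N' where N': "finite N'" "N' \<subseteq> N" "\<F> = ?U ` N'" using finite_subset_image[OF F(1,2)] by blast
    let ?s = "\<lambda>x. \<Sum>h\<in>N'. h x"
    have s: "cont X ?s" using N N' by (intro continuous_intros) auto
    have s0: "0 \<le> ?s x" if "x \<in> topspace X" for x using N N' that by (intro sum_nonneg) auto
    have spos: "0 < ?s x" if x: "x \<in> ?D" for x
    proof -
      have "x \<in> \<Union>(?U ` N')" using subsetD[OF F(3) x] unfolding N'(3) .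
      then obtain h where h: "h \<in> N'" "0 < h x" by auto
      then show ?thesis using N N' x by (intro sum_pos2[OF N'(1) h(1), of "\<lambda>h. h x"]) auto
    qed
    have "\<exists>m>0. \<forall>x\<in>?D. m \<le> ?s x"
    proof (cases "?D = {}")
      case False
      have "compact (?s ` ?D)" using image_compactin[OF D s] by simp
      then obtain y where "y \<in> ?s ` ?D" "\<And>z. z \<in> ?s ` ?D \<Longrightarrow> y \<le> z"
        using compact_attains_inf[of "?s ` ?D"] False by blast
      then show ?thesis using spos by (intro exI[of _ y]) auto
    qed (auto intro: exI[of _ 1])
    then obtain m where m: "0 < m" "\<And>x. x \<in> ?D \<Longrightarrow> m \<le> ?s x" by blast
    obtain B where B: "0 < B" "\<And>x. x \<in> topspace X \<Longrightarrow> ?d x \<le> B"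
      using cont_bounded[OF X d] by (metis abs_idempotent)
    have "?d x \<le> r + (B / m) * ?s x" if x: "x \<in> topspace X" for x
    proof (cases "x \<in> ?D")
      case True
      then have "B \<le> (B / m) * ?s x" using m B(1) by (simp add: field_simps)
      then show ?thesis using B(2)[OF x] r by linarith
    next
      case False
      then have "?d x \<le> r" using x by auto
      moreover have "0 \<le> (B / m) * ?s x" using s0[OF x] m(1) B(1) by simp
      ultimately show ?thesis by linarith
    qed
    then have "integ X \<nu> ?d \<le> integ X \<nu> (\<lambda>x. r + (B / m) * ?s x)"
      by (intro integ_mono[OF \<nu> d] continuous_map_add continuous_map_real_mult_left s) auto
    also have "\<dots> = r + (B / m) * integ X \<nu> ?s"
      using integ_add[OF \<nu> _ continuous_map_real_mult_left[OF s], of "\<lambda>_. r" "B / m"]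
      unfolding integ_scale[OF \<nu> s] integ_const[OF \<nu>] by simp
    also have "integ X \<nu> ?s = (\<Sum>h\<in>N'. integ X \<nu> h)" using N N' by (intro integ_sum[OF \<nu>]) auto
    also have "\<dots> = 0" using N N' by (intro sum.neutral) auto
    finally have d_le: "integ X \<nu> ?d \<le> r" by simp
    have c: "cont X (\<lambda>x. g x - g e)" using g by (intro continuous_intros) auto
    have "integ X \<nu> (\<lambda>x. g x - g e) \<le> integ X \<nu> ?d" by (intro integ_mono[OF \<nu> c d]) auto
    moreover have "integ X \<nu> (\<lambda>x. -1 * (g x - g e)) \<le> integ X \<nu> ?d"
      by (intro integ_mono[OF \<nu> continuous_map_real_mult_left[OF c] d]) auto
    ultimately show ?thesis
      using d_le integ_diff[OF \<nu> g, of "\<lambda>_. g e"]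
      unfolding integ_scale[OF \<nu> c] by (simp add: integ_const[OF \<nu>])
  qed
  then have "integ X \<nu> g = g e" using field_le_epsilon[of "\<bar>integ X \<nu> g - g e\<bar>" 0] by simp
  then show "integ X \<nu> g = integ X (dirac X e) g" using e g by simp
qed

text \<open>
  The measure with density \<open>w\<close>, normalized.
\<close>

definition tilt :: "'x topology \<Rightarrow> ('x \<Rightarrow> real) \<Rightarrow> (('x \<Rightarrow> real) \<Rightarrow> real) \<Rightarrow> (('x \<Rightarrow> real) \<Rightarrow> real)" where
  "tilt X w \<Lambda> = (\<lambda>f. if f \<in> continuous_functions X then integ X \<Lambda> (\<lambda>x. w x * f x) / integ X \<Lambda> w else 0)"

lemma integ_tilt:
  assumes "cont X f"
  shows "integ X (tilt X w \<Lambda>) f = integ X \<Lambda> (\<lambda>x. w x * f x) / integ X \<Lambda> w"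
  unfolding integ_def[of X "tilt X w \<Lambda>"]
  unfolding tilt_def
  using assms integ_cong[of X "\<lambda>x. w x * restrict f (topspace X) x" "\<lambda>x. w x * f x"] by simp

lemma tilt_state:
  assumes L: "\<Lambda> \<in> states X" and w: "cont X w" "\<And>x. x \<in> topspace X \<Longrightarrow> 0 \<le> w x" "0 < integ X \<Lambda> w"
  shows "tilt X w \<Lambda> \<in> states X"
proof -
  have c: "cont X (\<lambda>x. w x * f x)" if "cont X f" for f using w(1) that by (intro continuous_intros)
  have "integ X \<Lambda> (\<lambda>x. w x * (f x + g x)) = integ X \<Lambda> (\<lambda>x. w x * f x) + integ X \<Lambda> (\<lambda>x. w x * g x)"
    if "cont X f" "cont X g" for f g
    using integ_add[OF L c[OF that(1)] c[OF that(2)]] by (simp add: algebra_simps)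
  moreover have "integ X \<Lambda> (\<lambda>x. w x * (r * f x)) = r * integ X \<Lambda> (\<lambda>x. w x * f x)" if "cont X f" for f r
    using integ_scale[OF L c[OF that], of r] by (simp add: algebra_simps)
  moreover have "0 \<le> integ X \<Lambda> (\<lambda>x. w x * f x)" if "cont X f" "\<forall>x\<in>topspace X. 0 \<le> f x" for f
    using w(2) that by (intro integ_nonneg[OF L c]) auto
  ultimately show ?thesis
    using w(3) unfolding states_def[of X] mem_Collect_eq
    by (auto simp: integ_tilt continuous_intros add_divide_distrib) (simp add: tilt_def)
qed

text \<open>
  Bauer's theorem: an extreme point is the barycenter of its point mass only. For a weight \<open>w\<close> with
  values strictly between \<open>0\<close> and \<open>1\<close> the state \<open>\<nu>\<close> is a proper convex combination of its tilts by \<open>w\<close> and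
  \<open>1 - w\<close>, and so are the barycenters; both barycenters are therefore \<open>e\<close>, which reads
  \<open>\<nu> (w a) = \<nu> w * a e\<close> for affine \<open>a\<close>. Taking for \<open>w\<close> a rescaled copy of \<open>a\<close> itself shows that
  \<open>(a - a e)\<^sup>2\<close> has integral \<open>0\<close>.
\<close>

theorem bauer:
  fixes Q :: "'v::locally_convex_space set"
  assumes Q: "compact Q" "convex Q" and e: "e extreme_point_of Q" and Y: "compact Y" "Y \<subseteq> Q" "e \<in> Y"
    and \<nu>: "\<nu> \<in> states (top_of_set Y)"
    and bar: "barycenter_of Q (push (top_of_set Y) (top_of_set Q) id \<nu>) e"
  shows "\<nu> = dirac (top_of_set Y) e"
proof -
  let ?I = "integ (top_of_set Y)"
  have Qne: "Q \<noteq> {}" using Y by blast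
  have j: "continuous_map (top_of_set Y) (top_of_set Q) id"
    using Y(2) by (auto simp: continuous_map_in_subtopology)
  have jI: "integ (top_of_set Q) (push (top_of_set Y) (top_of_set Q) id \<Lambda>) a = ?I \<Lambda> a"
    if "continuous_on Q a" for a \<Lambda> using integ_push[OF j, of a \<Lambda>] that by simp
  have aY: "cont (top_of_set Y) a" if "continuous_on Q a" for a :: "'v \<Rightarrow> real"
    using continuous_on_subset[OF that Y(2)] by simp
  have split: "?I \<nu> (\<lambda>y. w y * a y) = ?I \<nu> w * a e"
    if w: "cont (top_of_set Y) w" "\<And>y. y \<in> Y \<Longrightarrow> 1/4 \<le> w y \<and> w y \<le> 3/4"
      and a: "continuous_on Q a" "affine_on Q a" for w a
  proof -
    define t where "t = ?I \<nu> w"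
    have "1/4 \<le> t" "t \<le> 3/4"
      using integ_mono[OF \<nu> _ w(1), of "\<lambda>_. 1/4"] integ_mono[OF \<nu> w(1), of "\<lambda>_. 3/4"] w(2)
      by (simp_all add: t_def integ_const[OF \<nu>])
    then have t: "0 < t" "t < 1" by linarith+
    let ?w' = "\<lambda>y. 1 - w y"
    have w': "cont (top_of_set Y) ?w'" using w(1) by (intro continuous_intros) auto
    have t': "?I \<nu> ?w' = 1 - t"
      using integ_diff[OF \<nu> _ w(1), of "\<lambda>_. 1"] by (simp add: integ_const[OF \<nu>] t_def)
    have s1: "tilt (top_of_set Y) w \<nu> \<in> states (top_of_set Y)"
      using w t by (intro tilt_state[OF \<nu>]) (auto simp: t_def[symmetric] intro: order_trans[of 0 "1/4"])
    have "0 \<le> ?w' y" if "y \<in> Y" for y using w(2)[OF that] by linarith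
    then have s2: "tilt (top_of_set Y) ?w' \<nu> \<in> states (top_of_set Y)"
      using t t' by (intro tilt_state[OF \<nu> w']) auto
    obtain b1 where b1: "barycenter_of Q (push (top_of_set Y) (top_of_set Q) id (tilt (top_of_set Y) w \<nu>)) b1"
      using barycenter_exists[OF Q Qne push_state[OF j s1]] by blast
    obtain b2 where b2: "barycenter_of Q (push (top_of_set Y) (top_of_set Q) id (tilt (top_of_set Y) ?w' \<nu>)) b2"
      using barycenter_exists[OF Q Qne push_state[OF j s2]] by blast
    have B: "b1 \<in> Q" "b2 \<in> Q" using b1 b2 by (auto simp: barycenter_of_def)
    have a1: "a b1 = ?I \<nu> (\<lambda>y. w y * a y) / t" if "continuous_on Q a" "affine_on Q a" for a
      using barycenterD[OF b1 that] jI[OF that(1)] integ_tilt[OF aY[OF that(1)], of w \<nu>] by (simp add: t_def)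
    have a2: "a b2 = ?I \<nu> (\<lambda>y. ?w' y * a y) / (1 - t)" if "continuous_on Q a" "affine_on Q a" for a
      using barycenterD[OF b2 that] jI[OF that(1)] integ_tilt[OF aY[OF that(1)], of ?w' \<nu>] by (simp add: t')
    have "e = t *\<^sub>R b1 + (1 - t) *\<^sub>R b2"
    proof (rule affine_functions_separate[of Q])
      fix a :: "'v \<Rightarrow> real" assume a: "continuous_on Q a" "affine_on Q a"
      have "a ((1 - (1 - t)) *\<^sub>R b1 + (1 - t) *\<^sub>R b2) = (1 - (1 - t)) *\<^sub>R a b1 + (1 - t) *\<^sub>R a b2"
        using a(2) B t unfolding affine_on_def by (intro a(2)[unfolded affine_on_def, rule_format]) auto
      then have "a (t *\<^sub>R b1 + (1 - t) *\<^sub>R b2) = ?I \<nu> (\<lambda>y. w y * a y) + ?I \<nu> (\<lambda>y. ?w' y * a y)"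
        using a1[OF a] a2[OF a] t by simp
      also have "\<dots> = ?I \<nu> (\<lambda>y. w y * a y + ?w' y * a y)"
        by (intro integ_add[OF \<nu>, symmetric] continuous_map_real_mult w w' aY a)
      also have "\<dots> = ?I \<nu> a" by (intro integ_cong) (simp add: algebra_simps)
      also have "\<dots> = a e" using barycenterD[OF bar a] jI[OF a(1)] by simp
      finally show "a e = a (t *\<^sub>R b1 + (1 - t) *\<^sub>R b2)" by simp
    qed
    then have "b1 = e" using extreme_pointD[OF e B t] by blast
    then show ?thesis using a1[OF a] t by (simp add: t_def)
  qed
  have zero: "?I \<nu> (\<lambda>y. (a y - a e) * (a y - a e)) = 0" if a: "continuous_on Q a" "affine_on Q a" for a
  proof -
    note ca = aY[OF a(1)]
    obtain B where B: "0 < B" "\<And>y. y \<in> Y \<Longrightarrow> \<bar>a y\<bar> \<le> B"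
      using cont_bounded[OF _ ca] Y(1) by auto
    \<comment> \<open>The scaling maps the range \<open>{-B..B}\<close> of \<open>a\<close> onto \<open>{1/4..3/4}\<close>.\<close>
    let ?w = "\<lambda>y. (1 / (4 * B)) * a y + 1/2"
    have cw: "cont (top_of_set Y) ?w" using ca by (intro continuous_map_add continuous_map_real_mult_left) simp_all
    have "1/4 \<le> ?w y \<and> ?w y \<le> 3/4" if "y \<in> Y" for y
      using abs_le_D1[OF B(2)[OF that]] abs_le_D2[OF B(2)[OF that]] B(1) by (simp add: field_simps)
    then have s: "?I \<nu> (\<lambda>y. ?w y * a y) = ?I \<nu> ?w * a e" by (intro split[OF cw _ a])
    have caa: "cont (top_of_set Y) (\<lambda>y. a y * a y)" by (rule continuous_map_real_mult[OF ca ca])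
    have ae: "?I \<nu> a = a e" using barycenterD[OF bar a] jI[OF a(1)] by simp
    have "?I \<nu> ?w = (1 / (4 * B)) * a e + 1/2"
      using integ_add[OF \<nu> continuous_map_real_mult_left[OF ca], of "\<lambda>_. 1/2" "1 / (4 * B)"]
      unfolding integ_scale[OF \<nu> ca] by (simp add: integ_const[OF \<nu>] ae)
    moreover have "?I \<nu> (\<lambda>y. ?w y * a y) = ?I \<nu> (\<lambda>y. (1 / (4 * B)) * (a y * a y) + (1/2) * a y)"
      by (intro integ_cong) (simp add: algebra_simps)
    moreover have "\<dots> = (1 / (4 * B)) * ?I \<nu> (\<lambda>y. a y * a y) + (1/2) * a e"
      using integ_add[OF \<nu> continuous_map_real_mult_left[OF caa] continuous_map_real_mult_left[OF ca], of "1 / (4 * B)" "1/2"]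
      unfolding integ_scale[OF \<nu> ca] integ_scale[OF \<nu> caa] ae .
    ultimately have "(1 / (4 * B)) * ?I \<nu> (\<lambda>y. a y * a y) = (1 / (4 * B)) * (a e * a e)"
      using s by (simp add: algebra_simps)
    then have sq: "?I \<nu> (\<lambda>y. a y * a y) = a e * a e" using B(1) by simp
    have "?I \<nu> (\<lambda>y. (a y - a e) * (a y - a e)) = ?I \<nu> (\<lambda>y. (a y * a y + (- 2 * a e) * a y) + a e * a e)"
      by (intro integ_cong) (simp add: algebra_simps)
    also have "\<dots> = ?I \<nu> (\<lambda>y. a y * a y) + (- 2 * a e) * ?I \<nu> a + a e * a e"
      using integ_add[OF \<nu> continuous_map_add[OF caa continuous_map_real_mult_left[OF ca]], of "\<lambda>_. a e * a e" "- 2 * a e"]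
        integ_add[OF \<nu> caa continuous_map_real_mult_left[OF ca], of "- 2 * a e"]
      unfolding integ_scale[OF \<nu> ca] by (simp add: integ_const[OF \<nu>])
    finally show ?thesis unfolding sq ae by simp
  qed
  let ?N = "{(\<lambda>y. (a y - a e) * (a y - a e)) | a :: 'v \<Rightarrow> real. continuous_on Q a \<and> affine_on Q a}"
  show ?thesis
  proof (rule state_eq_dirac[where N = ?N])
    fix h assume "h \<in> ?N"
    then obtain a where a: "continuous_on Q a" "affine_on Q a" and h: "h = (\<lambda>y. (a y - a e) * (a y - a e))" by blast
    have "cont (top_of_set Y) h"
      unfolding h by (intro continuous_map_real_mult continuous_map_diff aY[OF a(1)]) simp_all
    then show "cont (top_of_set Y) h \<and> (\<forall>x\<in>topspace (top_of_set Y). 0 \<le> h x) \<and> ?I \<nu> h = 0"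
      using zero[OF a] by (simp add: h)
  next
    fix x assume "x \<in> topspace (top_of_set Y)" "x \<noteq> e"
    then obtain f :: "'v \<Rightarrow> real" where f: "linear f" "continuous_on UNIV f" "f x \<noteq> f e"
      using separating_functional by blast
    have "continuous_on Q f \<and> affine_on Q f"
      using continuous_on_subset[OF f(2)] linear_imp_affine_on[OF f(1)] by blast
    moreover have "0 < (f x - f e) * (f x - f e)" using f(3) by (auto simp: zero_less_mult_iff neq_iff)
    ultimately show "\<exists>h\<in>?N. 0 < h x"
      by (intro bexI[of _ "\<lambda>y. (f y - f e) * (f y - f e)"]) auto
  qed (use Y \<nu> in auto)
qed

section \<open>The fixed point property of amenable groups\<close>

lemma affine_flowD:
  assumes "affine_flow G T K a"
  shows "convex K" "flow G T (top_of_set K) a" "compact K" "K \<noteq> {}"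
    and "g \<in> carrier G \<Longrightarrow> affine_on K (a g)"
    and "\<lbrakk>g \<in> carrier G; x \<in> K\<rbrakk> \<Longrightarrow> a g x \<in> K"
  using assms flow_compact[of G T "top_of_set K" a] flow_nonempty[of G T "top_of_set K" a]
    flow_closed[of G T "top_of_set K" a g x] unfolding affine_flow_def by auto

lemma affine_subflow:
  assumes TG: "topological_group G T" and K: "affine_flow G T K a"
    and C: "closedin (top_of_set K) C" "C \<noteq> {}" "convex C"
    and inv: "\<And>g x. \<lbrakk>g \<in> carrier G; x \<in> C\<rbrakk> \<Longrightarrow> a g x \<in> C"
  shows "affine_flow G T C (\<lambda>g. restrict (a g) C)"
proof -
  interpret topological_group G T by fact
  have CK: "C \<subseteq> K" using closedin_subset[OF C(1)] by simp
  then have "subtopology (top_of_set K) C = top_of_set C" by (simp add: subtopology_subtopology inf.absorb2)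
  then have "flow G T (top_of_set C) (\<lambda>g. restrict (a g) C)"
    using flow_subflow[OF affine_flowD(2)[OF K] is_group C(1,2) inv topspace_eq] by simp
  moreover have "affine_on C (restrict (a g) C)" if "g \<in> carrier G" for g
    unfolding affine_on_def
  proof (intro ballI)
    fix x y and t :: real assume xy: "x \<in> C" "y \<in> C" and t: "t \<in> {0..1}"
    have "(1 - t) *\<^sub>R x + t *\<^sub>R y \<in> C" using convexD[OF C(3) xy, of "1 - t" t] t by simp
    then show "restrict (a g) C ((1 - t) *\<^sub>R x + t *\<^sub>R y) = (1 - t) *\<^sub>R restrict (a g) C x + t *\<^sub>R restrict (a g) C y"
      using affine_flowD(5)[OF K that, unfolded affine_on_def, rule_format, OF subsetD[OF CK xy(1)] subsetD[OF CK xy(2)] t]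
        xy by simp
  qed
  ultimately show ?thesis using C(3) by (simp add: affine_flow_def)
qed

text \<open>
  Irreducibility, that is, having no proper closed convex invariant subset, is minimality among the
  affine subflows; Zorn's lemma applies because of compactness.
\<close>

lemma irreducible_affine_subflow:
  assumes TG: "topological_group G T" and K: "affine_flow G T K a"
  obtains Q where "Q \<subseteq> K" "affine_flow G T Q (\<lambda>g. restrict (a g) Q)"
    "\<And>C. \<lbrakk>C \<noteq> {}; convex C; closedin (top_of_set Q) C; \<And>g x. \<lbrakk>g \<in> carrier G; x \<in> C\<rbrakk> \<Longrightarrow> a g x \<in> C\<rbrakk> \<Longrightarrow> C = Q"
proof -
  let ?\<F> = "{C. closedin (top_of_set K) C \<and> C \<noteq> {} \<and> convex C \<and> (\<forall>g\<in>carrier G. \<forall>x\<in>C. a g x \<in> C)}"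
  obtain Q where Q: "Q \<in> ?\<F>" and min: "\<And>A. \<lbrakk>A \<in> ?\<F>; A \<subseteq> Q\<rbrakk> \<Longrightarrow> A = Q"
  proof (rule minimal_closed_member[of "top_of_set K" K ?\<F>])
    show "compact_space (top_of_set K)" using affine_flowD(3)[OF K] by simp
    show "K \<in> ?\<F>" using affine_flowD[OF K] by auto
    fix \<C> assume C: "\<C> \<subseteq> ?\<F>" "\<C> \<noteq> {}" "\<Inter>\<C> \<noteq> {}"
    have "closedin (top_of_set K) (\<Inter>\<C>)" using C by (intro closedin_Inter) auto
    moreover have "convex (\<Inter>\<C>)" using C by (intro convex_Inter) auto
    ultimately show "\<Inter>\<C> \<in> ?\<F>" using C by blast
  qed auto
  show ?thesis
  proof (rule that)
    show "Q \<subseteq> K" using Q closedin_subset by fastforce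
    show "affine_flow G T Q (\<lambda>g. restrict (a g) Q)"
      using Q by (intro affine_subflow[OF TG K]) auto
    fix C assume "C \<noteq> {}" "convex C" and cl: "closedin (top_of_set Q) C"
      and "\<And>g x. \<lbrakk>g \<in> carrier G; x \<in> C\<rbrakk> \<Longrightarrow> a g x \<in> C"
    moreover have "closedin (top_of_set K) C" using closedin_trans[OF cl] Q by blast
    ultimately have "C \<in> ?\<F>" by blast
    then show "C = Q" using min closedin_subset[OF cl] by simp
  qed
qed

lemma orbit_closure_flow:
  assumes TG: "topological_group G T" and fl: "flow G T X act" and x: "x \<in> topspace X"
    and Y: "Y = X closure_of ((\<lambda>g. act g x) ` carrier G)"
  shows "closedin X Y" "x \<in> Y" "\<And>g y. \<lbrakk>g \<in> carrier G; y \<in> Y\<rbrakk> \<Longrightarrow> act g y \<in> Y"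
    "topspace (subtopology X Y) \<subseteq> (subtopology X Y) closure_of ((\<lambda>g. act g x) ` carrier G)"
proof -
  interpret topological_group G T by fact
  let ?S = "(\<lambda>g. act g x) ` carrier G"
  have S: "?S \<subseteq> topspace X" using flow_closed[OF fl _ x] by blast
  show "closedin X Y" unfolding Y by (rule closedin_closure_of)
  have SY: "?S \<subseteq> Y" unfolding Y by (rule closure_of_subset[OF S])
  then show "x \<in> Y" using flow_one[OF fl x] one_closed by force
  show "act g y \<in> Y" if g: "g \<in> carrier G" and y: "y \<in> Y" for g y
  proof -
    have "act g ` ?S \<subseteq> ?S"
      using flow_mult[OF fl g _ x, symmetric] g by auto
    moreover have "act g ` Y \<subseteq> X closure_of (act g ` ?S)"
      unfolding Y by (rule continuous_map_image_closure_subset[OF flow_continuous_act[OF TG fl g]])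
    ultimately show ?thesis using y closure_of_mono[of "act g ` ?S" ?S X] unfolding Y by blast
  qed
  have "Y \<inter> ?S = ?S" using SY by blast
  then show "topspace (subtopology X Y) \<subseteq> (subtopology X Y) closure_of ?S"
    unfolding closure_of_subtopology using Y by auto
qed

lemma integ_abs_le:
  assumes "\<Lambda> \<in> states X" "cont X f"
  shows "\<bar>integ X \<Lambda> f\<bar> \<le> integ X \<Lambda> (\<lambda>x. \<bar>f x\<bar>)"
proof -
  have c: "cont X (\<lambda>x. \<bar>f x\<bar>)" using assms(2) by (intro continuous_intros)
  have "integ X \<Lambda> f \<le> integ X \<Lambda> (\<lambda>x. \<bar>f x\<bar>)" by (intro integ_mono[OF assms c]) auto
  moreover have "integ X \<Lambda> (\<lambda>x. -1 * f x) \<le> integ X \<Lambda> (\<lambda>x. \<bar>f x\<bar>)"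
    by (intro integ_mono[OF assms(1) continuous_map_real_mult_left[OF assms(2)] c]) auto
  ultimately show ?thesis unfolding integ_scale[OF assms] by simp
qed

text \<open>
  The setting of the theorem of Furstenberg and Glasner: the orbit closure \<open>Y\<close> of an extreme point \<open>e\<close>
  of an irreducible affine flow is strongly proximal.
\<close>

locale irreducible_affine_flow =
  fixes G :: "('g, 'b) monoid_scheme" and T :: "'g topology"
    and Q :: "'v::locally_convex_space set" and a :: "'g \<Rightarrow> 'v \<Rightarrow> 'v" and e :: 'v and Y :: "'v set"
  assumes TG: "topological_group G T" and aff: "affine_flow G T Q a"
    and irr: "\<And>C. \<lbrakk>C \<noteq> {}; convex C; closedin (top_of_set Q) C;
        \<And>g x. \<lbrakk>g \<in> carrier G; x \<in> C\<rbrakk> \<Longrightarrow> a g x \<in> C\<rbrakk> \<Longrightarrow> C = Q"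
    and extr: "e extreme_point_of Q"
    and Y: "Y = top_of_set Q closure_of ((\<lambda>g. a g e) ` carrier G)"
begin

abbreviation "aY \<equiv> \<lambda>g. restrict (a g) Y"
abbreviation "I \<equiv> integ (top_of_set Y)"
abbreviation "A \<equiv> {\<alpha> :: 'v \<Rightarrow> real. continuous_on Q \<alpha> \<and> affine_on Q \<alpha>}"

lemma eQ: "e \<in> topspace (top_of_set Q)" using extr by (simp add: extreme_point_of_def)

lemmas Y_facts = orbit_closure_flow[OF TG affine_flowD(2)[OF aff] eQ Y]

lemma YQ: "Y \<subseteq> Q" using closedin_subset[OF Y_facts(1)] by simp

lemma compact_Y: "compact Y" using closedin_compact[OF affine_flowD(3)[OF aff] Y_facts(1)] .

lemma subtop: "subtopology (top_of_set Q) Y = top_of_set Y"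
  using YQ by (simp add: subtopology_subtopology inf.absorb2)

lemma flow_Y: "flow G T (top_of_set Y) aY"
proof -
  interpret topological_group G T by (rule TG)
  show ?thesis
    using flow_subflow[OF affine_flowD(2)[OF aff] is_group Y_facts(1) _ Y_facts(3) topspace_eq] Y_facts(2)
    unfolding subtop by blast
qed

lemma incl: "continuous_map (top_of_set Y) (top_of_set Q) id"
  using YQ by (auto simp: continuous_map_in_subtopology)

definition bary :: "(('v \<Rightarrow> real) \<Rightarrow> real) \<Rightarrow> 'v" where
  "bary \<nu> = (SOME b. barycenter_of Q (push (top_of_set Y) (top_of_set Q) id \<nu>) b)"

lemma bary:
  assumes "\<nu> \<in> states (top_of_set Y)"
  shows "barycenter_of Q (push (top_of_set Y) (top_of_set Q) id \<nu>) (bary \<nu>)"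
  unfolding bary_def
  using barycenter_exists[OF affine_flowD(3,1,4)[OF aff] push_state[OF incl assms]] by (metis someI_ex)

lemma bary_in: "\<nu> \<in> states (top_of_set Y) \<Longrightarrow> bary \<nu> \<in> Q"
  using bary by (simp add: barycenter_of_def)

lemma bary_eval:
  assumes "\<nu> \<in> states (top_of_set Y)" "\<alpha> \<in> A"
  shows "\<alpha> (bary \<nu>) = I \<nu> \<alpha>"
  using barycenterD[OF bary[OF assms(1)], of \<alpha>] integ_push[OF incl, of \<alpha> \<nu>] assms(2) by simp

lemma cont_A_Y: "\<alpha> \<in> A \<Longrightarrow> cont (top_of_set Y) \<alpha>"
  using continuous_on_subset[OF _ YQ] by auto

lemma continuous_bary:
  assumes "S \<subseteq> states (top_of_set Y)"
  shows "continuous_map (top_of_set S) (top_of_set Q) bary"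
proof (rule continuous_map_by_separating[where A = A])
  show "compact_space (top_of_set Q)" using affine_flowD(3)[OF aff] by simp
  show "x = y" if "\<And>\<alpha>. \<alpha> \<in> A \<Longrightarrow> \<alpha> x = \<alpha> y" for x y
    using that by (intro affine_functions_separate[of Q]) blast
  show "bary z \<in> topspace (top_of_set Q)" if "z \<in> topspace (top_of_set S)" for z
    using that assms bary_in by auto
  show "cont (top_of_set S) (\<lambda>z. \<alpha> (bary z))" if "\<alpha> \<in> A" for \<alpha>
    using cont_integ[OF cont_A_Y[OF that], of S] assms bary_eval[OF _ that]
    by (rule_tac continuous_map_eq[of _ _ "\<lambda>z. I z \<alpha>"]) auto
qed auto

text \<open>
  By Hahn-Banach this says that \<open>dirac e\<close> lies in the closed convex hull of the orbit of \<open>\<Lambda>\<close>. That hull is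
  taken here as the set of the states that satisfy every upper bound valid along the orbit
  (\<open>dom\<close>). Its barycenters form a closed convex invariant subset of \<open>Q\<close>, hence all of \<open>Q\<close>. So some state in
  the hull has barycenter \<open>e\<close>, and by Bauer's theorem it is the point mass at \<open>e\<close>.
\<close>

lemma orbit_dominates_extreme_point:
  assumes L: "\<Lambda> \<in> states (top_of_set Y)" and f: "cont (top_of_set Y) f"
    and le: "\<And>g. g \<in> carrier G \<Longrightarrow> I \<Lambda> (\<lambda>y. f (aY g y)) \<le> c"
  shows "f e \<le> c"
proof -
  interpret topological_group G T by (rule TG)
  note PY = flow_Prob_eq_states[OF flow_Y]
  let ?P = "Prob_action (top_of_set Y) aY"
  define dom where "dom \<nu> \<longleftrightarrow> (\<forall>f c. cont (top_of_set Y) f \<longrightarrow>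
      (\<forall>g\<in>carrier G. I \<Lambda> (\<lambda>y. f (aY g y)) \<le> c) \<longrightarrow> I \<nu> f \<le> c)" for \<nu>
  have domI: "dom \<nu>" if "\<And>f c. \<lbrakk>cont (top_of_set Y) f; \<And>g. g \<in> carrier G \<Longrightarrow> I \<Lambda> (\<lambda>y. f (aY g y)) \<le> c\<rbrakk> \<Longrightarrow> I \<nu> f \<le> c" for \<nu>
    using that unfolding dom_def by blast
  have domD: "I \<nu> f \<le> c" if "dom \<nu>" "cont (top_of_set Y) f" "\<And>g. g \<in> carrier G \<Longrightarrow> I \<Lambda> (\<lambda>y. f (aY g y)) \<le> c" for \<nu> f c
    using that unfolding dom_def by blast
  let ?C = "states (top_of_set Y) \<inter> {\<nu>. dom \<nu>}"
  have "closed {\<nu>. dom \<nu>}"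
    unfolding dom_def
    by (intro closed_Collect_all closed_Collect_imp closed_Collect_le open_Collect_const
        continuous_intros) (simp add: integ_def)
  then have C: "compact ?C"
    using compact_states[of "top_of_set Y"] compact_Y by (intro compact_Int_closed) auto
  have "dom \<Lambda>"
  proof (rule domI)
    fix f c assume f: "cont (top_of_set Y) f" and le: "\<And>g. g \<in> carrier G \<Longrightarrow> I \<Lambda> (\<lambda>y. f (aY g y)) \<le> c"
    have "I \<Lambda> (\<lambda>y. f (aY \<one>\<^bsub>G\<^esub> y)) = I \<Lambda> f"
      by (rule integ_cong) (simp only: flow_one[OF flow_Y])
    then show "I \<Lambda> f \<le> c" using le[OF one_closed] by simp
  qed
  then have LC: "\<Lambda> \<in> ?C" using L by blast
  have "bary ` ?C = Q"
  proof (rule irr)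
    show "bary ` ?C \<noteq> {}" using LC by blast
    have "compactin (top_of_set ?C) ?C" using C by (simp add: compactin_subtopology)
    then have "compactin (top_of_set Q) (bary ` ?C)"
      using image_compactin continuous_bary[of ?C] by blast
    then show "closedin (top_of_set Q) (bary ` ?C)"
      by (rule compactin_imp_closedin[OF Hausdorff_top_of_set_lcs])
    show "convex (bary ` ?C)"
    proof (rule convexI, elim imageE)
      fix x y \<nu> \<nu>' and u v :: real
      assume uv: "0 \<le> u" "0 \<le> v" "u + v = 1" and x: "x = bary \<nu>" "y = bary \<nu>'" and n: "\<nu> \<in> ?C" "\<nu>' \<in> ?C"
      let ?\<nu> = "u *\<^sub>R \<nu> + v *\<^sub>R \<nu>'"
      have s: "?\<nu> \<in> states (top_of_set Y)" using n uv by (intro convexD[OF convex_states]) auto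
      have "dom ?\<nu>"
      proof (rule domI)
        fix f c assume f: "cont (top_of_set Y) f" and le: "\<And>g. g \<in> carrier G \<Longrightarrow> I \<Lambda> (\<lambda>y. f (aY g y)) \<le> c"
        have "dom \<nu>" "dom \<nu>'" using n by auto
        then have "I \<nu> f \<le> c" "I \<nu>' f \<le> c" using domD[OF _ f le] by auto
        then have "u * I \<nu> f + v * I \<nu>' f \<le> u * c + v * c" using uv by (intro add_mono mult_left_mono)
        also have "\<dots> = c" using uv by (simp add: distrib_right[symmetric])
        finally show "I ?\<nu> f \<le> c" by (simp add: integ_combination)
      qed
      moreover have "u *\<^sub>R x + v *\<^sub>R y = bary ?\<nu>"
      proof (rule affine_functions_separate[of Q])
        fix \<alpha> :: "'v \<Rightarrow> real" assume "continuous_on Q \<alpha>" "affine_on Q \<alpha>"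
        then have \<alpha>: "\<alpha> \<in> A" by blast
        have xy: "x \<in> Q" "y \<in> Q" using n bary_in x by auto
        have "\<alpha> ((1 - v) *\<^sub>R x + v *\<^sub>R y) = (1 - v) *\<^sub>R \<alpha> x + v *\<^sub>R \<alpha> y"
          using \<alpha> xy uv by (auto simp: affine_on_def)
        moreover have "1 - v = u" using uv by simp
        ultimately show "\<alpha> (u *\<^sub>R x + v *\<^sub>R y) = \<alpha> (bary ?\<nu>)"
          using bary_eval[OF s \<alpha>] bary_eval[OF _ \<alpha>, of \<nu>] bary_eval[OF _ \<alpha>, of \<nu>'] n x
          by (simp add: integ_combination)
      qed
      ultimately show "u *\<^sub>R x + v *\<^sub>R y \<in> bary ` ?C" using s by blast
    qed
    fix k x assume k: "k \<in> carrier G" and "x \<in> bary ` ?C"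
    then obtain \<nu> where n: "\<nu> \<in> ?C" "x = bary \<nu>" by blast
    have nP: "\<nu> \<in> Prob (top_of_set Y)" using n by (simp add: PY)
    have s: "?P k \<nu> \<in> states (top_of_set Y)" using Prob_action_closed[OF TG flow_Y k nP] by (simp add: PY)
    note act = integ_Prob_action[OF TG flow_Y k nP]
    have "dom (?P k \<nu>)"
    proof (rule domI)
      fix f c assume f: "cont (top_of_set Y) f" and le: "\<And>g. g \<in> carrier G \<Longrightarrow> I \<Lambda> (\<lambda>y. f (aY g y)) \<le> c"
      have "I \<Lambda> (\<lambda>y. f (aY k (aY g y))) \<le> c" if g: "g \<in> carrier G" for g
      proof -
        have "I \<Lambda> (\<lambda>y. f (aY (k \<otimes>\<^bsub>G\<^esub> g) y)) = I \<Lambda> (\<lambda>y. f (aY k (aY g y)))"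
          by (rule integ_cong) (simp only: flow_mult[OF flow_Y k g])
        then show ?thesis using le[OF m_closed[OF k g]] by simp
      qed
      moreover have "dom \<nu>" using n(1) by blast
      ultimately have "I \<nu> (\<lambda>y. f (aY k y)) \<le> c"
        by (intro domD[OF _ flow_cont_act[OF TG flow_Y k f]])
      then show "I (?P k \<nu>) f \<le> c" using act[OF f] by simp
    qed
    moreover have "a k x = bary (?P k \<nu>)"
    proof (rule affine_functions_separate[of Q])
      fix \<alpha> :: "'v \<Rightarrow> real" assume "continuous_on Q \<alpha>" "affine_on Q \<alpha>"
      then have \<alpha>: "\<alpha> \<in> A" by blast
      have "continuous_on Q (\<lambda>x. \<alpha> (a k x))"
        using flow_cont_act[OF TG affine_flowD(2)[OF aff] k, of \<alpha>] \<alpha> by simp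
      moreover have "affine_on Q (\<lambda>x. \<alpha> (a k x))"
        using affine_flowD(5,6)[OF aff k] \<alpha> by (auto simp: affine_on_def)
      ultimately have "\<alpha> (a k x) = I \<nu> (\<lambda>x. \<alpha> (a k x))"
        using bary_eval[of \<nu> "\<lambda>x. \<alpha> (a k x)"] n by blast
      also have "\<dots> = I \<nu> (\<lambda>y. \<alpha> (aY k y))" by (rule integ_cong) simp
      also have "\<dots> = \<alpha> (bary (?P k \<nu>))" using act[OF cont_A_Y[OF \<alpha>]] bary_eval[OF s \<alpha>] by simp
      finally show "\<alpha> (a k x) = \<alpha> (bary (?P k \<nu>))" .
    qed
    ultimately show "a k x \<in> bary ` ?C" using s by blast
  qed
  moreover have "e \<in> Q" using eQ by simp
  ultimately obtain \<nu> where n: "\<nu> \<in> ?C" "bary \<nu> = e" by (metis imageE)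
  have "\<nu> = dirac (top_of_set Y) e"
    using n bary[of \<nu>] Y_facts(2) YQ compact_Y by (intro bauer[OF affine_flowD(3,1)[OF aff] extr]) auto
  then have "I \<nu> f = f e" using f Y_facts(2) by simp
  moreover have "I \<nu> f \<le> c" using n by (intro domD[OF _ f le]) auto
  ultimately show ?thesis by simp
qed

text \<open>
  Two measures are pushed towards the same point mass by moving their average \<open>M\<close> there. For every
  continuous \<open>h \<ge> 0\<close> with \<open>h e = 0\<close> the previous lemma, applied to \<open>- h\<close>, yields group elements \<open>g\<close> for which
  the integral of \<open>h\<close> against \<open>g M\<close> is below \<open>1\<close>. These sets of group elements generate a filter, as \<open>h\<close> may
  be replaced by a sum, and \<open>g M\<close> converges to \<open>dirac e\<close> along it, as \<open>h\<close> may be replaced by a multiple.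
\<close>

theorem strongly_proximal_Y: "strongly_proximal G (top_of_set Y) aY"
  unfolding strongly_proximal_def proximal_def
proof (intro ballI)
  note PY = flow_Prob_eq_states[OF flow_Y]
  let ?TY = "top_of_set Y"
  let ?P = "Prob_action ?TY aY"
  fix \<Lambda>1 \<Lambda>2 assume "\<Lambda>1 \<in> topspace (top_of_set (Prob ?TY))" "\<Lambda>2 \<in> topspace (top_of_set (Prob ?TY))"
  then have L: "\<Lambda>1 \<in> states ?TY" "\<Lambda>2 \<in> states ?TY" by (simp_all add: PY)
  let ?M = "(1/2) *\<^sub>R \<Lambda>1 + (1/2) *\<^sub>R \<Lambda>2"
  have M: "?M \<in> states ?TY" using convexD[OF convex_states L, of "1/2" "1/2"] by simp
  let ?H = "{h. cont ?TY h \<and> (\<forall>y\<in>Y. 0 \<le> h y) \<and> h e = 0}"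
  let ?S = "\<lambda>h. {g \<in> carrier G. I ?M (\<lambda>y. h (aY g y)) < 1}"
  let ?F = "INF h\<in>?H. principal (?S h)"
  have c_act: "cont ?TY (\<lambda>y. h (aY g y))" if "cont ?TY h" "g \<in> carrier G" for h g
    using flow_cont_act[OF TG flow_Y that(2,1)] .
  have aY_in: "aY g y \<in> Y" if "g \<in> carrier G" "y \<in> Y" for g y using that Y_facts(3) by simp
  have ev: "eventually P ?F \<longleftrightarrow> (\<exists>h\<in>?H. \<forall>g\<in>?S h. P g)" for P
  proof -
    have directed: "\<exists>x\<in>?H. principal (?S x) \<le> inf (principal (?S h)) (principal (?S h'))"
      if h: "h \<in> ?H" "h' \<in> ?H" for h h'
    proof (rule bexI[of _ "\<lambda>y. h y + h' y"])
      show "(\<lambda>y. h y + h' y) \<in> ?H" using h by (auto intro!: continuous_intros)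
      have "g \<in> ?S h \<and> g \<in> ?S h'" if "g \<in> ?S (\<lambda>y. h y + h' y)" for g
      proof -
        have g: "g \<in> carrier G" using that by simp
        have "0 \<le> I ?M (\<lambda>y. k (aY g y))" if k: "cont ?TY k" "\<forall>y\<in>Y. 0 \<le> k y" for k
          by (rule integ_nonneg[OF M c_act[OF k(1) g]]) (use k(2) Y_facts(3)[OF g] in auto)
        then have "0 \<le> I ?M (\<lambda>y. h (aY g y))" "0 \<le> I ?M (\<lambda>y. h' (aY g y))" using h by auto
        moreover have "I ?M (\<lambda>y. h (aY g y) + h' (aY g y)) = I ?M (\<lambda>y. h (aY g y)) + I ?M (\<lambda>y. h' (aY g y))"
          using h g by (intro integ_add[OF M] c_act) auto
        ultimately show ?thesis using that by auto
      qed
      then show "principal (?S (\<lambda>y. h y + h' y)) \<le> inf (principal (?S h)) (principal (?S h'))"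
        by (auto simp: inf_principal)
    qed
    have "(\<lambda>_. 0) \<in> ?H" by simp
    then have "?H \<noteq> {}" by blast
    from eventually_INF_base[OF this directed, of P] show ?thesis unfolding eventually_principal .
  qed
  have "?F \<noteq> bot"
  proof
    assume "?F = bot"
    then have "eventually (\<lambda>_. False) ?F" by (simp only: eventually_bot)
    then obtain h where h: "h \<in> ?H" "?S h = {}" unfolding ev by blast
    have ch: "cont ?TY (\<lambda>y. -1 * h y)" using h by (intro continuous_map_real_mult_left) simp
    have "-1 * h e \<le> -1"
    proof (rule orbit_dominates_extreme_point[OF M ch])
      fix g assume g: "g \<in> carrier G"
      then have "1 \<le> I ?M (\<lambda>y. h (aY g y))" using h(2) by force
      then show "I ?M (\<lambda>y. -1 * h (aY g y)) \<le> -1"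
        using integ_scale[OF M c_act[OF _ g], of h "-1"] h(1) by simp
    qed
    then show False using h(1) by simp
  qed
  moreover have "?F \<le> principal (carrier G)" unfolding le_principal ev by (intro bexI[of _ "\<lambda>_. 0"]) auto
  moreover have "limitin (top_of_set (Prob ?TY)) (\<lambda>g. ?P g \<Lambda>) (dirac ?TY e) ?F"
    if Lam: "\<Lambda> \<in> {\<Lambda>1, \<Lambda>2}" for \<Lambda>
  proof -
    have LP: "\<Lambda> \<in> Prob ?TY" "\<Lambda> \<in> states ?TY" using Lam L by (auto simp: PY)
    have evG: "eventually (\<lambda>g. g \<in> carrier G) ?F" unfolding ev by (intro bexI[of _ "\<lambda>_. 0"]) auto
    have eY: "e \<in> topspace ?TY" using Y_facts(2) by simp
    have "((\<lambda>g. ?P g \<Lambda> f) \<longlongrightarrow> dirac ?TY e f) ?F" for f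
    proof (cases "f \<in> continuous_functions ?TY")
      case False
      have "?P g \<Lambda> f = 0" if "g \<in> carrier G" for g
        using Prob_action_closed[OF TG flow_Y that LP(1)] False by (simp add: PY states_def)
      then have "eventually (\<lambda>g. ?P g \<Lambda> f = 0) ?F" by (rule eventually_mono[OF evG])
      then show ?thesis using False by (simp add: dirac_def tendsto_eventually)
    next
      case True
      then have f: "cont ?TY f" "restrict f (topspace ?TY) = f"
        by (auto simp: continuous_functions_def extensional_restrict)
      have val: "?P g \<Lambda> f = I \<Lambda> (\<lambda>y. f (aY g y))" if "g \<in> carrier G" for g
        using integ_Prob_action[OF TG flow_Y that LP(1) f(1)] f(2) by (simp add: integ_def)
      have "dirac ?TY e f = f e" using True by (simp add: dirac_def)
      moreover have "eventually (\<lambda>g. dist (?P g \<Lambda> f) (f e) < r) ?F" if r: "0 < r" for r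
        unfolding ev
        \<comment> \<open>On nonnegative functions \<open>\<Lambda>\<close> is at most twice the average \<open>?M\<close>, whence the factor \<open>2\<close>.\<close>
      proof (intro bexI[of _ "\<lambda>y. (2 / r) * \<bar>f y - f e\<bar>"] ballI)
        have cd: "cont ?TY (\<lambda>y. \<bar>f y - f e\<bar>)" using f(1) by (intro continuous_map_real_abs continuous_map_diff) auto
        show "(\<lambda>y. (2 / r) * \<bar>f y - f e\<bar>) \<in> ?H"
          using continuous_map_real_mult_left[OF cd, of "2 / r"] r by simp
        fix g assume "g \<in> ?S (\<lambda>y. (2 / r) * \<bar>f y - f e\<bar>)"
        then have g: "g \<in> carrier G" and lt: "I ?M (\<lambda>y. (2 / r) * \<bar>f (aY g y) - f e\<bar>) < 1" by auto
        let ?d = "\<lambda>y. \<bar>f (aY g y) - f e\<bar>"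
        have cg: "cont ?TY ?d" using c_act[OF cd g] .
        have "0 \<le> I \<Lambda>1 ?d" "0 \<le> I \<Lambda>2 ?d" using integ_nonneg[OF L(1) cg] integ_nonneg[OF L(2) cg] by auto
        moreover have "(2 / r) * ((1/2) * I \<Lambda>1 ?d + (1/2) * I \<Lambda>2 ?d) < 1"
          using lt unfolding integ_scale[OF M cg] unfolding integ_combination .
        then have "I \<Lambda>1 ?d + I \<Lambda>2 ?d < r" using r by (simp add: field_simps)
        ultimately have "I \<Lambda> ?d < r" using Lam by auto
        moreover have "\<bar>I \<Lambda> (\<lambda>y. f (aY g y) - f e)\<bar> \<le> I \<Lambda> ?d"
          using c_act[OF f(1) g] by (intro integ_abs_le[OF LP(2)] continuous_map_diff) auto
        moreover have "I \<Lambda> (\<lambda>y. f (aY g y) - f e) = I \<Lambda> (\<lambda>y. f (aY g y)) - f e"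
          using integ_diff[OF LP(2) c_act[OF f(1) g], of "\<lambda>_. f e"] by (simp add: integ_const[OF LP(2)])
        ultimately show "dist (?P g \<Lambda> f) (f e) < r" unfolding val[OF g] dist_real_def by linarith
      qed
      ultimately show ?thesis by (simp add: tendsto_iff)
    qed
    then have "((\<lambda>g. ?P g \<Lambda>) \<longlongrightarrow> dirac ?TY e) ?F" by (simp add: tendsto_fun_iff)
    moreover have "eventually (\<lambda>g. ?P g \<Lambda> \<in> Prob ?TY) ?F"
      using Prob_action_closed[OF TG flow_Y _ LP(1)] by (rule eventually_mono[OF evG])
    ultimately show ?thesis using dirac_state[OF eY] unfolding limitin_subtopology PY by simp
  qed
  ultimately show "\<exists>F z. F \<noteq> bot \<and> F \<le> principal (carrier G) \<and>
      limitin (top_of_set (Prob ?TY)) (\<lambda>g. ?P g \<Lambda>1) z F \<and> limitin (top_of_set (Prob ?TY)) (\<lambda>g. ?P g \<Lambda>2) z F"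
    by blast
qed

end

text \<open>
  Amenability is tested on a single type of flows, whereas \<open>K\<close> lives on an arbitrary type. The strongly
  proximal flow extracted from \<open>K\<close> has a dense orbit and therefore a copy on \<open>'g sa_point\<close>.
\<close>

theorem amenable_imp_affine_fixed_point:
  fixes G :: "('g, 'b) monoid_scheme" and K :: "'v::locally_convex_space set"
  assumes TG: "topological_group G T" and am: "amenable TYPE('g sa_point) G T" and K: "affine_flow G T K a"
  obtains x where "x \<in> K" "\<And>g. g \<in> carrier G \<Longrightarrow> a g x = x"
proof -
  interpret topological_group G T by fact
  obtain Q where Q: "Q \<subseteq> K" "affine_flow G T Q (\<lambda>g. restrict (a g) Q)"
    "\<And>C. \<lbrakk>C \<noteq> {}; convex C; closedin (top_of_set Q) C; \<And>g x. \<lbrakk>g \<in> carrier G; x \<in> C\<rbrakk> \<Longrightarrow> a g x \<in> C\<rbrakk> \<Longrightarrow> C = Q"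
    using irreducible_affine_subflow[OF TG K] by blast
  obtain e where e: "e extreme_point_of Q"
    using extreme_point_exists[OF affine_flowD(3,4)[OF Q(2)]] by blast
  let ?a = "\<lambda>g. restrict (a g) Q"
  let ?Y = "top_of_set Q closure_of ((\<lambda>g. ?a g e) ` carrier G)"
  interpret irreducible_affine_flow G T Q ?a e ?Y
  proof
    show "C = Q" if "C \<noteq> {}" "convex C" "closedin (top_of_set Q) C"
      "\<And>g x. \<lbrakk>g \<in> carrier G; x \<in> C\<rbrakk> \<Longrightarrow> restrict (a g) Q x \<in> C" for C
    proof (rule Q(3)[OF that(1-3)])
      fix g x assume gx: "g \<in> carrier G" "x \<in> C"
      moreover have "x \<in> Q" using gx closedin_subset[OF that(3)] by auto
      ultimately show "a g x \<in> C" using that(4)[OF gx] by simp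
    qed
  qed (use TG Q(2) e in auto)
  note trans = Y_facts(4)[unfolded subtop]
  obtain \<iota> :: "'v \<Rightarrow> 'g sa_point" where inj: "inj_on \<iota> (topspace (top_of_set ?Y))"
    using injection_of_transitive_space[OF flow_compact[OF flow_Y] flow_Hausdorff[OF flow_Y] trans] by blast
  obtain Z act' where Z: "flow G T Z act'" "continuous_map (top_of_set ?Y) Z \<iota>"
      "\<iota> ` topspace (top_of_set ?Y) = topspace Z"
      "\<And>g x. \<lbrakk>g \<in> carrier G; x \<in> topspace (top_of_set ?Y)\<rbrakk> \<Longrightarrow> \<iota> (aY g x) = act' g (\<iota> x)"
    using flow_copy[OF flow_Y is_group inj topspace_eq] by blast
  have "strongly_proximal G Z act'"
    by (rule strongly_proximal_factor[where p = \<iota>, OF TG flow_Y Z(1-3) _ strongly_proximal_Y]) (rule Z(4))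
  then have "\<exists>z\<in>topspace Z. \<forall>g\<in>carrier G. act' g z = z"
    by (intro am[unfolded amenable_def, rule_format] conjI Z(1))
  then obtain z where z: "z \<in> topspace Z" "\<And>g. g \<in> carrier G \<Longrightarrow> act' g z = z" by blast
  obtain y where y: "y \<in> ?Y" "z = \<iota> y" using z(1) Z(3) by auto
  have yQ: "y \<in> Q" using y YQ by blast
  have "a g y = y" if g: "g \<in> carrier G" for g
  proof -
    have "\<iota> (aY g y) = \<iota> y" using Z(4)[OF g] z(2)[OF g] y by simp
    moreover have "aY g y \<in> ?Y" using Y_facts(3)[OF g y(1)] y by simp
    ultimately have "aY g y = y" using inj y(1) by (simp add: inj_on_def)
    then show ?thesis using y yQ by simp
  qed
  then show ?thesis using that yQ Q(1) by blast
qed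

text \<open>
  Strong proximality moves \<open>\<Lambda>\<close> and a point mass towards a common limit, which is \<open>\<Lambda>\<close> because \<open>\<Lambda>\<close> is
  invariant. The point masses form a closed set, so \<open>\<Lambda>\<close> is itself a point mass.
\<close>

theorem strongly_proximal_fixed_point:
  assumes TG: "topological_group G T" and fl: "flow G T X act" and sp: "strongly_proximal G X act"
    and L: "\<Lambda> \<in> Prob X" and inv: "\<And>g. g \<in> carrier G \<Longrightarrow> Prob_action X act g \<Lambda> = \<Lambda>"
  obtains x where "x \<in> topspace X" "\<And>g. g \<in> carrier G \<Longrightarrow> act g x = x"
proof -
  note PX = flow_Prob_eq_states[OF fl]
  let ?P = "top_of_set (Prob X)" and ?a = "Prob_action X act"
  obtain x0 where x0: "x0 \<in> topspace X" using flow_nonempty[OF fl] by blast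
  have push_dirac': "?a g (dirac X x) = dirac X (act g x)" if "g \<in> carrier G" "x \<in> topspace X" for g x
    using push_dirac[OF flow_continuous_act[OF TG fl that(1)] that(2)]
      Prob_action_eq_push[of "dirac X x" X act g] dirac_state[OF that(2)] by (simp add: PX)
  obtain F z where F: "F \<noteq> bot" "F \<le> principal (carrier G)"
      "limitin ?P (\<lambda>g. ?a g \<Lambda>) z F" "limitin ?P (\<lambda>g. ?a g (dirac X x0)) z F"
    using sp[unfolded strongly_proximal_def proximal_def, rule_format, of \<Lambda> "dirac X x0"] dirac_state[OF x0] L
    by (auto simp: PX)
  have ev: "eventually (\<lambda>g. g \<in> carrier G) F" using F(2) by (simp add: le_principal)
  have "eventually (\<lambda>g. ?a g \<Lambda> = \<Lambda>) F" using inv by (rule eventually_mono[OF ev])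
  then have "limitin ?P (\<lambda>g. ?a g \<Lambda>) \<Lambda> F" using L by (intro limitin_eventually) auto
  then have "z = \<Lambda>" using limitin_Hausdorff_unique[OF F(3)] F(1) Hausdorff_top_of_set_lcs by blast
  have "compactin (top_of_set (states X)) (dirac X ` topspace X)"
    using image_compactin[OF _ continuous_dirac] flow_compact[OF fl] by (simp add: compact_space_def)
  then have "closedin ?P (dirac X ` topspace X)"
    unfolding PX by (rule compactin_imp_closedin[OF Hausdorff_top_of_set_lcs])
  moreover have "eventually (\<lambda>g. ?a g (dirac X x0) \<in> dirac X ` topspace X) F"
    by (rule eventually_mono[OF ev]) (simp add: push_dirac' x0 flow_closed[OF fl])
  ultimately have "z \<in> dirac X ` topspace X" using limitin_closedin[OF F(4)] F(1) by blast
  then obtain x where x: "x \<in> topspace X" "\<Lambda> = dirac X x" using \<open>z = \<Lambda>\<close> by blast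
  have "act g x = x" if g: "g \<in> carrier G" for g
  proof (rule ccontr)
    assume ne: "act g x \<noteq> x"
    have gx: "act g x \<in> topspace X" using flow_closed[OF fl g x(1)] .
    obtain f where f: "cont X f" "f (act g x) \<noteq> f x"
      using Urysohn_point[OF flow_compact[OF fl] flow_Hausdorff[OF fl] gx x(1) ne] by blast
    have "dirac X (act g x) = dirac X x" using inv[OF g] push_dirac'[OF g x(1)] x(2) by simp
    then show False using f integ_dirac[OF gx f(1)] integ_dirac[OF x(1) f(1)] by simp
  qed
  then show ?thesis using that x(1) by blast
qed

section \<open>The Samuel compactification of a coset space\<close>

context topological_group
begin

lemma continuous_translations:
  assumes "a \<in> carrier G"
  shows "continuous_map T T (\<lambda>x. a \<otimes> x)" "continuous_map T T (\<lambda>x. x \<otimes> a)"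
proof -
  have a: "a \<in> topspace T" using assms by (simp add: topspace_eq)
  have "continuous_map T (prod_topology T T) (\<lambda>x. (a, x))" "continuous_map T (prod_topology T T) (\<lambda>x. (x, a))"
    using a by (auto intro!: continuous_map_pairedI)
  from this[THEN continuous_map_compose, OF continuous_mult]
  show "continuous_map T T (\<lambda>x. a \<otimes> x)" "continuous_map T T (\<lambda>x. x \<otimes> a)" by (simp_all add: comp_def)
qed

lemma open_translate:
  assumes "k \<in> carrier G" "openin T U"
  shows "openin T {g \<in> carrier G. g \<otimes> inv k \<in> U}"
  using openin_continuous_map_preimage[OF continuous_translations(2)[OF inv_closed[OF assms(1)]] assms(2)]
  by (simp add: topspace_eq)

lemma open_conjugate:
  assumes "k \<in> carrier G" "openin T U" "\<one> \<in> U"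
  obtains V where "openin T V" "\<one> \<in> V" "\<And>v. v \<in> V \<Longrightarrow> v \<in> carrier G \<and> k \<otimes> v \<otimes> inv k \<in> U"
proof -
  have "continuous_map T T (\<lambda>v. k \<otimes> v \<otimes> inv k)"
    using continuous_map_compose[OF continuous_translations(1)[OF assms(1)] continuous_translations(2)[OF inv_closed[OF assms(1)]]]
    by (simp add: comp_def)
  from openin_continuous_map_preimage[OF this assms(2)]
  have "openin T {v \<in> carrier G. k \<otimes> v \<otimes> inv k \<in> U}" by (simp add: topspace_eq)
  moreover have "\<one> \<in> {v \<in> carrier G. k \<otimes> v \<otimes> inv k \<in> U}" using assms by simp
  ultimately show ?thesis using that by blast
qed

lemma open_carrier: "openin T (carrier G)"
  by (metis openin_topspace topspace_eq)

lemma open_subset: "openin T U \<Longrightarrow> u \<in> U \<Longrightarrow> u \<in> carrier G"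
  using openin_subset topspace_eq by blast

end

lemma continuous_map_complex_mult:
  fixes f g :: "'x \<Rightarrow> complex"
  shows "\<lbrakk>continuous_map X euclidean f; continuous_map X euclidean g\<rbrakk> \<Longrightarrow> continuous_map X euclidean (\<lambda>x. f x * g x)"
  by (simp add: continuous_map_atin tendsto_mult)

locale coset_space = topological_group G T for G :: "('a, 'b) monoid_scheme" (structure) and T +
  fixes H :: "'a set"
  assumes subgroup_H: "subgroup H G"
begin

abbreviation "S \<equiv> lcosets H"
abbreviation "R \<equiv> RUC G T H"
abbreviation "SaH \<equiv> Sa G T H"
abbreviation "act \<equiv> Sa_action G T H"

lemma H_subset: "H \<subseteq> carrier G" by (rule subgroup.subset[OF subgroup_H])

lemma cosetE:
  assumes "x \<in> S"
  obtains k where "k \<in> carrier G" "x = k <#\<^bsub>G\<^esub> H"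
  using assms by (auto simp: LCOSETS_def)

lemma coset_in: "k \<in> carrier G \<Longrightarrow> k <#\<^bsub>G\<^esub> H \<in> S"
  by (auto simp: LCOSETS_def)

lemma base_in: "H \<in> S"
  using coset_in[OF one_closed] lcos_mult_one[OF H_subset] by simp

lemma coset_act:
  assumes "x \<in> S"
  shows "g \<in> carrier G \<Longrightarrow> g <#\<^bsub>G\<^esub> x \<in> S" "\<one> <#\<^bsub>G\<^esub> x = x"
    "\<lbrakk>g \<in> carrier G; h \<in> carrier G\<rbrakk> \<Longrightarrow> g <#\<^bsub>G\<^esub> (h <#\<^bsub>G\<^esub> x) = (g \<otimes> h) <#\<^bsub>G\<^esub> x"
proof -
  obtain k where k: "k \<in> carrier G" "x = k <#\<^bsub>G\<^esub> H" using assms by (rule cosetE)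
  show "g <#\<^bsub>G\<^esub> x \<in> S" if "g \<in> carrier G"
    unfolding k(2) lcos_m_assoc[OF H_subset that k(1)] using that k(1) by (simp add: coset_in)
  have x: "x \<subseteq> carrier G" unfolding k(2) by (rule l_coset_subset_G[OF H_subset k(1)])
  show "\<one> <#\<^bsub>G\<^esub> x = x" by (rule lcos_mult_one[OF x])
  show "g <#\<^bsub>G\<^esub> (h <#\<^bsub>G\<^esub> x) = (g \<otimes> h) <#\<^bsub>G\<^esub> x" if "g \<in> carrier G" "h \<in> carrier G" using lcos_m_assoc[OF x that] .
qed

lemma RUC_uniform:
  assumes "f \<in> R" "0 < e"
  obtains U where "openin T U" "\<one> \<in> U" "\<And>u x. \<lbrakk>u \<in> U; x \<in> S\<rbrakk> \<Longrightarrow> cmod (f (u <#\<^bsub>G\<^esub> x) - f x) < e"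
proof -
  have "\<forall>\<epsilon>>0. \<exists>U. openin T U \<and> \<one> \<in> U \<and> (\<forall>u\<in>U. \<forall>x\<in>S. cmod (f (u <#\<^bsub>G\<^esub> x) - f x) < \<epsilon>)"
    using assms(1) unfolding RUC_def mem_Collect_eq by (elim conjE)
  from this[rule_format, OF assms(2)] obtain U where
    U: "openin T U" "\<one> \<in> U" "\<forall>u\<in>U. \<forall>x\<in>S. cmod (f (u <#\<^bsub>G\<^esub> x) - f x) < e" by (elim exE conjE)
  show ?thesis by (rule that[OF U(1,2)]) (use U(3) in simp)
qed

lemma RUC_bounded:
  assumes "f \<in> R"
  obtains B where "0 < B" "\<And>x. x \<in> S \<Longrightarrow> cmod (f x) \<le> B"
  using assms unfolding RUC_def mem_Collect_eq bounded_pos by auto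

lemma RUC_extensional: "f \<in> R \<Longrightarrow> restrict f S = f"
  by (simp add: RUC_def extensional_restrict)

lemma RUC_I:
  assumes "\<And>x. x \<in> S \<Longrightarrow> cmod (f x) \<le> B"
    and "\<And>e. 0 < e \<Longrightarrow> \<exists>U. openin T U \<and> \<one> \<in> U \<and> (\<forall>u\<in>U. \<forall>x\<in>S. cmod (f (u <#\<^bsub>G\<^esub> x) - f x) < e)"
  shows "restrict f S \<in> R"
  unfolding RUC_def mem_Collect_eq
proof (intro conjI allI impI)
  show "bounded (restrict f S ` S)" unfolding bounded_iff using assms(1) by auto
  fix e :: real assume "0 < e"
  then obtain U where U: "openin T U" "\<one> \<in> U" "\<forall>u\<in>U. \<forall>x\<in>S. cmod (f (u <#\<^bsub>G\<^esub> x) - f x) < e"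
    using assms(2) by blast
  have "cmod (restrict f S (u <#\<^bsub>G\<^esub> x) - restrict f S x) < e" if "u \<in> U" "x \<in> S" for u x
    using U(3) that coset_act(1)[OF that(2) open_subset[OF U(1) that(1)]] by simp
  then show "\<exists>U. openin T U \<and> \<one> \<in> U \<and> (\<forall>u\<in>U. \<forall>x\<in>S. cmod (restrict f S (u <#\<^bsub>G\<^esub> x) - restrict f S x) < e)"
    using U by blast
qed simp

text \<open>
  A continuous function of two variables is uniformly continuous on the bounded set in which the pair
  of functions takes its values. All algebra operations are instances.
\<close>

lemma RUC_compose:
  assumes f: "f \<in> R" and h: "h \<in> R" and \<Phi>: "continuous_on UNIV (\<lambda>(a, b). \<Phi> a b :: complex)"
  shows "(\<lambda>x\<in>S. \<Phi> (f x) (h x)) \<in> R"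
proof -
  let ?\<Phi> = "\<lambda>(a, b). \<Phi> a b"
  obtain B where B: "\<And>x. x \<in> S \<Longrightarrow> cmod (f x) \<le> B" using RUC_bounded[OF f] by blast
  obtain C where C: "\<And>x. x \<in> S \<Longrightarrow> cmod (h x) \<le> C" using RUC_bounded[OF h] by blast
  let ?K = "cball (0::complex) B \<times> cball (0::complex) C"
  have K: "compact ?K" by (intro compact_Times compact_cball)
  have fhK: "(f x, h x) \<in> ?K" if "x \<in> S" for x using B C that by simp
  have cont: "continuous_on ?K ?\<Phi>" using continuous_on_subset[OF \<Phi>] by simp
  have "bounded (?\<Phi> ` ?K)" using compact_continuous_image[OF cont K] by (rule compact_imp_bounded)
  then obtain D where "\<forall>z\<in>?\<Phi> ` ?K. norm z \<le> D" unfolding bounded_iff by blast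
  then have D: "cmod (\<Phi> (f x) (h x)) \<le> D" if "x \<in> S" for x using fhK[OF that] by force
  have uc: "uniformly_continuous_on ?K ?\<Phi>" by (rule compact_uniformly_continuous[OF cont K])
  show ?thesis
  proof (rule RUC_I[of _ D, OF D])
    fix e :: real assume "0 < e"
    then obtain d where d: "0 < d" "\<And>p q. \<lbrakk>p \<in> ?K; q \<in> ?K; dist q p < d\<rbrakk> \<Longrightarrow> dist (?\<Phi> q) (?\<Phi> p) < e"
      using uc unfolding uniformly_continuous_on_def by metis
    obtain U where U: "openin T U" "\<one> \<in> U" "\<And>u x. \<lbrakk>u \<in> U; x \<in> S\<rbrakk> \<Longrightarrow> cmod (f (u <#\<^bsub>G\<^esub> x) - f x) < d/2"
      using RUC_uniform[OF f, of "d/2"] d(1) by auto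
    obtain V where V: "openin T V" "\<one> \<in> V" "\<And>u x. \<lbrakk>u \<in> V; x \<in> S\<rbrakk> \<Longrightarrow> cmod (h (u <#\<^bsub>G\<^esub> x) - h x) < d/2"
      using RUC_uniform[OF h, of "d/2"] d(1) by auto
    have "cmod (\<Phi> (f (u <#\<^bsub>G\<^esub> x)) (h (u <#\<^bsub>G\<^esub> x)) - \<Phi> (f x) (h x)) < e" if u: "u \<in> U \<inter> V" and x: "x \<in> S" for u x
    proof -
      have ux: "u <#\<^bsub>G\<^esub> x \<in> S" using coset_act(1)[OF x] open_subset[OF U(1)] u by blast
      have "dist (f (u <#\<^bsub>G\<^esub> x), h (u <#\<^bsub>G\<^esub> x)) (f x, h x) \<le> dist (f (u <#\<^bsub>G\<^esub> x)) (f x) + dist (h (u <#\<^bsub>G\<^esub> x)) (h x)"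
        unfolding dist_prod_def using sqrt_sum_squares_le_sum by simp
      also have "\<dots> < d" using U(3)[OF _ x, of u] V(3)[OF _ x, of u] u by (simp add: dist_norm)
      finally show ?thesis using d(2)[OF fhK[OF x] fhK[OF ux]] by (simp add: dist_norm)
    qed
    then show "\<exists>U. openin T U \<and> \<one> \<in> U \<and>
        (\<forall>u\<in>U. \<forall>x\<in>S. cmod (\<Phi> (f (u <#\<^bsub>G\<^esub> x)) (h (u <#\<^bsub>G\<^esub> x)) - \<Phi> (f x) (h x)) < e)"
      using U V by (intro exI[of _ "U \<inter> V"]) auto
  qed
qed

lemma RUC_const: "(\<lambda>x\<in>S. c) \<in> R"
  by (rule RUC_I[of _ "cmod c"]) (use open_carrier in auto)

lemma RUC_add: "\<lbrakk>f \<in> R; h \<in> R\<rbrakk> \<Longrightarrow> (\<lambda>x\<in>S. f x + h x) \<in> R"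
  by (rule RUC_compose) (auto simp: case_prod_beta intro!: continuous_intros)

lemma RUC_mult: "\<lbrakk>f \<in> R; h \<in> R\<rbrakk> \<Longrightarrow> (\<lambda>x\<in>S. f x * h x) \<in> R"
  by (rule RUC_compose) (auto simp: case_prod_beta intro!: continuous_intros)

lemma RUC_scale: "f \<in> R \<Longrightarrow> (\<lambda>x\<in>S. c * f x) \<in> R"
  by (rule RUC_compose[of f f "\<lambda>a b. c * a"]) (auto simp: case_prod_beta intro!: continuous_intros)

lemma RUC_cnj: "f \<in> R \<Longrightarrow> (\<lambda>x\<in>S. cnj (f x)) \<in> R"
  by (rule RUC_compose[of f f "\<lambda>a b. cnj a"]) (auto simp: case_prod_beta intro!: continuous_intros)

lemma RUC_inverse_max:
  assumes "f \<in> R" "0 < r"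
  shows "(\<lambda>x\<in>S. 1 / complex_of_real (max r (Re (f x)))) \<in> R"
proof (rule RUC_compose[OF assms(1,1), of "\<lambda>a b. 1 / complex_of_real (max r (Re a))"])
  have "max r (Re a) \<noteq> 0" for a using assms(2) by (simp add: max_def)
  then have "continuous_on UNIV (\<lambda>p. 1 / complex_of_real (max r (Re (fst p :: complex))))"
    by (intro continuous_intros) auto
  then show "continuous_on UNIV (\<lambda>(a, b::complex). 1 / complex_of_real (max r (Re a)))"
    by (simp add: case_prod_beta)
qed

lemma RUC_translate:
  assumes f: "f \<in> R" and g: "g \<in> carrier G"
  shows "(\<lambda>x\<in>S. f (g <#\<^bsub>G\<^esub> x)) \<in> R"
proof -
  obtain B where B: "\<And>x. x \<in> S \<Longrightarrow> cmod (f x) \<le> B" using RUC_bounded[OF f] by blast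
  show ?thesis
  proof (rule RUC_I[of _ B])
    show "cmod (f (g <#\<^bsub>G\<^esub> x)) \<le> B" if "x \<in> S" for x using B coset_act(1)[OF that g] by blast
    fix e :: real assume "0 < e"
    then obtain U where U: "openin T U" "\<one> \<in> U" "\<And>u x. \<lbrakk>u \<in> U; x \<in> S\<rbrakk> \<Longrightarrow> cmod (f (u <#\<^bsub>G\<^esub> x) - f x) < e"
      using RUC_uniform[OF f] by blast
    obtain V where V: "openin T V" "\<one> \<in> V" "\<And>v. v \<in> V \<Longrightarrow> v \<in> carrier G \<and> g \<otimes> v \<otimes> inv g \<in> U"
      using open_conjugate[OF g U(1,2)] by blast
    have "cmod (f (g <#\<^bsub>G\<^esub> (v <#\<^bsub>G\<^esub> x)) - f (g <#\<^bsub>G\<^esub> x)) < e" if "v \<in> V" "x \<in> S" for v x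
    proof -
      have v: "v \<in> carrier G" using V(3)[OF that(1)] by blast
      have "g \<otimes> v = (g \<otimes> v \<otimes> inv g) \<otimes> g" using g v by (simp add: m_assoc)
      then have "g <#\<^bsub>G\<^esub> (v <#\<^bsub>G\<^esub> x) = (g \<otimes> v \<otimes> inv g) <#\<^bsub>G\<^esub> (g <#\<^bsub>G\<^esub> x)"
        using coset_act(3)[OF that(2)] g v by simp
      then show ?thesis using U(3)[OF _ coset_act(1)[OF that(2) g]] V(3)[OF that(1)] by simp
    qed
    then show "\<exists>U. openin T U \<and> \<one> \<in> U \<and> (\<forall>u\<in>U. \<forall>x\<in>S. cmod (f (g <#\<^bsub>G\<^esub> (u <#\<^bsub>G\<^esub> x)) - f (g <#\<^bsub>G\<^esub> x)) < e)"
      using V by blast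
  qed
qed

subsection \<open>Characters\<close>

lemma Sa_iff:
  "\<omega> \<in> topspace SaH \<longleftrightarrow> \<omega> \<in> extensional R \<and> \<omega> (\<lambda>x\<in>S. 1) = 1 \<and>
     (\<forall>c. \<forall>f\<in>R. \<omega> (\<lambda>x\<in>S. c * f x) = c * \<omega> f) \<and>
     (\<forall>f\<in>R. \<forall>h\<in>R. \<omega> (\<lambda>x\<in>S. f x + h x) = \<omega> f + \<omega> h \<and> \<omega> (\<lambda>x\<in>S. f x * h x) = \<omega> f * \<omega> h)"
  by (auto simp: Sa_def gelfand_spectrum_def PiE_iff)

lemma char_one: "\<omega> \<in> topspace SaH \<Longrightarrow> \<omega> (\<lambda>x\<in>S. 1) = 1"
  and char_scale: "\<lbrakk>\<omega> \<in> topspace SaH; f \<in> R\<rbrakk> \<Longrightarrow> \<omega> (\<lambda>x\<in>S. c * f x) = c * \<omega> f"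
  and char_add: "\<lbrakk>\<omega> \<in> topspace SaH; f \<in> R; h \<in> R\<rbrakk> \<Longrightarrow> \<omega> (\<lambda>x\<in>S. f x + h x) = \<omega> f + \<omega> h"
  and char_mult: "\<lbrakk>\<omega> \<in> topspace SaH; f \<in> R; h \<in> R\<rbrakk> \<Longrightarrow> \<omega> (\<lambda>x\<in>S. f x * h x) = \<omega> f * \<omega> h"
  and char_extensional: "\<omega> \<in> topspace SaH \<Longrightarrow> \<omega> \<in> extensional R"
  unfolding Sa_iff by blast+

lemma restrict_cong_S: "(\<And>x. x \<in> S \<Longrightarrow> f x = h x) \<Longrightarrow> restrict f S = restrict h S"
  by (rule restrict_ext)

lemma char_const: "\<omega> \<in> topspace SaH \<Longrightarrow> \<omega> (\<lambda>x\<in>S. c) = c"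
  using char_scale[OF _ RUC_const[of 1], of \<omega> c] char_one[of \<omega>]
    restrict_cong_S[of "\<lambda>x. c * (\<lambda>x\<in>S. 1) x" "\<lambda>_. c"] by simp

text \<open>
  A character vanishes on \<open>f - \<omega> f\<close>, hence by multiplicativity on the product of this function with its
  complex conjugate.
\<close>

lemma square_distance_function:
  assumes \<omega>: "\<omega> \<in> topspace SaH" and I: "finite I" "I \<subseteq> R"
  shows "(\<lambda>x\<in>S. complex_of_real (\<Sum>f\<in>I. (cmod (f x - \<omega> f))\<^sup>2)) \<in> R \<and>
     \<omega> (\<lambda>x\<in>S. complex_of_real (\<Sum>f\<in>I. (cmod (f x - \<omega> f))\<^sup>2)) = 0"
  using I
proof (induction I rule: finite_induct)
  case empty
  show ?case using RUC_const[of 0] char_const[OF \<omega>, of 0] by (simp only: sum.empty of_real_0 simp_thms)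
next
  case (insert f I)
  let ?q = "\<lambda>x\<in>S. complex_of_real (\<Sum>f\<in>I. (cmod (f x - \<omega> f))\<^sup>2)"
  let ?d = "\<lambda>x\<in>S. f x + (\<lambda>x\<in>S. - \<omega> f) x"
  let ?c = "\<lambda>x\<in>S. cnj (?d x)"
  have fI: "f \<in> R" "I \<subseteq> R" using insert.prems by simp_all
  note f = fI(1) and q = insert.IH[OF fI(2), THEN conjunct1] insert.IH[OF fI(2), THEN conjunct2]
  have sq: "(f x - \<omega> f) * cnj (f x - \<omega> f) = complex_of_real ((cmod (f x - \<omega> f))\<^sup>2)" for x
    by (rule complex_norm_square[symmetric])
  have d: "?d \<in> R" by (rule RUC_add[OF f RUC_const])
  have c: "?c \<in> R" by (rule RUC_cnj[OF d])
  have p: "(\<lambda>x\<in>S. ?d x * ?c x) \<in> R" by (rule RUC_mult[OF d c])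
  have "\<omega> ?d = 0" unfolding char_add[OF \<omega> f RUC_const] char_const[OF \<omega>] by simp
  then have "\<omega> (\<lambda>x\<in>S. ?d x * ?c x) = 0" unfolding char_mult[OF \<omega> d c] by simp
  then have "\<omega> (\<lambda>x\<in>S. ?q x + (\<lambda>x\<in>S. ?d x * ?c x) x) = 0" unfolding char_add[OF \<omega> q(1) p] q(2) by simp
  moreover have "(\<lambda>x\<in>S. ?q x + (\<lambda>x\<in>S. ?d x * ?c x) x) =
      (\<lambda>x\<in>S. complex_of_real (\<Sum>f\<in>insert f I. (cmod (f x - \<omega> f))\<^sup>2))"
    using insert(1,2) by (intro restrict_cong_S) (simp add: sq del: complex_cnj_add complex_cnj_diff)
  moreover have "(\<lambda>x\<in>S. ?q x + (\<lambda>x\<in>S. ?d x * ?c x) x) \<in> R" by (rule RUC_add[OF q(1) p])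
  ultimately show ?case by (simp only: simp_thms)
qed

text \<open>
  Otherwise the function of the previous lemma is bounded away from \<open>0\<close> and so invertible in the
  algebra, but a character vanishes on it. This is the density of \<open>G/H\<close> in the spectrum.
\<close>

theorem char_approx:
  assumes \<omega>: "\<omega> \<in> topspace SaH" and I: "finite I" "I \<subseteq> R" and e: "0 < e"
  obtains x where "x \<in> S" "\<And>f. f \<in> I \<Longrightarrow> cmod (f x - \<omega> f) < e"
proof (rule ccontr)
  note far = that
  assume "\<not> thesis"
  then have no: "\<exists>f\<in>I. e \<le> cmod (f x - \<omega> f)" if "x \<in> S" for x using far[OF that] by force
  let ?q = "\<lambda>x\<in>S. complex_of_real (\<Sum>f\<in>I. (cmod (f x - \<omega> f))\<^sup>2)"
  let ?i = "\<lambda>x\<in>S. 1 / complex_of_real (max (e\<^sup>2) (Re (?q x)))"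
  have q: "?q \<in> R" "\<omega> ?q = 0" using square_distance_function[OF \<omega> I] by auto
  have i: "?i \<in> R" using e by (intro RUC_inverse_max q(1)) simp
  have "?q x * ?i x = 1" if x: "x \<in> S" for x
  proof -
    obtain f where f: "f \<in> I" "e \<le> cmod (f x - \<omega> f)" using no[OF x] by blast
    have "e\<^sup>2 \<le> (cmod (f x - \<omega> f))\<^sup>2" using f e by (simp add: power_mono)
    also have "\<dots> \<le> (\<Sum>f\<in>I. (cmod (f x - \<omega> f))\<^sup>2)" using f I by (intro member_le_sum) auto
    finally have le: "e\<^sup>2 \<le> (\<Sum>f\<in>I. (cmod (f x - \<omega> f))\<^sup>2)" .
    moreover have "0 < e\<^sup>2" using e by simp
    ultimately have "(\<Sum>f\<in>I. (cmod (f x - \<omega> f))\<^sup>2) \<noteq> 0" by linarith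
    then show ?thesis using x le by (simp add: max_absorb2 del: of_real_sum)
  qed
  then have "(\<lambda>x\<in>S. ?q x * ?i x) = (\<lambda>x\<in>S. 1)" by (rule restrict_cong_S)
  then have "\<omega> (\<lambda>x\<in>S. 1) = 0" using char_mult[OF \<omega> q(1) i] q(2) by simp
  then show False using char_one[OF \<omega>] by simp
qed

lemma char_closed_condition:
  assumes \<omega>: "\<omega> \<in> topspace SaH" and f: "f \<in> R" and C: "closed C" "\<And>x. x \<in> S \<Longrightarrow> f x \<in> C"
  shows "\<omega> f \<in> C"
proof (rule ccontr)
  assume "\<omega> f \<notin> C"
  then obtain e where e: "0 < e" "ball (\<omega> f) e \<subseteq> - C"
    using C(1) open_contains_ball[of "- C"] by (auto simp: open_Compl)
  obtain x where x: "x \<in> S" "cmod (f x - \<omega> f) < e" using char_approx[OF \<omega>, of "{f}" e] f e(1) by auto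
  then have "f x \<in> ball (\<omega> f) e" by (simp add: dist_norm norm_minus_commute)
  then show False using e(2) C(2)[OF x(1)] by blast
qed

lemma char_bound:
  assumes "\<omega> \<in> topspace SaH" "f \<in> R" "\<And>x. x \<in> S \<Longrightarrow> cmod (f x) \<le> B"
  shows "cmod (\<omega> f) \<le> B"
  using char_closed_condition[OF assms(1,2), of "cball 0 B"] assms(3) by auto

definition eval :: "'a set \<Rightarrow> ('a set \<Rightarrow> complex) \<Rightarrow> complex" where
  "eval x = (\<lambda>f\<in>R. f x)"

lemma eval_in: "x \<in> S \<Longrightarrow> eval x \<in> topspace SaH"
  unfolding Sa_iff eval_def by (auto simp: RUC_const RUC_scale RUC_add RUC_mult)

lemma Sa_subtopology: "SaH = subtopology (product_topology (\<lambda>_. euclidean) R) (topspace SaH)"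
  unfolding Sa_def gelfand_spectrum_def topspace_subtopology subtopology_restrict ..

lemma continuous_char: "f \<in> R \<Longrightarrow> continuous_map SaH euclidean (\<lambda>\<omega>. \<omega> f)"
  unfolding Sa_def gelfand_spectrum_def
  by (rule continuous_map_from_subtopology[OF continuous_map_product_projection])

lemma continuous_map_into_Sa:
  assumes "\<And>z. z \<in> topspace Z \<Longrightarrow> F z \<in> topspace SaH"
    and "\<And>f. f \<in> R \<Longrightarrow> continuous_map Z euclidean (\<lambda>z. F z f)"
  shows "continuous_map Z SaH F"
proof -
  have "continuous_map Z (product_topology (\<lambda>_. euclidean) R) F"
    unfolding continuous_map_componentwise using assms char_extensional by auto
  then show ?thesis
    using assms(1) unfolding Sa_def gelfand_spectrum_def continuous_map_in_subtopology topspace_subtopology by auto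
qed

lemma Hausdorff_Sa: "Hausdorff_space SaH"
  unfolding Sa_def gelfand_spectrum_def
  by (intro Hausdorff_space_subtopology) (simp add: Hausdorff_space_product_topology)

lemma compact_Sa: "compact_space SaH"
proof -
  let ?P = "product_topology (\<lambda>_. euclidean :: complex topology) R"
  have pr: "continuous_map ?P euclidean (\<lambda>\<omega>. \<omega> f)" if "f \<in> R" for f
    using that by (rule continuous_map_product_projection)
  \<comment> \<open>The spectrum is the set of solutions of a family of equations between continuous functions; \<open>E\<close>
    consists of the pairs of their two sides.\<close>
  define E :: "(('a sa_point \<Rightarrow> complex) \<times> ('a sa_point \<Rightarrow> complex)) set" where "E = {((\<lambda>\<omega>. \<omega> (\<lambda>x\<in>S. 1)), (\<lambda>\<omega>. 1))}
    \<union> {((\<lambda>\<omega>. \<omega> (\<lambda>x\<in>S. c * f x)), (\<lambda>\<omega>. c * \<omega> f)) | c f. f \<in> R}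
    \<union> {((\<lambda>\<omega>. \<omega> (\<lambda>x\<in>S. f x + h x)), (\<lambda>\<omega>. \<omega> f + \<omega> h)) | f h. f \<in> R \<and> h \<in> R}
    \<union> {((\<lambda>\<omega>. \<omega> (\<lambda>x\<in>S. f x * h x)), (\<lambda>\<omega>. \<omega> f * \<omega> h)) | f h. f \<in> R \<and> h \<in> R}"
  let ?Z = "\<lambda>p. {\<omega> \<in> topspace ?P. fst p \<omega> = snd p \<omega>}"
  have "continuous_map ?P euclidean (fst p) \<and> continuous_map ?P euclidean (snd p)" if "p \<in> E" for p
    using that unfolding E_def
    by (auto intro!: pr continuous_map_add continuous_map_complex_mult RUC_const RUC_scale RUC_add RUC_mult)
  then have "closedin ?P (?Z p)" if "p \<in> E" for p
    using that by (intro closedin_continuous_maps_eq[of euclidean]) auto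
  moreover have "E \<noteq> {}" by (simp add: E_def)
  ultimately have cl: "closedin ?P (\<Inter>(?Z ` E))" by (intro closedin_INT)
  have eq: "topspace SaH = \<Inter>(?Z ` E)"
  proof (intro equalityI subsetI)
    fix \<omega> assume "\<omega> \<in> topspace SaH"
    then show "\<omega> \<in> \<Inter>(?Z ` E)" unfolding Sa_iff E_def by (auto simp: PiE_iff)
  next
    fix \<omega> assume w: "\<omega> \<in> \<Inter>(?Z ` E)"
    then have *: "fst p \<omega> = snd p \<omega>" if "p \<in> E" for p using that by blast
    have "\<omega> \<in> topspace ?P" using w by (auto simp: E_def)
    then have "\<omega> \<in> extensional R" by (simp add: PiE_iff)
    moreover have "\<omega> (\<lambda>x\<in>S. 1) = 1"
      by (rule *[of "((\<lambda>\<omega>. \<omega> (\<lambda>x\<in>S. 1)), (\<lambda>\<omega>. 1))", unfolded fst_conv snd_conv]) (simp add: E_def)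
    moreover have "\<omega> (\<lambda>x\<in>S. c * f x) = c * \<omega> f" if "f \<in> R" for c f
      by (rule *[of "((\<lambda>\<omega>. \<omega> (\<lambda>x\<in>S. c * f x)), (\<lambda>\<omega>. c * \<omega> f))", unfolded fst_conv snd_conv])
        (use that in \<open>unfold E_def, blast\<close>)
    moreover have "\<omega> (\<lambda>x\<in>S. f x + h x) = \<omega> f + \<omega> h" if "f \<in> R" "h \<in> R" for f h
      by (rule *[of "((\<lambda>\<omega>. \<omega> (\<lambda>x\<in>S. f x + h x)), (\<lambda>\<omega>. \<omega> f + \<omega> h))", unfolded fst_conv snd_conv])
        (use that in \<open>unfold E_def, blast\<close>)
    moreover have "\<omega> (\<lambda>x\<in>S. f x * h x) = \<omega> f * \<omega> h" if "f \<in> R" "h \<in> R" for f h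
      by (rule *[of "((\<lambda>\<omega>. \<omega> (\<lambda>x\<in>S. f x * h x)), (\<lambda>\<omega>. \<omega> f * \<omega> h))", unfolded fst_conv snd_conv])
        (use that in \<open>unfold E_def, blast\<close>)
    ultimately show "\<omega> \<in> topspace SaH" unfolding Sa_iff by blast
  qed
  have "\<exists>B. \<forall>x\<in>S. f \<in> R \<longrightarrow> cmod (f x) \<le> B" for f using RUC_bounded[of f] by metis
  then obtain B where B: "\<And>f x. \<lbrakk>f \<in> R; x \<in> S\<rbrakk> \<Longrightarrow> cmod (f x) \<le> B f" by metis
  let ?K = "Pi\<^sub>E R (\<lambda>f. cball 0 (B f))"
  have K: "compactin ?P ?K" unfolding compactin_PiE by simp
  have sub: "topspace SaH \<subseteq> ?K"
  proof
    fix \<omega> assume w: "\<omega> \<in> topspace SaH"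
    have "\<omega> f \<in> cball 0 (B f)" if "f \<in> R" for f
      using char_bound[OF w that, of "B f"] B[OF that] by (simp add: dist_norm)
    then show "\<omega> \<in> ?K" using char_extensional[OF w] unfolding PiE_iff by blast
  qed
  have "compactin ?P (topspace SaH)"
    using closed_compactin[OF K sub] cl unfolding eq by blast
  then have "compact_space (subtopology ?P (topspace SaH))" by (rule compact_space_subtopology)
  then show ?thesis unfolding Sa_subtopology[symmetric] .
qed

lemma Sa_dense: "topspace SaH \<subseteq> SaH closure_of (eval ` S)"
proof
  fix \<omega> assume w: "\<omega> \<in> topspace SaH"
  let ?P = "product_topology (\<lambda>_. euclidean :: complex topology) R"
  show "\<omega> \<in> SaH closure_of (eval ` S)"
    unfolding in_closure_of
  proof (intro conjI allI impI w)
    fix W assume W: "\<omega> \<in> W \<and> openin SaH W"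
    have "openin (subtopology ?P (topspace SaH)) W" using W Sa_subtopology by simp
    then obtain W' where W': "openin ?P W'" "W = W' \<inter> topspace SaH"
      unfolding openin_subtopology by blast
    have "\<omega> \<in> W'" using W W'(2) by blast
    from product_topology_open_contains_basis[OF W'(1) this]
    obtain O' where O: "\<omega> \<in> Pi\<^sub>E R O'" "\<And>i. open (O' i)" "finite {i. O' i \<noteq> UNIV}" "Pi\<^sub>E R O' \<subseteq> W'"
      by auto
    let ?I = "{i. O' i \<noteq> UNIV} \<inter> R"
    have "\<exists>e>0. ball (\<omega> i) e \<subseteq> O' i" if "i \<in> R" for i
      using O(1,2) that open_contains_ball by (metis PiE_mem)
    then obtain e where e: "\<And>i. i \<in> R \<Longrightarrow> 0 < e i \<and> ball (\<omega> i) (e i) \<subseteq> O' i" by metis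
    let ?e = "Min (insert 1 (e ` ?I))"
    have I: "finite ?I" using O(3) by simp
    have "0 < ?e" using I e by (subst Min_gr_iff) auto
    then obtain x where x: "x \<in> S" "\<And>f. f \<in> ?I \<Longrightarrow> cmod (f x - \<omega> f) < ?e"
      using char_approx[OF w I] by blast
    have "f x \<in> O' f" if f: "f \<in> R" for f
    proof (cases "O' f = UNIV")
      case False
      then have fI: "f \<in> ?I" using f by blast
      have "?e \<le> e f" using I fI by (intro Min_le) auto
      then have "f x \<in> ball (\<omega> f) (e f)" using x(2)[OF fI] by (simp add: dist_norm norm_minus_commute)
      then show ?thesis using e[OF f] by blast
    qed simp
    then have "eval x \<in> Pi\<^sub>E R O'" by (auto simp: eval_def)
    then have "eval x \<in> W" using O(4) W'(2) eval_in[OF x(1)] by blast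
    then show "\<exists>y. y \<in> eval ` S \<and> y \<in> W" using x(1) by blast
  qed
qed

subsection \<open>The action\<close>

lemma act_apply:
  assumes "\<omega> \<in> topspace SaH" "f \<in> R"
  shows "act g \<omega> f = \<omega> (\<lambda>x\<in>S. f (g <#\<^bsub>G\<^esub> x))"
  using assms by (simp add: Sa_action_def)

lemma act_in:
  assumes w: "\<omega> \<in> topspace SaH" and g: "g \<in> carrier G"
  shows "act g \<omega> \<in> topspace SaH"
proof -
  have t: "(\<lambda>x\<in>S. restrict f S (g <#\<^bsub>G\<^esub> x)) = (\<lambda>x\<in>S. f (g <#\<^bsub>G\<^esub> x))" for f :: "'a set \<Rightarrow> complex"
    by (rule restrict_cong_S) (simp add: coset_act(1)[OF _ g])
  have "act g \<omega> \<in> extensional R" using w by (simp add: Sa_action_def)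
  moreover have "act g \<omega> (\<lambda>x\<in>S. 1) = 1"
    unfolding act_apply[OF w RUC_const] t char_one[OF w] ..
  moreover have "act g \<omega> (\<lambda>x\<in>S. c * f x) = c * act g \<omega> f" if f: "f \<in> R" for c f
  proof -
    have "(\<lambda>x\<in>S. c * f (g <#\<^bsub>G\<^esub> x)) = (\<lambda>x\<in>S. c * (\<lambda>x\<in>S. f (g <#\<^bsub>G\<^esub> x)) x)" by (rule restrict_cong_S) simp
    then show ?thesis
      unfolding act_apply[OF w RUC_scale[OF f]] t act_apply[OF w f] using char_scale[OF w RUC_translate[OF f g]] by simp
  qed
  moreover have "act g \<omega> (\<lambda>x\<in>S. f x + h x) = act g \<omega> f + act g \<omega> h" if f: "f \<in> R" "h \<in> R" for f h
  proof -
    have "(\<lambda>x\<in>S. f (g <#\<^bsub>G\<^esub> x) + h (g <#\<^bsub>G\<^esub> x)) = (\<lambda>x\<in>S. (\<lambda>x\<in>S. f (g <#\<^bsub>G\<^esub> x)) x + (\<lambda>x\<in>S. h (g <#\<^bsub>G\<^esub> x)) x)"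
      by (rule restrict_cong_S) simp
    then show ?thesis
      unfolding act_apply[OF w RUC_add[OF f]] t act_apply[OF w f(1)] act_apply[OF w f(2)]
      using char_add[OF w RUC_translate[OF f(1) g] RUC_translate[OF f(2) g]] by simp
  qed
  moreover have "act g \<omega> (\<lambda>x\<in>S. f x * h x) = act g \<omega> f * act g \<omega> h" if f: "f \<in> R" "h \<in> R" for f h
  proof -
    have "(\<lambda>x\<in>S. f (g <#\<^bsub>G\<^esub> x) * h (g <#\<^bsub>G\<^esub> x)) = (\<lambda>x\<in>S. (\<lambda>x\<in>S. f (g <#\<^bsub>G\<^esub> x)) x * (\<lambda>x\<in>S. h (g <#\<^bsub>G\<^esub> x)) x)"
      by (rule restrict_cong_S) simp
    then show ?thesis
      unfolding act_apply[OF w RUC_mult[OF f]] t act_apply[OF w f(1)] act_apply[OF w f(2)]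
      using char_mult[OF w RUC_translate[OF f(1) g] RUC_translate[OF f(2) g]] by simp
  qed
  ultimately show ?thesis unfolding Sa_iff by blast
qed

lemma char_diff:
  assumes w: "\<omega> \<in> topspace SaH" and f: "f \<in> R" "h \<in> R" and B: "\<And>x. x \<in> S \<Longrightarrow> cmod (f x - h x) \<le> B"
  shows "cmod (\<omega> f - \<omega> h) \<le> B"
proof -
  let ?n = "\<lambda>x\<in>S. - 1 * h x"
  have n: "?n \<in> R" by (rule RUC_scale[OF f(2)])
  have "cmod (\<omega> (\<lambda>x\<in>S. f x + ?n x)) \<le> B" using B by (intro char_bound[OF w RUC_add[OF f(1) n]]) simp
  then show ?thesis unfolding char_add[OF w f(1) n] char_scale[OF w f(2)] by simp
qed

lemma continuous_act: "continuous_map (prod_topology T SaH) SaH (\<lambda>(g, \<omega>). act g \<omega>)"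
proof -
  have "continuous_map (prod_topology T SaH) SaH (\<lambda>p. act (fst p) (snd p))"
  proof (rule continuous_map_into_Sa)
    fix p assume "p \<in> topspace (prod_topology T SaH)"
    then show "act (fst p) (snd p) \<in> topspace SaH" using act_in by (auto simp: topspace_eq)
  next
    fix f assume f: "f \<in> R"
    have "continuous_map (prod_topology T SaH) Met_TC.mtopology (\<lambda>p. act (fst p) (snd p) f)"
      unfolding Met_TC.continuous_map_to_metric
    proof (intro ballI allI impI)
      fix p and e :: real assume p: "p \<in> topspace (prod_topology T SaH)" and e: "0 < e"
      obtain g \<omega> where pe: "p = (g, \<omega>)" by fastforce
      have g: "g \<in> carrier G" and w: "\<omega> \<in> topspace SaH" using p pe by (auto simp: topspace_eq)
      let ?h = "\<lambda>x\<in>S. f (g <#\<^bsub>G\<^esub> x)"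
      have h: "?h \<in> R" by (rule RUC_translate[OF f g])
      obtain U where U: "openin T U" "\<one> \<in> U" "\<And>u x. \<lbrakk>u \<in> U; x \<in> S\<rbrakk> \<Longrightarrow> cmod (f (u <#\<^bsub>G\<^esub> x) - f x) < e/2"
        using RUC_uniform[OF f, of "e/2"] e by auto
      let ?U = "{k \<in> carrier G. k \<otimes> inv g \<in> U}"
      have U': "openin T ?U" by (rule open_translate[OF g U(1)])
      let ?V = "{\<nu> \<in> topspace SaH. \<nu> ?h \<in> ball (\<omega> ?h) (e/2)}"
      have V: "openin SaH ?V" by (rule openin_continuous_map_preimage[OF continuous_char[OF h]]) simp
      have "act k \<nu> f \<in> ball (act g \<omega> f) e" if k: "k \<in> ?U" and n: "\<nu> \<in> ?V" for k \<nu>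
      proof -
        have kG: "k \<in> carrier G" and ns: "\<nu> \<in> topspace SaH" using k n by auto
        have "cmod (\<nu> (\<lambda>x\<in>S. f (k <#\<^bsub>G\<^esub> x)) - \<nu> ?h) \<le> e/2"
        proof (rule char_diff[OF ns RUC_translate[OF f kG] h])
          fix x assume x: "x \<in> S"
          have "k = (k \<otimes> inv g) \<otimes> g" using kG g by (simp add: m_assoc)
          then have "k <#\<^bsub>G\<^esub> x = (k \<otimes> inv g) <#\<^bsub>G\<^esub> (g <#\<^bsub>G\<^esub> x)" using coset_act(3)[OF x, of "k \<otimes> inv g" g] kG g by simp
          then show "cmod ((\<lambda>x\<in>S. f (k <#\<^bsub>G\<^esub> x)) x - ?h x) \<le> e/2"
            using U(3)[OF _ coset_act(1)[OF x g], of "k \<otimes> inv g"] k x by simp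
        qed
        moreover have "cmod (\<nu> ?h - \<omega> ?h) < e/2" using n by (simp add: dist_norm norm_minus_commute)
        ultimately have "cmod ((\<nu> (\<lambda>x\<in>S. f (k <#\<^bsub>G\<^esub> x)) - \<nu> ?h) + (\<nu> ?h - \<omega> ?h)) < e"
          using norm_triangle_ineq[of "\<nu> (\<lambda>x\<in>S. f (k <#\<^bsub>G\<^esub> x)) - \<nu> ?h" "\<nu> ?h - \<omega> ?h"] by linarith
        then show ?thesis
          unfolding act_apply[OF ns f] act_apply[OF w f] by (simp add: dist_norm norm_minus_commute)
      qed
      then show "\<exists>W. openin (prod_topology T SaH) W \<and> p \<in> W \<and>
          (\<forall>q\<in>W. act (fst q) (snd q) f \<in> Met_TC.mball (act (fst p) (snd p) f) e)"
        using U' V U(2) g w e pe by (intro exI[of _ "?U \<times> ?V"]) (auto simp: openin_prod_Times_iff)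
    qed
    then show "continuous_map (prod_topology T SaH) euclidean (\<lambda>p. act (fst p) (snd p) f)"
      by (simp add: mtopology_is_euclidean)
  qed
  then show ?thesis by (simp add: case_prod_unfold)
qed

theorem flow_Sa: "flow G T SaH act"
proof (rule flowI)
  show "group G" by (rule is_group)
  show "topspace SaH \<noteq> {}" using eval_in[OF base_in] by blast
  show "act g \<in> extensional (topspace SaH)" for g by (simp add: Sa_action_def)
  show "act g \<omega> \<in> topspace SaH" if "g \<in> carrier G" "\<omega> \<in> topspace SaH" for g \<omega> using act_in that by blast
  show "act \<one> \<omega> = \<omega>" if w: "\<omega> \<in> topspace SaH" for \<omega>
  proof (rule extensionalityI[OF char_extensional[OF act_in[OF w one_closed]] char_extensional[OF w]])
    fix f assume f: "f \<in> R"
    have "(\<lambda>x\<in>S. f (\<one> <#\<^bsub>G\<^esub> x)) = restrict f S" by (rule restrict_cong_S) (simp add: coset_act(2))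
    then show "act \<one> \<omega> f = \<omega> f" unfolding act_apply[OF w f] using RUC_extensional[OF f] by simp
  qed
  show "act (g \<otimes> h) \<omega> = act g (act h \<omega>)" if gh: "g \<in> carrier G" "h \<in> carrier G" and w: "\<omega> \<in> topspace SaH" for g h \<omega>
  proof (rule extensionalityI[OF char_extensional[OF act_in[OF w]] char_extensional[OF act_in[OF act_in[OF w]]]])
    fix f assume f: "f \<in> R"
    have "(\<lambda>x\<in>S. f ((g \<otimes> h) <#\<^bsub>G\<^esub> x)) = (\<lambda>x\<in>S. (\<lambda>x\<in>S. f (g <#\<^bsub>G\<^esub> x)) (h <#\<^bsub>G\<^esub> x))"
      by (rule restrict_cong_S) (simp add: coset_act gh)
    then show "act (g \<otimes> h) \<omega> f = act g (act h \<omega>) f"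
      unfolding act_apply[OF w f] act_apply[OF act_in[OF w gh(2)] f] act_apply[OF w RUC_translate[OF f gh(1)]] by simp
  qed (use gh in auto)
qed (rule compact_Sa Hausdorff_Sa continuous_act)+

lemma act_eval:
  assumes "g \<in> carrier G" "x \<in> S"
  shows "act g (eval x) = eval (g <#\<^bsub>G\<^esub> x)"
proof (rule extensionalityI[OF char_extensional[OF act_in[OF eval_in]] char_extensional[OF eval_in]])
  fix f assume f: "f \<in> R"
  show "act g (eval x) f = eval (g <#\<^bsub>G\<^esub> x) f"
    unfolding act_apply[OF eval_in[OF assms(2)] f] using f assms RUC_translate[OF f assms(1)] by (simp add: eval_def)
qed (use assms coset_act in auto)

subsection \<open>Real functions\<close>

abbreviation cplx :: "('a set \<Rightarrow> real) \<Rightarrow> 'a set \<Rightarrow> complex" where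
  "cplx u \<equiv> \<lambda>x\<in>S. complex_of_real (u x)"

text \<open>
  The Gelfand transform of a real function.
\<close>

definition hat :: "('a set \<Rightarrow> real) \<Rightarrow> (('a set \<Rightarrow> complex) \<Rightarrow> complex) \<Rightarrow> real" where
  "hat u \<omega> = Re (\<omega> (cplx u))"

lemma real_RUC_I:
  assumes "\<And>x. x \<in> S \<Longrightarrow> \<bar>u x\<bar> \<le> B"
    and "\<And>e. 0 < e \<Longrightarrow> \<exists>U. openin T U \<and> \<one> \<in> U \<and> (\<forall>v\<in>U. \<forall>x\<in>S. \<bar>u (v <#\<^bsub>G\<^esub> x) - u x\<bar> < e)"
  shows "cplx u \<in> R"
  using assms by (intro RUC_I[of _ B]) (simp_all add: norm_of_real flip: of_real_diff)

lemma cont_hat: "cplx u \<in> R \<Longrightarrow> cont SaH (hat u)"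
  unfolding hat_def
  using continuous_map_compose[OF continuous_char, of "cplx u" euclideanreal Re]
  by (simp add: comp_def continuous_intros)

lemma hat_eval: "\<lbrakk>cplx u \<in> R; x \<in> S\<rbrakk> \<Longrightarrow> hat u (eval x) = u x"
  by (simp add: hat_def eval_def)

lemma hat_cong: "(\<And>x. x \<in> S \<Longrightarrow> u x = v x) \<Longrightarrow> hat u = hat v"
  unfolding hat_def[abs_def] by (simp cong: restrict_cong)

text \<open>
  By density, continuous functions on the compactification are determined by their values on \<open>G/H\<close>.
\<close>

lemma cont_eq_of_eval:
  assumes "cont SaH f" "cont SaH h" "\<And>x. x \<in> S \<Longrightarrow> f (eval x) = h (eval x)" "\<omega> \<in> topspace SaH"
  shows "f \<omega> = h \<omega>"
  by (rule forall_in_closure_of_eq[of \<omega> SaH "eval ` S" euclideanreal]) (use assms Sa_dense in auto)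

lemma hat_add:
  assumes "cplx u \<in> R" "cplx v \<in> R" "\<omega> \<in> topspace SaH"
  shows "hat (\<lambda>x. u x + v x) \<omega> = hat u \<omega> + hat v \<omega>"
  using char_add[OF assms(3,1,2)] by (simp add: hat_def cong: restrict_cong)

lemma hat_scale:
  assumes "cplx u \<in> R" "\<omega> \<in> topspace SaH"
  shows "hat (\<lambda>x. c * u x) \<omega> = c * hat u \<omega>"
  using char_scale[OF assms(2,1), of "complex_of_real c"] by (simp add: hat_def cong: restrict_cong)

lemma hat_const: "\<omega> \<in> topspace SaH \<Longrightarrow> hat (\<lambda>_. c) \<omega> = c"
  by (simp add: hat_def char_const)

lemma hat_nonneg:
  assumes "cplx u \<in> R" "\<omega> \<in> topspace SaH" "\<And>x. x \<in> S \<Longrightarrow> 0 \<le> u x"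
  shows "0 \<le> hat u \<omega>"
proof -
  have "\<omega> (cplx u) \<in> {z. 0 \<le> Re z}"
    using assms by (intro char_closed_condition[OF assms(2,1)] closed_Collect_le continuous_intros) auto
  then show ?thesis by (simp add: hat_def)
qed

lemma hat_act:
  assumes "cplx u \<in> R" "\<omega> \<in> topspace SaH" "g \<in> carrier G"
  shows "hat u (act g \<omega>) = hat (\<lambda>x. u (g <#\<^bsub>G\<^esub> x)) \<omega>"
  unfolding hat_def act_apply[OF assms(2,1)]
  using coset_act(1)[OF _ assms(3)] by (simp cong: restrict_cong)

end

section \<open>Amenability of the subgroup implies projectivity\<close>

lemma topological_group_subgroup:
  assumes TG: "topological_group G T" and H: "subgroup H G"
  shows "topological_group (G\<lparr>carrier := H\<rparr>) (subtopology T H)"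
proof -
  interpret topological_group G T by fact
  have HG: "H \<subseteq> carrier G" by (rule subgroup.subset[OF H])
  have g: "group (G\<lparr>carrier := H\<rparr>)" using subgroup.subgroup_is_group[OF H is_group] .
  have top: "topspace (subtopology T H) = H" by (rule topspace_subtopology_subset) (simp add: topspace_eq HG)
  show ?thesis
  proof (rule topological_group.intro[OF g], unfold_locales)
    show "topspace (subtopology T H) = carrier (G\<lparr>carrier := H\<rparr>)" unfolding top by simp
    show "Hausdorff_space (subtopology T H)" by (rule Hausdorff_space_subtopology[OF Hausdorff])
    have "continuous_map (prod_topology (subtopology T H) (subtopology T H)) (prod_topology T T) (\<lambda>p. (fst p, snd p))"
      by (intro continuous_map_pairedI continuous_map_into_fulltopology[OF continuous_map_fst]
          continuous_map_into_fulltopology[OF continuous_map_snd])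
    from continuous_map_compose[OF this continuous_mult]
    show "continuous_map (prod_topology (subtopology T H) (subtopology T H)) (subtopology T H)
        (\<lambda>(x, y). x \<otimes>\<^bsub>G\<lparr>carrier := H\<rparr>\<^esub> y)"
      using subgroup.m_closed[OF H] top by (auto simp: continuous_map_in_subtopology comp_def case_prod_unfold)
    have "continuous_map (subtopology T H) T (\<lambda>x. inv\<^bsub>G\<^esub> x)"
      by (rule continuous_map_from_subtopology[OF continuous_inv])
    then have "continuous_map (subtopology T H) T (\<lambda>x. inv\<^bsub>G\<lparr>carrier := H\<rparr>\<^esub> x)"
      by (rule continuous_map_eq) (simp add: top m_inv_consistent[OF H])
    then show "continuous_map (subtopology T H) (subtopology T H) (\<lambda>x. inv\<^bsub>G\<lparr>carrier := H\<rparr>\<^esub> x)"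
      using subgroup.m_inv_closed[OF H] top m_inv_consistent[OF H] by (auto simp: continuous_map_in_subtopology)
  qed
qed

lemma flow_subgroup:
  assumes TG: "topological_group G T" and H: "subgroup H G" and fl: "flow G T X act"
  shows "flow (G\<lparr>carrier := H\<rparr>) (subtopology T H) X act"
proof (rule flowI)
  have HG: "h \<in> H \<Longrightarrow> h \<in> carrier G" for h using subgroup.subset[OF H] by blast
  interpret HH: topological_group "G\<lparr>carrier := H\<rparr>" "subtopology T H"
    by (rule topological_group_subgroup[OF TG H])
  show "group (G\<lparr>carrier := H\<rparr>)" by (rule HH.is_group)
  show "act g \<in> extensional (topspace X)" if "g \<in> carrier (G\<lparr>carrier := H\<rparr>)" for g
    using that flow_extensional[OF fl HG] by simp
  show "act g x \<in> topspace X" if "g \<in> carrier (G\<lparr>carrier := H\<rparr>)" "x \<in> topspace X" for g x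
    using that flow_closed[OF fl HG] by simp
  show "act \<one>\<^bsub>G\<lparr>carrier := H\<rparr>\<^esub> x = x" if "x \<in> topspace X" for x
    using that flow_one[OF fl] by simp
  show "act (g \<otimes>\<^bsub>G\<lparr>carrier := H\<rparr>\<^esub> h) x = act g (act h x)"
    if "g \<in> carrier (G\<lparr>carrier := H\<rparr>)" "h \<in> carrier (G\<lparr>carrier := H\<rparr>)" "x \<in> topspace X" for g h x
    using that flow_mult[OF fl HG HG] by simp
  have "continuous_map (prod_topology (subtopology T H) X) (prod_topology T X) (\<lambda>p. (fst p, snd p))"
    by (intro continuous_map_pairedI continuous_map_into_fulltopology[OF continuous_map_fst] continuous_map_snd)
  from continuous_map_compose[OF this flow_continuous[OF fl]]
  show "continuous_map (prod_topology (subtopology T H) X) X (\<lambda>(g, x). act g x)"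
    by (simp add: comp_def case_prod_unfold)
qed (rule flow_nonempty[OF fl] flow_compact[OF fl] flow_Hausdorff[OF fl])+

lemma affine_flow_subgroup:
  assumes "topological_group G T" "subgroup H G" "affine_flow G T K a"
  shows "affine_flow (G\<lparr>carrier := H\<rparr>) (subtopology T H) K a"
  using flow_subgroup[OF assms(1,2)] assms(3) subgroup.subset[OF assms(2)] by (auto simp: affine_flow_def)

lemma affine_on_compose:
  assumes "affine_on K f" "f ` K \<subseteq> L" "affine_on L a"
  shows "affine_on K (\<lambda>x. a (f x))"
  using assms unfolding affine_on_def by (simp add: image_subset_iff)

context coset_space
begin

lemma coset_fixed: "h \<in> H \<Longrightarrow> h <#\<^bsub>G\<^esub> H = H"
  using coset_join3[OF _ subgroup_H] H_subset by blast

lemma coset_eqE: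
  assumes "k \<in> carrier G" "k' \<in> carrier G" "k <#\<^bsub>G\<^esub> H = k' <#\<^bsub>G\<^esub> H"
  obtains h where "h \<in> H" "k = k' \<otimes> h"
proof -
  have "k \<in> k <#\<^bsub>G\<^esub> H"
    using subgroup.one_closed[OF subgroup_H] assms(1) by (force simp: l_coset_def)
  then show ?thesis using that unfolding assms(3) by (auto simp: l_coset_def)
qed

definition equivariant_map :: "'x topology \<Rightarrow> ('a \<Rightarrow> 'x \<Rightarrow> 'x) \<Rightarrow> ('a set \<Rightarrow> 'x) \<Rightarrow> bool" where
  "equivariant_map X c orb \<longleftrightarrow> (\<forall>x\<in>S. orb x \<in> topspace X) \<and>
     (\<forall>g\<in>carrier G. \<forall>x\<in>S. orb (g <#\<^bsub>G\<^esub> x) = c g (orb x))"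

lemma equivariant_mapD:
  assumes "equivariant_map X c orb" "x \<in> S"
  shows "orb x \<in> topspace X" "g \<in> carrier G \<Longrightarrow> orb (g <#\<^bsub>G\<^esub> x) = c g (orb x)"
  using assms by (simp_all add: equivariant_map_def)

lemma orbit_map_exists:
  assumes fl: "flow G T X c" and q: "q \<in> topspace X" "\<And>h. h \<in> H \<Longrightarrow> c h q = q"
  obtains orb where "\<And>k. k \<in> carrier G \<Longrightarrow> orb (k <#\<^bsub>G\<^esub> H) = c k q" "equivariant_map X c orb"
proof -
  define rep where "rep x = (SOME k. k \<in> carrier G \<and> x = k <#\<^bsub>G\<^esub> H)" for x
  have orb: "c (rep (k <#\<^bsub>G\<^esub> H)) q = c k q" if k: "k \<in> carrier G" for k
  proof -
    have r: "rep (k <#\<^bsub>G\<^esub> H) \<in> carrier G \<and> k <#\<^bsub>G\<^esub> H = rep (k <#\<^bsub>G\<^esub> H) <#\<^bsub>G\<^esub> H"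
      unfolding rep_def by (rule someI[of _ k]) (use k in simp)
    then obtain h where h: "h \<in> H" "rep (k <#\<^bsub>G\<^esub> H) = k \<otimes> h" using coset_eqE[of "rep (k <#\<^bsub>G\<^esub> H)" k] k by metis
    show ?thesis unfolding h(2) using flow_mult[OF fl k _ q(1), of h] q(2)[OF h(1)] h(1) H_subset by auto
  qed
  have "equivariant_map X c (\<lambda>x. c (rep x) q)"
    unfolding equivariant_map_def
  proof (intro conjI ballI)
    show "c (rep x) q \<in> topspace X" if "x \<in> S" for x
      using that orb flow_closed[OF fl _ q(1)] by (elim cosetE) simp
    show "c (rep (g <#\<^bsub>G\<^esub> x)) q = c g (c (rep x) q)" if g: "g \<in> carrier G" and x: "x \<in> S" for g x
    proof -
      obtain k where k: "k \<in> carrier G" "x = k <#\<^bsub>G\<^esub> H" using x by (rule cosetE)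
      show ?thesis
        unfolding k(2) lcos_m_assoc[OF H_subset g k(1)] using orb[OF m_closed[OF g k(1)]] orb[OF k(1)]
          flow_mult[OF fl g k(1) q(1)] by simp
    qed
  qed
  then show ?thesis using that[of "\<lambda>x. c (rep x) q"] orb by blast
qed

lemma RUC_orbit_map:
  assumes fl: "flow G T X c" and orb: "equivariant_map X c orb" and f: "cont X f"
  shows "cplx (\<lambda>x. f (orb x)) \<in> R"
proof -
  obtain B where B: "\<And>x. x \<in> topspace X \<Longrightarrow> \<bar>f x\<bar> \<le> B"
    using cont_bounded[OF flow_compact[OF fl] f] by blast
  show ?thesis
  proof (rule real_RUC_I[of _ B])
    show "\<bar>f (orb x)\<bar> \<le> B" if "x \<in> S" for x using B equivariant_mapD(1)[OF orb that] by blast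
    fix e :: real assume "0 < e"
    then obtain U where U: "openin T U" "\<one> \<in> U"
        "\<And>k x. \<lbrakk>k \<in> U; x \<in> topspace X\<rbrakk> \<Longrightarrow> \<bar>f (c k x) - f (c \<one> x)\<bar> < e"
      using flow_uniform[OF topological_group_axioms fl f one_closed] by blast
    have "\<bar>f (orb (v <#\<^bsub>G\<^esub> x)) - f (orb x)\<bar> < e" if "v \<in> U" "x \<in> S" for v x
      using U(3)[OF that(1) equivariant_mapD(1)[OF orb that(2)]] flow_one[OF fl equivariant_mapD(1)[OF orb that(2)]]
        equivariant_mapD(2)[OF orb that(2) open_subset[OF U(1) that(1)]] by simp
    then show "\<exists>U. openin T U \<and> \<one> \<in> U \<and> (\<forall>v\<in>U. \<forall>x\<in>S. \<bar>f (orb (v <#\<^bsub>G\<^esub> x)) - f (orb x)\<bar> < e)"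
      using U by blast
  qed
qed

text \<open>
  For an equivariant map \<open>orb\<close> from \<open>G/H\<close> to \<open>X\<close> the function \<open>f \<circ> orb\<close> extends to the Samuel compactification.
  Integrating the extension amounts to pushing \<open>\<Lambda>\<close> forward along the map from the compactification to
  \<open>X\<close> that extends \<open>orb\<close>, without constructing that map.
\<close>

definition transfer :: "'x topology \<Rightarrow> ('a set \<Rightarrow> 'x) \<Rightarrow> 'a sa_functional \<Rightarrow> ('x \<Rightarrow> real) \<Rightarrow> real" where
  "transfer X orb \<Lambda> = (\<lambda>f. if f \<in> continuous_functions X then integ SaH \<Lambda> (hat (\<lambda>x. f (orb x))) else 0)"

lemma integ_transfer:
  assumes "equivariant_map X c orb" "cont X f"
  shows "integ X (transfer X orb \<Lambda>) f = integ SaH \<Lambda> (hat (\<lambda>x. f (orb x)))"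
proof -
  have "hat (\<lambda>x. restrict f (topspace X) (orb x)) = hat (\<lambda>x. f (orb x))"
    by (rule hat_cong) (simp add: equivariant_mapD(1)[OF assms(1)])
  then show ?thesis
    unfolding integ_def[of X "transfer X orb \<Lambda>"] unfolding transfer_def using assms(2) by simp
qed

lemma transfer_state:
  assumes fl: "flow G T X c" and orb: "equivariant_map X c orb" and L: "\<Lambda> \<in> states SaH"
  shows "transfer X orb \<Lambda> \<in> states X"
proof -
  note r = RUC_orbit_map[OF fl orb] and I = integ_transfer[OF orb]
  have "\<forall>f. f \<notin> continuous_functions X \<longrightarrow> transfer X orb \<Lambda> f = 0" by (simp add: transfer_def)
  moreover have "integ X (transfer X orb \<Lambda>) (\<lambda>_. 1) = 1"
  proof -
    have "integ SaH \<Lambda> (hat (\<lambda>x. 1)) = integ SaH \<Lambda> (\<lambda>_. 1)" by (rule integ_cong) (rule hat_const)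
    then show ?thesis using I[of "\<lambda>_. 1" \<Lambda>] integ_const[OF L] by simp
  qed
  moreover have "integ X (transfer X orb \<Lambda>) (\<lambda>x. f x + g x) = integ X (transfer X orb \<Lambda>) f + integ X (transfer X orb \<Lambda>) g"
    if f: "cont X f" and g: "cont X g" for f g
  proof -
    have "integ SaH \<Lambda> (hat (\<lambda>x. f (orb x) + g (orb x))) = integ SaH \<Lambda> (\<lambda>\<omega>. hat (\<lambda>x. f (orb x)) \<omega> + hat (\<lambda>x. g (orb x)) \<omega>)"
      by (rule integ_cong) (rule hat_add[OF r[OF f] r[OF g]])
    then show ?thesis
      using I[OF continuous_map_add[OF f g]] I[OF f] I[OF g] integ_add[OF L cont_hat[OF r[OF f]] cont_hat[OF r[OF g]]] by simp
  qed
  moreover have "integ X (transfer X orb \<Lambda>) (\<lambda>x. d * f x) = d * integ X (transfer X orb \<Lambda>) f" if f: "cont X f" for d f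
  proof -
    have "integ SaH \<Lambda> (hat (\<lambda>x. d * f (orb x))) = integ SaH \<Lambda> (\<lambda>\<omega>. d * hat (\<lambda>x. f (orb x)) \<omega>)"
      by (rule integ_cong) (rule hat_scale[OF r[OF f]])
    then show ?thesis
      using I[OF continuous_map_real_mult_left[OF f]] I[OF f] integ_scale[OF L cont_hat[OF r[OF f]]] by simp
  qed
  moreover have "0 \<le> integ X (transfer X orb \<Lambda>) f" if f: "cont X f" and "\<forall>x\<in>topspace X. 0 \<le> f x" for f
    unfolding I[OF f] using that equivariant_mapD(1)[OF orb] by (intro integ_nonneg[OF L cont_hat[OF r[OF f]]] hat_nonneg[OF r[OF f]]) auto
  ultimately show ?thesis unfolding states_def mem_Collect_eq by blast
qed

text \<open>
  The fibre of \<open>\<pi>\<close> over a point fixed by \<open>H\<close> is an affine flow of \<open>H\<close>.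
\<close>

lemma fixed_point_lifts:
  fixes Q :: "'q::locally_convex_space set" and L :: "'l::locally_convex_space set"
  assumes am: "amenable TYPE('a sa_point) (G\<lparr>carrier := H\<rparr>) (subtopology T H)"
    and L: "affine_flow G T L b" and Q: "affine_flow G T Q c" and ext: "affine_extension G Q c L b \<pi>"
    and y: "y \<in> L" "\<And>h. h \<in> H \<Longrightarrow> b h y = y"
  obtains q where "q \<in> Q" "\<pi> q = y" "\<And>h. h \<in> H \<Longrightarrow> c h q = q"
proof -
  let ?H = "G\<lparr>carrier := H\<rparr>" and ?T = "subtopology T H"
  let ?Z = "{q \<in> Q. \<pi> q = y}"
  have \<pi>: "\<pi> ` Q = L" "continuous_on Q \<pi>" "affine_on Q \<pi>"
      "\<And>g x. \<lbrakk>g \<in> carrier G; x \<in> Q\<rbrakk> \<Longrightarrow> \<pi> (c g x) = b g (\<pi> x)"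
    using ext unfolding affine_extension_def affine_gmap_def by blast+
  note TH = topological_group_subgroup[OF topological_group_axioms subgroup_H]
  note QH = affine_flow_subgroup[OF topological_group_axioms subgroup_H Q]
  have "affine_flow ?H ?T ?Z (\<lambda>g. restrict (c g) ?Z)"
  proof (rule affine_subflow[OF TH QH])
    have "continuous_map (top_of_set Q) (top_of_set L) \<pi>" using \<pi>(1,2) by (auto simp: continuous_map_in_subtopology)
    moreover have "closedin (top_of_set L) {y}" using y(1) Hausdorff_top_of_set_lcs[of L] by (simp add: closedin_Hausdorff_sing_eq)
    ultimately show "closedin (top_of_set Q) ?Z" using closedin_continuous_map_preimage[of "top_of_set Q" "top_of_set L" \<pi> "{y}"] by simp
    show "?Z \<noteq> {}" using \<pi>(1) y(1) by auto
    show "convex ?Z"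
    proof (rule convexI)
      fix x x' and u v :: real assume *: "x \<in> ?Z" "x' \<in> ?Z" "0 \<le> u" "0 \<le> v" "u + v = 1"
      have "u *\<^sub>R x + v *\<^sub>R x' \<in> Q" using convexD[OF affine_flowD(1)[OF Q]] * by simp
      moreover have "\<pi> ((1 - v) *\<^sub>R x + v *\<^sub>R x') = (1 - v) *\<^sub>R \<pi> x + v *\<^sub>R \<pi> x'"
        using \<pi>(3)[unfolded affine_on_def, rule_format, of x x' v] * by auto
      moreover have "1 - v = u" using * by simp
      moreover have "u *\<^sub>R y + v *\<^sub>R y = y" using * by (simp flip: scaleR_add_left)
      ultimately show "u *\<^sub>R x + v *\<^sub>R x' \<in> ?Z" using * by simp
    qed
    show "c g x \<in> ?Z" if "g \<in> carrier ?H" "x \<in> ?Z" for g x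
      using that affine_flowD(6)[OF Q] \<pi>(4) y(2) H_subset by auto
  qed
  then obtain q where "q \<in> ?Z" "\<And>g. g \<in> carrier ?H \<Longrightarrow> restrict (c g) ?Z q = q"
    using amenable_imp_affine_fixed_point[OF TH am] by blast
  then show ?thesis by (intro that[of q]) auto
qed

text \<open>
  The point mass at the coset \<open>H\<close> is fixed by \<open>H\<close>. Its image in \<open>L\<close> lifts to a point \<open>q\<close> of \<open>Q\<close> fixed by \<open>H\<close>,
  and \<open>g H \<mapsto> g q\<close> is an equivariant map into \<open>Q\<close>. The required \<open>\<psi>\<close> sends a measure to the barycenter
  of its push-forward under this map. Two points of an affine flow agree when all affine functions
  agree on them, so each property of \<open>\<psi>\<close> becomes an identity of integrals over the compactification;
  for \<open>\<pi> \<circ> \<psi> = \<phi>\<close> both integrands are determined on the dense set \<open>G/H\<close>.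
\<close>

theorem amenable_imp_affine_projective:
  assumes am: "amenable TYPE('a sa_point) (G\<lparr>carrier := H\<rparr>) (subtopology T H)"
  shows "affine_projective TYPE('l::locally_convex_space) TYPE('q::locally_convex_space) G T
          (Prob SaH) (Prob_action SaH act)"
  unfolding affine_projective_def
proof (intro conjI allI impI; (elim conjE)?)
  note TG = topological_group_axioms
  note P = flow_Prob_eq_states[OF flow_Sa]
  let ?a = "Prob_action SaH act"
  show "affine_flow G T (Prob SaH) ?a" by (rule affine_flow_Prob[OF TG flow_Sa])
  fix L :: "'l set" and b and Q :: "'q set" and c \<phi> \<pi>
  assume L: "affine_flow G T L b" and Q: "affine_flow G T Q c"
    and phi: "affine_gmap G (Prob SaH) ?a L b \<phi>" and ext: "affine_extension G Q c L b \<pi>"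
  have \<phi>: "\<phi> ` states SaH \<subseteq> L" "continuous_on (states SaH) \<phi>" "affine_on (states SaH) \<phi>"
      "\<And>g x. \<lbrakk>g \<in> carrier G; x \<in> states SaH\<rbrakk> \<Longrightarrow> \<phi> (?a g x) = b g (\<phi> x)"
    using phi unfolding affine_gmap_def P by blast+
  have \<pi>: "\<pi> ` Q \<subseteq> L" "continuous_on Q \<pi>" "affine_on Q \<pi>"
      "\<And>g x. \<lbrakk>g \<in> carrier G; x \<in> Q\<rbrakk> \<Longrightarrow> \<pi> (c g x) = b g (\<pi> x)"
    using ext unfolding affine_extension_def affine_gmap_def by blast+
  let ?d = "\<lambda>x. dirac SaH (eval x)"
  have d: "?d x \<in> states SaH" if "x \<in> S" for x using dirac_state[OF eval_in[OF that]] .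
  have act_d: "?a g (?d x) = ?d (g <#\<^bsub>G\<^esub> x)" if "g \<in> carrier G" "x \<in> S" for g x
    using push_dirac[OF flow_continuous_act[OF TG flow_Sa that(1)] eval_in[OF that(2)]]
      Prob_action_eq_push[of "?d x" SaH act g] d[OF that(2)] act_eval[OF that] by (simp add: P)
  let ?y = "\<phi> (?d H)"
  have y: "?y \<in> L" using \<phi>(1) d[OF base_in] by blast
  have yH: "b h ?y = ?y" if "h \<in> H" for h
  proof -
    have hG: "h \<in> carrier G" using that H_subset by blast
    have "b h ?y = \<phi> (?a h (?d H))" using \<phi>(4)[OF hG d[OF base_in]] by simp
    then show ?thesis using act_d[OF hG base_in] coset_fixed[OF that] by simp
  qed
  obtain q where q: "q \<in> Q" "\<pi> q = ?y" "\<And>h. h \<in> H \<Longrightarrow> c h q = q"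
    using fixed_point_lifts[OF am L Q ext y yH] by blast
  let ?TQ = "top_of_set Q"
  note flQ = affine_flowD(2)[OF Q]
  have "q \<in> topspace ?TQ" using q(1) by simp
  from orbit_map_exists[OF flQ this q(3)] obtain orb where
    orb: "\<And>k. k \<in> carrier G \<Longrightarrow> orb (k <#\<^bsub>G\<^esub> H) = c k q" "equivariant_map ?TQ c orb" by blast
  define \<psi> where "\<psi> \<Lambda> = (SOME z. barycenter_of Q (transfer ?TQ orb \<Lambda>) z)" for \<Lambda>
  have \<psi>: "barycenter_of Q (transfer ?TQ orb \<Lambda>) (\<psi> \<Lambda>)" if "\<Lambda> \<in> states SaH" for \<Lambda>
    unfolding \<psi>_def
    using barycenter_exists[OF affine_flowD(3,1,4)[OF Q] transfer_state[OF flQ orb(2) that]] by (metis someI_ex)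
  have \<psi>_in: "\<psi> \<Lambda> \<in> Q" if "\<Lambda> \<in> states SaH" for \<Lambda> using \<psi>[OF that] by (simp add: barycenter_of_def)
  have r: "cplx (\<lambda>x. \<alpha> (orb x)) \<in> R" if "continuous_on Q \<alpha>" for \<alpha>
    using RUC_orbit_map[OF flQ orb(2)] that by simp
  have ev: "\<alpha> (\<psi> \<Lambda>) = integ SaH \<Lambda> (hat (\<lambda>x. \<alpha> (orb x)))"
    if "\<Lambda> \<in> states SaH" "continuous_on Q \<alpha>" "affine_on Q \<alpha>" for \<Lambda> \<alpha>
    using barycenterD[OF \<psi>[OF that(1)] that(2,3)] integ_transfer[OF orb(2), of \<alpha> \<Lambda>] that(2) by simp
  have "continuous_map (top_of_set (states SaH)) ?TQ \<psi>"
  proof (rule continuous_map_by_separating[where A = "{\<alpha>. continuous_on Q \<alpha> \<and> affine_on Q \<alpha>}"])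
    show "compact_space ?TQ" by (rule flow_compact[OF flQ])
    show "z = z'" if "\<And>\<alpha>. \<alpha> \<in> {\<alpha> :: 'q \<Rightarrow> real. continuous_on Q \<alpha> \<and> affine_on Q \<alpha>} \<Longrightarrow> \<alpha> z = \<alpha> z'" for z z'
      using that by (intro affine_functions_separate[of Q]) blast
    show "\<psi> \<Lambda> \<in> topspace ?TQ" if "\<Lambda> \<in> topspace (top_of_set (states SaH))" for \<Lambda> using that \<psi>_in by simp
    show "cont (top_of_set (states SaH)) (\<lambda>\<Lambda>. \<alpha> (\<psi> \<Lambda>))" if "\<alpha> \<in> {\<alpha>. continuous_on Q \<alpha> \<and> affine_on Q \<alpha>}" for \<alpha>
    proof -
      have a: "continuous_on Q \<alpha>" "affine_on Q \<alpha>" using that by auto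
      show ?thesis
        by (rule continuous_map_eq[OF cont_integ[OF cont_hat[OF r[OF a(1)]], of "states SaH"]]) (simp add: ev[OF _ a])
    qed
  qed auto
  then have c1: "continuous_on (states SaH) \<psi>" by (simp add: continuous_map_in_subtopology)
  have c2: "affine_on (states SaH) \<psi>"
    unfolding affine_on_def
  proof (intro ballI)
    fix \<Lambda> M and t :: real assume LM: "\<Lambda> \<in> states SaH" "M \<in> states SaH" and t: "t \<in> {0..1}"
    have s: "(1 - t) *\<^sub>R \<Lambda> + t *\<^sub>R M \<in> states SaH" using t by (intro convexD[OF convex_states LM]) auto
    show "\<psi> ((1 - t) *\<^sub>R \<Lambda> + t *\<^sub>R M) = (1 - t) *\<^sub>R \<psi> \<Lambda> + t *\<^sub>R \<psi> M"
    proof (rule affine_functions_separate[of Q])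
      fix \<alpha> :: "'q \<Rightarrow> real" assume a: "continuous_on Q \<alpha>" "affine_on Q \<alpha>"
      show "\<alpha> (\<psi> ((1 - t) *\<^sub>R \<Lambda> + t *\<^sub>R M)) = \<alpha> ((1 - t) *\<^sub>R \<psi> \<Lambda> + t *\<^sub>R \<psi> M)"
        using a(2)[unfolded affine_on_def, rule_format, OF \<psi>_in[OF LM(1)] \<psi>_in[OF LM(2)] t]
        unfolding ev[OF s a] integ_combination by (simp add: ev[OF LM(1) a] ev[OF LM(2) a])
    qed
  qed
  have c3: "\<psi> (?a g \<Lambda>) = c g (\<psi> \<Lambda>)" if g: "g \<in> carrier G" and Lam: "\<Lambda> \<in> states SaH" for g \<Lambda>
  proof (rule affine_functions_separate[of Q])
    fix \<alpha> :: "'q \<Rightarrow> real" assume a: "continuous_on Q \<alpha>" "affine_on Q \<alpha>"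
    have LP: "\<Lambda> \<in> Prob SaH" using Lam by (simp add: P)
    have gL: "?a g \<Lambda> \<in> states SaH" using Prob_action_closed[OF TG flow_Sa g LP] by (simp add: P)
    have cg: "c g ` Q \<subseteq> Q" using affine_flowD(6)[OF Q g] by blast
    have ac: "continuous_on Q (\<lambda>x. \<alpha> (c g x))" using flow_cont_act[OF TG flQ g, of \<alpha>] a(1) by simp
    have aa: "affine_on Q (\<lambda>x. \<alpha> (c g x))" by (rule affine_on_compose[OF affine_flowD(5)[OF Q g] cg a(2)])
    have "\<alpha> (\<psi> (?a g \<Lambda>)) = integ SaH \<Lambda> (\<lambda>\<omega>. hat (\<lambda>x. \<alpha> (orb x)) (act g \<omega>))"
      unfolding ev[OF gL a] by (rule integ_Prob_action[OF TG flow_Sa g LP cont_hat[OF r[OF a(1)]]])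
    also have "\<dots> = integ SaH \<Lambda> (hat (\<lambda>x. \<alpha> (c g (orb x))))"
    proof (rule integ_cong)
      fix \<omega> assume w: "\<omega> \<in> topspace SaH"
      have "hat (\<lambda>x. \<alpha> (orb (g <#\<^bsub>G\<^esub> x))) = hat (\<lambda>x. \<alpha> (c g (orb x)))"
        by (rule hat_cong) (simp add: equivariant_mapD(2)[OF orb(2) _ g])
      then show "hat (\<lambda>x. \<alpha> (orb x)) (act g \<omega>) = hat (\<lambda>x. \<alpha> (c g (orb x))) \<omega>"
        using hat_act[OF r[OF a(1)] w g] by simp
    qed
    also have "\<dots> = \<alpha> (c g (\<psi> \<Lambda>))" using ev[OF Lam ac aa] by simp
    finally show "\<alpha> (\<psi> (?a g \<Lambda>)) = \<alpha> (c g (\<psi> \<Lambda>))" .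
  qed
  have c4: "\<pi> (\<psi> \<Lambda>) = \<phi> \<Lambda>" if Lam: "\<Lambda> \<in> states SaH" for \<Lambda>
  proof (rule affine_functions_separate[of L])
    fix \<alpha> :: "'l \<Rightarrow> real" assume a: "continuous_on L \<alpha>" "affine_on L \<alpha>"
    have pc: "continuous_on Q (\<lambda>x. \<alpha> (\<pi> x))" by (rule continuous_on_compose2[OF a(1) \<pi>(2,1)])
    have pa: "affine_on Q (\<lambda>x. \<alpha> (\<pi> x))" by (rule affine_on_compose[OF \<pi>(3,1) a(2)])
    have fc: "continuous_on (states SaH) (\<lambda>x. \<alpha> (\<phi> x))" by (rule continuous_on_compose2[OF a(1) \<phi>(2,1)])
    have fa: "affine_on (states SaH) (\<lambda>x. \<alpha> (\<phi> x))" by (rule affine_on_compose[OF \<phi>(3,1) a(2)])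
    have bar: "barycenter_of (states SaH) (push SaH (top_of_set (states SaH)) (dirac SaH) \<Lambda>) \<Lambda>"
      using barycenter_states_subset[OF compact_states[OF compact_Sa] convex_states _ dirac_state Lam flow_nonempty[OF flow_Sa]]
      by blast
    have fd: "cont SaH (\<lambda>\<omega>. \<alpha> (\<phi> (dirac SaH \<omega>)))"
      using cont_compose[OF continuous_dirac, of SaH "\<lambda>x. \<alpha> (\<phi> x)"] fc by simp
    have "\<alpha> (\<phi> \<Lambda>) = integ SaH \<Lambda> (\<lambda>\<omega>. \<alpha> (\<phi> (dirac SaH \<omega>)))"
      using barycenterD[OF bar fc fa] integ_push[OF continuous_dirac, of SaH "\<lambda>x. \<alpha> (\<phi> x)" \<Lambda>] fc by simp
    also have "\<dots> = integ SaH \<Lambda> (hat (\<lambda>x. \<alpha> (\<pi> (orb x))))"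
    proof (rule integ_cong, rule cont_eq_of_eval[OF fd cont_hat[OF r[OF pc]]])
      fix x assume x: "x \<in> S"
      then obtain k where k: "k \<in> carrier G" "x = k <#\<^bsub>G\<^esub> H" by (rule cosetE)
      have "\<phi> (?d x) = b k ?y" using \<phi>(4)[OF k(1) d[OF base_in]] act_d[OF k(1) base_in] k(2) by simp
      moreover have "\<pi> (orb x) = b k ?y" using orb(1)[OF k(1)] \<pi>(4)[OF k(1) q(1)] q(2) k(2) by simp
      ultimately show "\<alpha> (\<phi> (dirac SaH (eval x))) = hat (\<lambda>x. \<alpha> (\<pi> (orb x))) (eval x)"
        using hat_eval[OF r[OF pc] x] by simp
    qed
    also have "\<dots> = \<alpha> (\<pi> (\<psi> \<Lambda>))" using ev[OF Lam pc pa] by simp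
    finally show "\<alpha> (\<pi> (\<psi> \<Lambda>)) = \<alpha> (\<phi> \<Lambda>)" by simp
  qed
  show "\<exists>\<psi>. affine_gmap G (Prob SaH) ?a Q c \<psi> \<and> (\<forall>x\<in>Prob SaH. \<pi> (\<psi> x) = \<phi> x)"
    using \<psi>_in c1 c2 c3 c4 unfolding affine_gmap_def P by (intro exI[of _ \<psi>]) auto
qed

end

section \<open>Length functions on topological groups\<close>

context topological_group
begin

lemma open_square_root:
  assumes "openin T V" "\<one> \<in> V"
  obtains W where "openin T W" "\<one> \<in> W" "\<And>a b. \<lbrakk>a \<in> W; b \<in> W\<rbrakk> \<Longrightarrow> a \<otimes> b \<in> V"
proof -
  let ?P = "{p \<in> topspace (prod_topology T T). (\<lambda>(x, y). x \<otimes> y) p \<in> V}"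
  have "openin (prod_topology T T) ?P" by (rule openin_continuous_map_preimage[OF continuous_mult assms(1)])
  moreover have "(\<one>, \<one>) \<in> ?P" using assms by (simp add: topspace_eq)
  ultimately have "\<exists>A B. openin T A \<and> openin T B \<and> \<one> \<in> A \<and> \<one> \<in> B \<and> A \<times> B \<subseteq> ?P"
    unfolding openin_prod_topology_alt by blast
  then obtain A B where AB: "openin T A" "openin T B" "\<one> \<in> A" "\<one> \<in> B" "A \<times> B \<subseteq> ?P" by blast
  show ?thesis
  proof (rule that[of "A \<inter> B"])
    show "a \<otimes> b \<in> V" if "a \<in> A \<inter> B" "b \<in> A \<inter> B" for a b
      using subsetD[OF AB(5), of "(a, b)"] that by auto
  qed (use AB in auto)
qed

lemma open_symmetric_cube_root:
  assumes "openin T V" "\<one> \<in> V"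
  obtains W where "openin T W" "\<one> \<in> W" "\<And>a. a \<in> W \<Longrightarrow> inv a \<in> W"
    "\<And>a b c. \<lbrakk>a \<in> W; b \<in> W; c \<in> W\<rbrakk> \<Longrightarrow> a \<otimes> b \<otimes> c \<in> V"
proof -
  obtain A where A: "openin T A" "\<one> \<in> A" "\<And>a b. \<lbrakk>a \<in> A; b \<in> A\<rbrakk> \<Longrightarrow> a \<otimes> b \<in> V"
    using open_square_root[OF assms] by blast
  obtain B where B: "openin T B" "\<one> \<in> B" "\<And>a b. \<lbrakk>a \<in> B; b \<in> B\<rbrakk> \<Longrightarrow> a \<otimes> b \<in> A"
    using open_square_root[OF A(1,2)] by blast
  let ?C = "A \<inter> B"
  let ?W = "?C \<inter> {x \<in> topspace T. inv x \<in> ?C}"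
  have C: "openin T ?C" using A B by blast
  show ?thesis
  proof (rule that[of ?W])
    show "openin T ?W" by (intro openin_Int C openin_continuous_map_preimage[OF continuous_inv])
    show "\<one> \<in> ?W" using A B by (simp add: topspace_eq)
    show "inv a \<in> ?W" if "a \<in> ?W" for a
      using that open_subset[OF A(1), of a] by (simp add: topspace_eq)
    show "a \<otimes> b \<otimes> c \<in> V" if "a \<in> ?W" "b \<in> ?W" "c \<in> ?W" for a b c
      using A(3)[OF B(3), of a b c] that by blast
  qed
qed

end

text \<open>
  A letter \<open>(u, n)\<close> stands for an element \<open>u\<close> of the \<open>n\<close>-th neighbourhood of a sequence that shrinks to the
  unit; it costs \<open>(1/2) ^ n\<close>.
\<close>

definition word_cost :: "('a \<times> nat) list \<Rightarrow> real" where
  "word_cost xs = (\<Sum>p\<leftarrow>xs. (1/2) ^ snd p)"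

lemma word_cost_simps [simp]:
  "word_cost [] = 0" "word_cost (p # xs) = (1/2) ^ snd p + word_cost xs"
  "word_cost (xs @ ys) = word_cost xs + word_cost ys"
  by (simp_all add: word_cost_def)

lemma word_cost_nonneg: "0 \<le> word_cost xs"
  by (induction xs) auto

lemma word_cost_split:
  assumes "0 \<le> c" "c < word_cost xs"
  obtains ys p zs where "xs = ys @ p # zs" "word_cost ys \<le> c" "c < word_cost ys + (1/2) ^ snd p"
proof -
  have "\<exists>ys p zs. xs = ys @ p # zs \<and> word_cost ys \<le> c \<and> c < word_cost ys + (1/2) ^ snd p"
    using assms
  proof (induction xs arbitrary: c)
    case Nil
    then show ?case by simp
  next
    case (Cons x xs)
    show ?case
    proof (cases "c < (1/2) ^ snd x")
      case True
      then show ?thesis using Cons.prems by (intro exI[of _ "[]"]) auto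
    next
      case False
      then obtain ys p zs where *: "xs = ys @ p # zs" "word_cost ys \<le> c - (1/2) ^ snd x"
          "c - (1/2) ^ snd x < word_cost ys + (1/2) ^ snd p"
        using Cons.IH[of "c - (1/2) ^ snd x"] Cons.prems by auto
      then show ?thesis by (intro exI[of _ "x # ys"] exI[of _ p] exI[of _ zs]) auto
    qed
  qed
  then show ?thesis using that by blast
qed

context topological_group
begin

definition word_prod :: "('a \<times> nat) list \<Rightarrow> 'a" where
  "word_prod xs = foldr (\<lambda>p g. fst p \<otimes> g) xs \<one>"

lemma word_prod_simps [simp]:
  "word_prod [] = \<one>" "word_prod (p # xs) = fst p \<otimes> word_prod xs"
  by (simp_all add: word_prod_def)

lemma word_prod_closed: "(\<And>p. p \<in> set xs \<Longrightarrow> fst p \<in> carrier G) \<Longrightarrow> word_prod xs \<in> carrier G"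
  by (induction xs) auto

lemma word_prod_append:
  assumes "\<And>p. p \<in> set xs \<Longrightarrow> fst p \<in> carrier G" "\<And>p. p \<in> set ys \<Longrightarrow> fst p \<in> carrier G"
  shows "word_prod (xs @ ys) = word_prod xs \<otimes> word_prod ys"
  using assms
proof (induction xs)
  case (Cons p xs)
  then show ?case using word_prod_closed[of xs] word_prod_closed[of ys] by (simp add: m_assoc)
qed (simp add: word_prod_closed)

text \<open>
  A length function that is continuous at the unit, normalized to values in \<open>{0..1}\<close>. Smallness at both \<open>u\<close>
  and \<open>inv u\<close> bounds the change of \<open>len\<close> under translation by \<open>u\<close> from both sides.
\<close>

definition length_function :: "('a \<Rightarrow> real) \<Rightarrow> bool" where
  "length_function len \<longleftrightarrow> (\<forall>g\<in>carrier G. 0 \<le> len g \<and> len g \<le> 1) \<and> len \<one> = 0 \<and>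
     (\<forall>g\<in>carrier G. \<forall>h\<in>carrier G. len (g \<otimes> h) \<le> len g + len h) \<and>
     (\<forall>e>0. \<exists>U. openin T U \<and> \<one> \<in> U \<and> (\<forall>u\<in>U. len u < e \<and> len (inv u) < e))"

text \<open>
  The construction of Birkhoff and Kakutani. Choose symmetric neighbourhoods \<open>U n\<close> with
  \<open>U (n+1)\<^sup>3 \<subseteq> U n\<close> and \<open>U (n+1) \<subseteq> W n\<close>, and let \<open>len g\<close> be the least cost of a word with product \<open>g\<close>.
  The point is that a word of cost below \<open>(1/2) ^ n\<close> has its product in \<open>U n\<close>: cut it at the letter where
  half of the cost is passed, so that by induction the two outer parts have products in \<open>U (n+1)\<close>, as
  does the letter itself.
\<close>

theorem length_function_exists:
  assumes W: "\<And>n::nat. openin T (W n)" "\<And>n. \<one> \<in> W n"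
  obtains len where "length_function len" "\<And>g n. \<lbrakk>g \<in> carrier G; len g < (1/2) ^ Suc n\<rbrakk> \<Longrightarrow> g \<in> W n"
proof -
  have "\<exists>U. \<forall>n. (openin T (U n) \<and> \<one> \<in> U n \<and> (\<forall>u\<in>U n. inv u \<in> U n) \<and> (n = 0 \<longrightarrow> U n = carrier G)) \<and>
      ((\<forall>a\<in>U (Suc n). \<forall>b\<in>U (Suc n). \<forall>c\<in>U (Suc n). a \<otimes> b \<otimes> c \<in> U n) \<and> U (Suc n) \<subseteq> W n)"
  proof (rule dependent_nat_choice)
    show "\<exists>V. openin T V \<and> \<one> \<in> V \<and> (\<forall>u\<in>V. inv u \<in> V) \<and> (0 = 0 \<longrightarrow> V = carrier G)"
      using open_carrier by (intro exI[of _ "carrier G"]) auto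
    fix V and n :: nat
    assume V: "openin T V \<and> \<one> \<in> V \<and> (\<forall>u\<in>V. inv u \<in> V) \<and> (n = 0 \<longrightarrow> V = carrier G)"
    have "openin T (V \<inter> W n)" "\<one> \<in> V \<inter> W n" using V W by auto
    then obtain V' where V': "openin T V'" "\<one> \<in> V'" "\<And>a. a \<in> V' \<Longrightarrow> inv a \<in> V'"
        "\<And>a b c. \<lbrakk>a \<in> V'; b \<in> V'; c \<in> V'\<rbrakk> \<Longrightarrow> a \<otimes> b \<otimes> c \<in> V \<inter> W n"
      by (rule open_symmetric_cube_root) blast
    have "v \<in> W n" if "v \<in> V'" for v using V'(4)[OF that V'(2,2)] open_subset[OF V'(1) that] by simp
    then show "\<exists>V'. (openin T V' \<and> \<one> \<in> V' \<and> (\<forall>u\<in>V'. inv u \<in> V') \<and> (Suc n = 0 \<longrightarrow> V' = carrier G)) \<and>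
        ((\<forall>a\<in>V'. \<forall>b\<in>V'. \<forall>c\<in>V'. a \<otimes> b \<otimes> c \<in> V) \<and> V' \<subseteq> W n)"
      using V' by (intro exI[of _ V']) blast
  qed
  then obtain U where U: "\<And>n. openin T (U n)" "\<And>n. \<one> \<in> U n" "\<And>n u. u \<in> U n \<Longrightarrow> inv u \<in> U n"
      "U 0 = carrier G" "\<And>n a b c. \<lbrakk>a \<in> U (Suc n); b \<in> U (Suc n); c \<in> U (Suc n)\<rbrakk> \<Longrightarrow> a \<otimes> b \<otimes> c \<in> U n"
      "\<And>n. U (Suc n) \<subseteq> W n"
    by (elim exE) (metis (no_types, lifting))
  have UG: "u \<in> carrier G" if "u \<in> U n" for u n using open_subset[OF U(1) that] .
  have "U (Suc n) \<subseteq> U n" for n using U(5)[OF _ U(2,2), of _ n] UG by fastforce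
  then have dec: "U n \<subseteq> U m" if "m \<le> n" for m n using lift_Suc_antimono_le[of U] that by blast
  define valid where "valid xs \<longleftrightarrow> (\<forall>p\<in>set xs. fst p \<in> U (snd p))" for xs :: "('a \<times> nat) list"
  have vG: "fst p \<in> carrier G" if "valid xs" "p \<in> set xs" for xs p using that UG by (auto simp: valid_def)
  have key: "word_prod xs \<in> U n" if "valid xs" "word_cost xs < (1/2) ^ n" for xs n
    using that
  proof (induction xs arbitrary: n rule: length_induct)
    case (1 xs)
    show ?case
    proof (cases xs)
      case Nil
      then show ?thesis using U(2) by simp
    next
      case (Cons q qs)
      then have pos: "0 < word_cost xs" using word_cost_nonneg[of qs] by (simp add: add_pos_nonneg)
      then have "0 \<le> word_cost xs / 2" "word_cost xs / 2 < word_cost xs" by simp_all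
      then obtain ys p zs where s: "xs = ys @ p # zs" "word_cost ys \<le> word_cost xs / 2"
          "word_cost xs / 2 < word_cost ys + (1/2) ^ snd p"
        by (rule word_cost_split)
      have v: "valid ys" "valid zs" "fst p \<in> U (snd p)" using 1(2) s(1) by (auto simp: valid_def)
      have c: "word_cost ys < (1/2) ^ Suc n" "word_cost zs < (1/2) ^ Suc n"
        using s 1(3) by simp_all
      have "(1/2) ^ snd p < (1/2 :: real) ^ n"
      proof -
        have "word_cost xs = word_cost ys + ((1/2) ^ snd p + word_cost zs)" by (simp add: s(1))
        then show ?thesis using 1(3) word_cost_nonneg[of ys] word_cost_nonneg[of zs] by linarith
      qed
      then have "n < snd p" by (simp add: power_strict_decreasing_iff)
      then have "fst p \<in> U (Suc n)" using dec[of "Suc n" "snd p"] v(3) by auto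
      moreover have "word_prod ys \<in> U (Suc n)" "word_prod zs \<in> U (Suc n)"
        using 1(1) v c s(1) by auto
      ultimately have "word_prod ys \<otimes> fst p \<otimes> word_prod zs \<in> U n" using U(5) by blast
      moreover have "word_prod xs = word_prod ys \<otimes> (fst p \<otimes> word_prod zs)"
        unfolding s(1) by (subst word_prod_append) (use vG[OF 1(2)] s(1) in auto)
      ultimately show ?thesis
        using word_prod_closed[of ys] word_prod_closed[of zs] vG[OF v(1)] vG[OF v(2)] UG[OF v(3)] by (simp add: m_assoc)
    qed
  qed
  define costs where "costs g = {word_cost xs | xs. valid xs \<and> word_prod xs = g}" for g
  define len where "len g = Inf (costs g)" for g
  have ne: "costs g \<noteq> {}" if "g \<in> carrier G" for g
  proof -
    have "valid [(g, 0)] \<and> word_prod [(g, 0)] = g" using that U(4) by (simp add: valid_def)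
    then show ?thesis unfolding costs_def by blast
  qed
  have bdd: "bdd_below (costs g)" for g
    by (rule bdd_belowI[of _ 0]) (auto simp: costs_def word_cost_nonneg)
  have lower: "len (word_prod xs) \<le> word_cost xs" if "valid xs" for xs
    unfolding len_def using that by (intro cInf_lower bdd) (auto simp: costs_def)
  have small: "len u \<le> (1/2) ^ n" if "u \<in> U n" for u n
    using lower[of "[(u, n)]"] that UG[OF that] by (simp add: valid_def)
  have nonneg: "0 \<le> len g" if "g \<in> carrier G" for g
    unfolding len_def using ne[OF that] by (rule cInf_greatest) (auto simp: costs_def word_cost_nonneg)
  have "length_function len"
    unfolding length_function_def
  proof (intro conjI ballI allI impI)
    show "0 \<le> len g" "len g \<le> 1" if "g \<in> carrier G" for g
      using nonneg[OF that] small[of g 0] that U(4) by simp_all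
    show "len \<one> = 0" using nonneg[OF one_closed] lower[of "[]"] by (simp add: valid_def)
    show "len (g \<otimes> h) \<le> len g + len h" if gh: "g \<in> carrier G" "h \<in> carrier G" for g h
    proof -
      have *: "len (g \<otimes> h) \<le> s + t" if st: "s \<in> costs g" "t \<in> costs h" for s t
      proof -
        obtain xs ys where xy: "valid xs" "word_prod xs = g" "s = word_cost xs" "valid ys" "word_prod ys = h" "t = word_cost ys"
          using st unfolding costs_def by blast
        have "valid (xs @ ys)" using xy by (auto simp: valid_def)
        from lower[OF this] show ?thesis
          using word_prod_append[of xs ys] vG[OF xy(1)] vG[OF xy(4)] xy by simp
      qed
      have "len (g \<otimes> h) - s \<le> len h" if "s \<in> costs g" for s
        unfolding len_def[of h] using ne[OF gh(2)] by (rule cInf_greatest) (use *[OF that] in \<open>simp add: algebra_simps\<close>)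
      then have "len (g \<otimes> h) - len h \<le> len g"
        unfolding len_def[of g] using ne[OF gh(1)] by (intro cInf_greatest) (auto simp: algebra_simps)
      then show ?thesis by simp
    qed
    show "\<exists>V. openin T V \<and> \<one> \<in> V \<and> (\<forall>u\<in>V. len u < e \<and> len (inv u) < e)" if e: "0 < e" for e
    proof -
      obtain n where "(1/2 :: real) ^ n < e" using real_arch_pow_inv[OF e, of "1/2"] by auto
      then show ?thesis
        using U(1,2,3) small order_le_less_trans by (intro exI[of _ "U n"]) blast
    qed
  qed
  then show ?thesis
  proof (rule that)
    show "g \<in> W n" if g: "g \<in> carrier G" "len g < (1/2) ^ Suc n" for g n
    proof -
      obtain s where "s \<in> costs g" "s < (1/2) ^ Suc n"
        using cInf_lessD[OF ne[OF g(1)]] g(2) unfolding len_def by blast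
      then have "g \<in> U (Suc n)" using key unfolding costs_def by auto
      then show ?thesis using U(6) by blast
    qed
  qed
qed

section \<open>Extending uniformly continuous functions\<close>

text \<open>
  Real functions on the group that are uniformly continuous for left translation by small elements.
\<close>

definition ruc :: "('a \<Rightarrow> real) \<Rightarrow> bool" where
  "ruc v \<longleftrightarrow> (\<exists>B. \<forall>g\<in>carrier G. \<bar>v g\<bar> \<le> B) \<and>
     (\<forall>e>0. \<exists>U. openin T U \<and> \<one> \<in> U \<and> (\<forall>u\<in>U. \<forall>g\<in>carrier G. \<bar>v (u \<otimes> g) - v g\<bar> < e))"

lemma rucI:
  assumes "\<And>g. g \<in> carrier G \<Longrightarrow> \<bar>v g\<bar> \<le> B"
    "\<And>e. 0 < e \<Longrightarrow> \<exists>U. openin T U \<and> \<one> \<in> U \<and> (\<forall>u\<in>U. \<forall>g\<in>carrier G. \<bar>v (u \<otimes> g) - v g\<bar> < e)"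
  shows "ruc v"
  using assms unfolding ruc_def by blast

lemma ruc_bounded:
  assumes "ruc v"
  obtains B where "0 < B" "\<And>g. g \<in> carrier G \<Longrightarrow> \<bar>v g\<bar> \<le> B"
proof -
  obtain B where "\<forall>g\<in>carrier G. \<bar>v g\<bar> \<le> B" using assms unfolding ruc_def by blast
  then show ?thesis by (intro that[of "max B 1"]) auto
qed

lemma ruc_uniform:
  assumes "ruc v" "0 < e"
  obtains U where "openin T U" "\<one> \<in> U" "\<And>u g. \<lbrakk>u \<in> U; g \<in> carrier G\<rbrakk> \<Longrightarrow> \<bar>v (u \<otimes> g) - v g\<bar> < e"
proof -
  have "\<forall>e>0. \<exists>U. openin T U \<and> \<one> \<in> U \<and> (\<forall>u\<in>U. \<forall>g\<in>carrier G. \<bar>v (u \<otimes> g) - v g\<bar> < e)"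
    using assms(1) unfolding ruc_def by (elim conjE)
  from this[rule_format, OF assms(2)] show ?thesis using that by blast
qed

lemma ruc_combine:
  assumes v: "ruc v" and w: "ruc w" and k: "0 < k"
    and bound: "\<And>B C. \<exists>D. \<forall>s t. \<bar>s\<bar> \<le> B \<longrightarrow> \<bar>t\<bar> \<le> C \<longrightarrow> \<bar>\<Phi> s t\<bar> \<le> D"
    and lip: "\<And>s t s' t'. \<bar>\<Phi> s t - \<Phi> s' t'\<bar> \<le> k * (\<bar>s - s'\<bar> + \<bar>t - t'\<bar>)"
  shows "ruc (\<lambda>g. \<Phi> (v g) (w g))"
proof -
  obtain B where B: "\<And>g. g \<in> carrier G \<Longrightarrow> \<bar>v g\<bar> \<le> B" using ruc_bounded[OF v] by blast
  obtain C where C: "\<And>g. g \<in> carrier G \<Longrightarrow> \<bar>w g\<bar> \<le> C" using ruc_bounded[OF w] by blast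
  obtain D where D: "\<And>s t. \<lbrakk>\<bar>s\<bar> \<le> B; \<bar>t\<bar> \<le> C\<rbrakk> \<Longrightarrow> \<bar>\<Phi> s t\<bar> \<le> D" using bound[of B C] by blast
  show ?thesis
  proof (rule rucI[of _ D])
    show "\<bar>\<Phi> (v g) (w g)\<bar> \<le> D" if "g \<in> carrier G" for g using D B C that by blast
    fix e :: real assume "0 < e"
    then have e: "0 < e / (2 * k)" using k by simp
    obtain U where U: "openin T U" "\<one> \<in> U" "\<And>u g. \<lbrakk>u \<in> U; g \<in> carrier G\<rbrakk> \<Longrightarrow> \<bar>v (u \<otimes> g) - v g\<bar> < e / (2 * k)"
      using ruc_uniform[OF v e] by blast
    obtain V where V: "openin T V" "\<one> \<in> V" "\<And>u g. \<lbrakk>u \<in> V; g \<in> carrier G\<rbrakk> \<Longrightarrow> \<bar>w (u \<otimes> g) - w g\<bar> < e / (2 * k)"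
      using ruc_uniform[OF w e] by blast
    have "\<bar>\<Phi> (v (u \<otimes> g)) (w (u \<otimes> g)) - \<Phi> (v g) (w g)\<bar> < e" if "u \<in> U \<inter> V" "g \<in> carrier G" for u g
    proof -
      have "\<bar>v (u \<otimes> g) - v g\<bar> + \<bar>w (u \<otimes> g) - w g\<bar> < e / (2 * k) + e / (2 * k)"
        using U(3) V(3) that by (intro add_strict_mono) auto
      then have "k * (\<bar>v (u \<otimes> g) - v g\<bar> + \<bar>w (u \<otimes> g) - w g\<bar>) < e" using k by (simp add: field_simps)
      then show ?thesis using lip[of "v (u \<otimes> g)" "w (u \<otimes> g)" "v g" "w g"] by linarith
    qed
    then show "\<exists>U. openin T U \<and> \<one> \<in> U \<and> (\<forall>u\<in>U. \<forall>g\<in>carrier G. \<bar>\<Phi> (v (u \<otimes> g)) (w (u \<otimes> g)) - \<Phi> (v g) (w g)\<bar> < e)"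
      using U V by (intro exI[of _ "U \<inter> V"]) auto
  qed
qed

lemma ruc_const: "ruc (\<lambda>_. c)"
  by (rule rucI[of _ "\<bar>c\<bar>"]) (use open_carrier in auto)

lemma ruc_add: "\<lbrakk>ruc v; ruc w\<rbrakk> \<Longrightarrow> ruc (\<lambda>g. v g + w g)"
proof (rule ruc_combine[where k = 1 and \<Phi> = "(+)"])
  show "\<exists>D. \<forall>s t. \<bar>s\<bar> \<le> B \<longrightarrow> \<bar>t\<bar> \<le> C \<longrightarrow> \<bar>s + t\<bar> \<le> D" for B C :: real by (rule exI[of _ "B + C"]) auto
qed auto

lemma ruc_scale: "ruc v \<Longrightarrow> ruc (\<lambda>g. c * v g)"
proof (rule ruc_combine[of v v "\<bar>c\<bar> + 1" "\<lambda>s t. c * s"])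
  show "\<exists>D. \<forall>s t. \<bar>s\<bar> \<le> B \<longrightarrow> \<bar>t\<bar> \<le> C \<longrightarrow> \<bar>c * s\<bar> \<le> D" for B C :: real
    by (rule exI[of _ "\<bar>c\<bar> * B"]) (auto simp: abs_mult intro: mult_left_mono)
  show "\<bar>c * s - c * s'\<bar> \<le> (\<bar>c\<bar> + 1) * (\<bar>s - s'\<bar> + \<bar>t - t'\<bar>)" for s t s' t' :: real
  proof -
    have "\<bar>c * s - c * s'\<bar> = \<bar>c\<bar> * \<bar>s - s'\<bar>" by (simp add: abs_mult flip: right_diff_distrib)
    also have "\<dots> \<le> (\<bar>c\<bar> + 1) * (\<bar>s - s'\<bar> + \<bar>t - t'\<bar>)" by (intro mult_mono) auto
    finally show ?thesis .
  qed
qed auto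

lemma ruc_max: "\<lbrakk>ruc v; ruc w\<rbrakk> \<Longrightarrow> ruc (\<lambda>g. max (v g) (w g))"
proof (rule ruc_combine[where k = 1 and \<Phi> = max])
  show "\<exists>D. \<forall>s t. \<bar>s\<bar> \<le> B \<longrightarrow> \<bar>t\<bar> \<le> C \<longrightarrow> \<bar>max s t\<bar> \<le> D" for B C :: real
    by (rule exI[of _ "max B C"]) auto
  show "\<bar>max s t - max s' t'\<bar> \<le> 1 * (\<bar>s - s'\<bar> + \<bar>t - t'\<bar>)" for s t s' t' :: real
    by (auto simp: max_def abs_if)
qed auto

lemma ruc_translate:
  assumes v: "ruc v" and k: "k \<in> carrier G"
  shows "ruc (\<lambda>g. v (k \<otimes> g))"
proof -
  obtain B where B: "\<And>g. g \<in> carrier G \<Longrightarrow> \<bar>v g\<bar> \<le> B" using ruc_bounded[OF v] by blast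
  show ?thesis
  proof (rule rucI[of _ B])
    show "\<bar>v (k \<otimes> g)\<bar> \<le> B" if "g \<in> carrier G" for g using B that k by simp
    fix e :: real assume "0 < e"
    then obtain U where U: "openin T U" "\<one> \<in> U" "\<And>u g. \<lbrakk>u \<in> U; g \<in> carrier G\<rbrakk> \<Longrightarrow> \<bar>v (u \<otimes> g) - v g\<bar> < e"
      using ruc_uniform[OF v] by blast
    obtain V where V: "openin T V" "\<one> \<in> V" "\<And>x. x \<in> V \<Longrightarrow> x \<in> carrier G \<and> k \<otimes> x \<otimes> inv k \<in> U"
      using open_conjugate[OF k U(1,2)] by blast
    have "\<bar>v (k \<otimes> (u \<otimes> g)) - v (k \<otimes> g)\<bar> < e" if "u \<in> V" "g \<in> carrier G" for u g
    proof -
      have u: "u \<in> carrier G" using V(3)[OF that(1)] by blast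
      have "k \<otimes> (u \<otimes> g) = (k \<otimes> u \<otimes> inv k) \<otimes> (k \<otimes> g)"
        using k u that(2) by (simp add: m_assoc inv_solve_left)
      then show ?thesis using U(3)[of "k \<otimes> u \<otimes> inv k" "k \<otimes> g"] V(3)[OF that(1)] k that(2) by simp
    qed
    then show "\<exists>U. openin T U \<and> \<one> \<in> U \<and> (\<forall>u\<in>U. \<forall>g\<in>carrier G. \<bar>v (k \<otimes> (u \<otimes> g)) - v (k \<otimes> g)\<bar> < e)"
      using V by blast
  qed
qed

text \<open>
  The largest function \<open>v\<close> with \<open>v g \<le> a i + K * len (g \<otimes> s i)\<close>. With \<open>a = 0\<close> it is a distance to the set of
  inverses of the \<open>s i\<close>, and in general it is McShane's formula for the extension of a Lipschitz
  function with constant \<open>K\<close> from the set of these inverses.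
\<close>

definition inf_convolution :: "('a \<Rightarrow> real) \<Rightarrow> real \<Rightarrow> 'i set \<Rightarrow> ('i \<Rightarrow> real) \<Rightarrow> ('i \<Rightarrow> 'a) \<Rightarrow> 'a \<Rightarrow> real" where
  "inf_convolution len K I a s g = (INF i\<in>I. a i + K * len (g \<otimes> s i))"

lemma inf_convolution:
  assumes len: "length_function len" and I: "I \<noteq> {}" and a: "\<And>i. i \<in> I \<Longrightarrow> \<bar>a i\<bar> \<le> A"
    and K: "0 \<le> K" and s: "\<And>i. i \<in> I \<Longrightarrow> s i \<in> carrier G"
  shows "\<And>g i. \<lbrakk>g \<in> carrier G; i \<in> I\<rbrakk> \<Longrightarrow> inf_convolution len K I a s g \<le> a i + K * len (g \<otimes> s i)"
    and "\<And>g c. (\<And>i. i \<in> I \<Longrightarrow> c \<le> a i + K * len (g \<otimes> s i)) \<Longrightarrow> c \<le> inf_convolution len K I a s g"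
    and "ruc (inf_convolution len K I a s)"
proof -
  let ?v = "inf_convolution len K I a s"
  have l: "0 \<le> len g" "len g \<le> 1" if "g \<in> carrier G" for g using len that by (auto simp: length_function_def)
  have sub: "len (g \<otimes> h) \<le> len g + len h" if "g \<in> carrier G" "h \<in> carrier G" for g h
    using len that by (auto simp: length_function_def)
  have term_lower: "- A \<le> a i + K * len (g \<otimes> s i)" if "g \<in> carrier G" "i \<in> I" for g i
  proof -
    have "0 \<le> K * len (g \<otimes> s i)" using K l(1) s that by simp
    then show ?thesis using a[OF that(2)] by linarith
  qed
  show lower: "?v g \<le> a i + K * len (g \<otimes> s i)" if "g \<in> carrier G" "i \<in> I" for g i
    unfolding inf_convolution_def
    by (rule cINF_lower[OF bdd_belowI2[of _ "- A"] that(2)]) (rule term_lower[OF that(1)])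
  show greatest: "c \<le> ?v g" if "\<And>i. i \<in> I \<Longrightarrow> c \<le> a i + K * len (g \<otimes> s i)" for g c
    unfolding inf_convolution_def by (rule cINF_greatest[OF I that])
  show "ruc ?v"
  proof (rule rucI[of _ "A + K"])
    fix g assume g: "g \<in> carrier G"
    obtain i where i: "i \<in> I" using I by blast
    have "K * len (g \<otimes> s i) \<le> K * 1" using K l(2) s[OF i] g by (intro mult_left_mono) auto
    then have "?v g \<le> A + K" using lower[OF g i] a[OF i] by linarith
    moreover have "- A \<le> ?v g" using term_lower[OF g] by (rule greatest)
    ultimately show "\<bar>?v g\<bar> \<le> A + K" using K by linarith
  next
    fix e :: real assume "0 < e"
    then have "0 < e / (K + 1)" using K by simp
    then obtain U where U: "openin T U" "\<one> \<in> U" "\<And>u. u \<in> U \<Longrightarrow> len u < e / (K + 1) \<and> len (inv u) < e / (K + 1)"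
      using len unfolding length_function_def by blast
    have small: "K * len u < e" if "u \<in> carrier G" "len u < e / (K + 1)" for u
    proof -
      have "K * len u \<le> (K + 1) * len u" using l(1)[OF that(1)] by (simp add: distrib_right)
      also have "\<dots> < e" using that(2) K by (simp add: field_simps)
      finally show ?thesis .
    qed
    have step: "?v (u \<otimes> g) \<le> ?v g + K * len u" if u: "u \<in> carrier G" and g: "g \<in> carrier G" for u g
    proof -
      have "?v (u \<otimes> g) - K * len u \<le> ?v g"
      proof (rule greatest)
        fix i assume i: "i \<in> I"
        have "len (u \<otimes> g \<otimes> s i) \<le> len u + len (g \<otimes> s i)"
          using sub[of u "g \<otimes> s i"] u g s[OF i] by (simp add: m_assoc)
        then have "K * len (u \<otimes> g \<otimes> s i) \<le> K * len u + K * len (g \<otimes> s i)"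
          using K by (metis distrib_left mult_left_mono)
        then show "?v (u \<otimes> g) - K * len u \<le> a i + K * len (g \<otimes> s i)" using lower[OF m_closed[OF u g] i] by linarith
      qed
      then show ?thesis by simp
    qed
    have "\<bar>?v (u \<otimes> g) - ?v g\<bar> < e" if u: "u \<in> U" and g: "g \<in> carrier G" for u g
    proof -
      have uG: "u \<in> carrier G" using open_subset[OF U(1) u] .
      have "?v (u \<otimes> g) < ?v g + e" using step[OF uG g] small[OF uG] U(3)[OF u] by force
      moreover have "?v g < ?v (u \<otimes> g) + e"
        using step[OF inv_closed[OF uG] m_closed[OF uG g]] small[OF inv_closed[OF uG]] U(3)[OF u] uG g
        by (simp add: m_assoc[symmetric])
      ultimately show ?thesis by linarith
    qed
    then show "\<exists>U. openin T U \<and> \<one> \<in> U \<and> (\<forall>u\<in>U. \<forall>g\<in>carrier G. \<bar>?v (u \<otimes> g) - ?v g\<bar> < e)"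
      using U by blast
  qed
qed

section \<open>Means on the group that are concentrated on a subgroup\<close>

text \<open>
  An \<open>H\<close>-invariant mean on the uniformly continuous functions whose image on \<open>G/H\<close> is the point mass at
  \<open>H\<close>. The last clause expresses the latter, as functions on \<open>G/H\<close> are the right \<open>H\<close>-invariant functions
  on \<open>G\<close>; applied to the constant \<open>1\<close> it also contains the normalization.
\<close>

definition localized_mean :: "'a set \<Rightarrow> (('a \<Rightarrow> real) \<Rightarrow> real) \<Rightarrow> bool" where
  "localized_mean H m \<longleftrightarrow>
     (\<forall>v w. ruc v \<longrightarrow> ruc w \<longrightarrow> m (\<lambda>g. v g + w g) = m v + m w) \<and>
     (\<forall>c v. ruc v \<longrightarrow> m (\<lambda>g. c * v g) = c * m v) \<and>
     (\<forall>v. ruc v \<longrightarrow> (\<forall>g\<in>carrier G. 0 \<le> v g) \<longrightarrow> 0 \<le> m v) \<and>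
     (\<forall>v. ruc v \<longrightarrow> (\<forall>h\<in>H. m (\<lambda>g. v (h \<otimes> g)) = m v)) \<and>
     (\<forall>v. ruc v \<longrightarrow> (\<forall>g\<in>carrier G. \<forall>h\<in>H. v (g \<otimes> h) = v g) \<longrightarrow> m v = v \<one>)"

lemma localized_meanD:
  assumes "localized_mean H m" "ruc v"
  shows "ruc w \<Longrightarrow> m (\<lambda>g. v g + w g) = m v + m w" "m (\<lambda>g. c * v g) = c * m v"
    "(\<And>g. g \<in> carrier G \<Longrightarrow> 0 \<le> v g) \<Longrightarrow> 0 \<le> m v" "h \<in> H \<Longrightarrow> m (\<lambda>g. v (h \<otimes> g)) = m v"
    "(\<And>g h. \<lbrakk>g \<in> carrier G; h \<in> H\<rbrakk> \<Longrightarrow> v (g \<otimes> h) = v g) \<Longrightarrow> m v = v \<one>"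
  using assms unfolding localized_mean_def by blast+

lemma localized_mean_mono:
  assumes m: "localized_mean H m" and v: "ruc v" and w: "ruc w" and le: "\<And>g. g \<in> carrier G \<Longrightarrow> v g \<le> w g"
  shows "m v \<le> m w"
proof -
  have r: "ruc (\<lambda>g. -1 * v g)" by (rule ruc_scale[OF v])
  have "0 \<le> m (\<lambda>g. w g + (-1) * v g)"
    using le by (intro localized_meanD(3)[OF m ruc_add[OF w r]]) auto
  then show ?thesis unfolding localized_meanD(1)[OF m w r] localized_meanD(2)[OF m v] by simp
qed

text \<open>
  A localized mean depends on the restriction to \<open>H\<close> only. The distance \<open>D\<close> to \<open>H\<close> with respect to a length
  function is right \<open>H\<close>-invariant, so its mean is \<open>D \<one> = 0\<close>; and a function that vanishes on \<open>H\<close> is small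
  near \<open>H\<close> by uniform continuity and bounded by a multiple of \<open>D\<close> elsewhere.
\<close>

lemma localized_mean_null:
  assumes H: "subgroup H G" and m: "localized_mean H m" and v: "ruc v" and vH: "\<And>h. h \<in> H \<Longrightarrow> v h = 0"
  shows "m v = 0"
proof -
  have HG: "h \<in> carrier G" if "h \<in> H" for h using that subgroup.subset[OF H] by blast
  obtain B where B: "0 < B" "\<And>g. g \<in> carrier G \<Longrightarrow> \<bar>v g\<bar> \<le> B" using ruc_bounded[OF v] by blast
  have "\<bar>m v\<bar> \<le> e" if e: "0 < e" for e
  proof -
    obtain U where U: "openin T U" "\<one> \<in> U" "\<And>u g. \<lbrakk>u \<in> U; g \<in> carrier G\<rbrakk> \<Longrightarrow> \<bar>v (u \<otimes> g) - v g\<bar> < e"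
      using ruc_uniform[OF v e] by blast
    obtain len where len: "length_function len" "\<And>g n. \<lbrakk>g \<in> carrier G; len g < (1/2) ^ Suc n\<rbrakk> \<Longrightarrow> g \<in> U"
      using length_function_exists[of "\<lambda>_. U"] U(1,2) by blast
    have H0: "H \<noteq> {}" using subgroup.one_closed[OF H] by blast
    define D where "D = inf_convolution len 1 H (\<lambda>_. 0) (\<lambda>h. h)"
    have D: "D g \<le> len (g \<otimes> h)" if "g \<in> carrier G" "h \<in> H" for g h
      using inf_convolution(1)[OF len(1) H0, of "\<lambda>_. 0" 0 1 "\<lambda>h. h" g h] that HG by (simp add: D_def)
    have D_greatest: "c \<le> D g" if "\<And>h. h \<in> H \<Longrightarrow> c \<le> len (g \<otimes> h)" for c g
      unfolding D_def using that HG by (intro inf_convolution(2)[OF len(1) H0, where A = 0]) auto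
    have rD: "ruc D" unfolding D_def using HG by (intro inf_convolution(3)[OF len(1) H0, where A = 0]) auto
    have l0: "0 \<le> len g" if "g \<in> carrier G" for g using len(1) that by (auto simp: length_function_def)
    have D0: "0 \<le> D g" if "g \<in> carrier G" for g using l0 that HG by (intro D_greatest) auto
    have D_le: "D (g \<otimes> h) \<le> D g" if gh: "g \<in> carrier G" "h \<in> H" for g h
    proof (rule D_greatest)
      fix k assume k: "k \<in> H"
      have "D (g \<otimes> h) \<le> len (g \<otimes> h \<otimes> (inv h \<otimes> k))"
        using gh k HG subgroup.m_closed[OF H] subgroup.m_inv_closed[OF H] by (intro D) auto
      moreover have "g \<otimes> h \<otimes> (inv h \<otimes> k) = g \<otimes> k"
        using gh(1) HG[OF gh(2)] HG[OF k] m_assoc[of h "inv h" k, symmetric] by (simp add: m_assoc)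
      ultimately show "D (g \<otimes> h) \<le> len (g \<otimes> k)" by simp
    qed
    have "D (g \<otimes> h) = D g" if gh: "g \<in> carrier G" "h \<in> H" for g h
    proof (rule antisym[OF D_le[OF gh]])
      show "D g \<le> D (g \<otimes> h)"
        using D_le[of "g \<otimes> h" "inv h"] gh HG[OF gh(2)] subgroup.m_inv_closed[OF H gh(2)] by (simp add: m_assoc)
    qed
    then have "m D = D \<one>" by (rule localized_meanD(5)[OF m rD])
    moreover have "D \<one> \<le> 0"
      using D[OF one_closed subgroup.one_closed[OF H]] len(1) by (simp add: length_function_def)
    ultimately have mD: "m D \<le> 0" by simp
    have bound: "\<bar>v g\<bar> \<le> e + (2 * B) * D g" if g: "g \<in> carrier G" for g
    proof (cases "\<exists>h\<in>H. len (g \<otimes> h) < 1/2")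
      case True
      then obtain h where h: "h \<in> H" "len (g \<otimes> h) < 1/2" by blast
      have "g \<otimes> h \<in> U" using len(2)[of "g \<otimes> h" 0] h g HG by simp
      from U(3)[OF this, of "inv h"] have "\<bar>v g - v (inv h)\<bar> < e" using g HG[OF h(1)] by (simp add: m_assoc)
      then have "\<bar>v g\<bar> < e" using vH[OF subgroup.m_inv_closed[OF H h(1)]] by simp
      moreover have "0 \<le> (2 * B) * D g" using D0[OF g] B(1) by simp
      ultimately show ?thesis by linarith
    next
      case False
      then have "1/2 \<le> D g" by (intro D_greatest) auto
      then have "B \<le> (2 * B) * D g" using B(1) by (simp add: field_simps)
      then show ?thesis using B(2)[OF g] e by linarith
    qed
    let ?b = "\<lambda>g. e * 1 + (2 * B) * D g"
    have one: "m (\<lambda>_. 1) = 1" using localized_meanD(5)[OF m ruc_const[of 1]] by simp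
    have rb: "ruc ?b" by (intro ruc_add ruc_scale ruc_const rD)
    have mb: "m ?b \<le> e"
      using localized_meanD(1)[OF m ruc_scale[OF ruc_const[of 1], of e] ruc_scale[OF rD, of "2 * B"]]
        localized_meanD(2)[OF m ruc_const[of 1], of e] localized_meanD(2)[OF m rD, of "2 * B"] one mD B(1)
      by (simp add: mult_nonneg_nonpos)
    have "v g \<le> ?b g \<and> - 1 * v g \<le> ?b g" if "g \<in> carrier G" for g
      using bound[OF that] by (simp add: abs_le_iff)
    then have "m v \<le> m ?b" "m (\<lambda>g. -1 * v g) \<le> m ?b"
      by (intro localized_mean_mono[OF m] v ruc_scale rb; blast)+
    then show ?thesis using mb localized_meanD(2)[OF m v, of "-1"] by linarith
  qed
  then show ?thesis using field_le_epsilon[of "\<bar>m v\<bar>" 0] by simp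
qed

text \<open>
  For a suitable length function the orbit function \<open>h \<mapsto> F (h x)\<close> on \<open>H\<close> is Lipschitz, so McShane's
  formula extends it to a uniformly continuous function on \<open>G\<close>. Here the topology of the subgroup
  enters: the modulus of continuity of the action of \<open>H\<close> is given by neighbourhoods in \<open>G\<close>.
\<close>

lemma ruc_extension:
  assumes H: "subgroup H G" and fl: "flow (G\<lparr>carrier := H\<rparr>) (subtopology T H) X act"
    and x: "x \<in> topspace X" and F: "cont X F"
  obtains v where "ruc v" "\<And>h. h \<in> H \<Longrightarrow> v h = F (act h x)"
proof -
  have HG: "h \<in> carrier G" if "h \<in> H" for h using that subgroup.subset[OF H] by blast
  obtain C where C: "0 < C" "\<And>y. y \<in> topspace X \<Longrightarrow> \<bar>F y\<bar> \<le> C" using cont_bounded[OF flow_compact[OF fl] F] by blast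
  have cl: "act h y \<in> topspace X" if "h \<in> H" "y \<in> topspace X" for h y
    using flow_closed[OF fl _ that(2)] that(1) by simp
  have "\<exists>W. openin T W \<and> \<one> \<in> W \<and> (\<forall>u\<in>W \<inter> H. \<forall>y\<in>topspace X. \<bar>F (act u y) - F y\<bar> < C * (1/2) ^ n)" for n :: nat
  proof -
    have "\<one>\<^bsub>G\<lparr>carrier := H\<rparr>\<^esub> \<in> carrier (G\<lparr>carrier := H\<rparr>)" using subgroup.one_closed[OF H] by simp
    then obtain U where U: "openin (subtopology T H) U" "\<one> \<in> U"
        "\<And>k y. \<lbrakk>k \<in> U; y \<in> topspace X\<rbrakk> \<Longrightarrow> \<bar>F (act k y) - F (act \<one> y)\<bar> < C * (1/2) ^ n"
      using flow_uniform[OF topological_group_subgroup[OF topological_group_axioms H] fl F, of "\<one>" "C * (1/2) ^ n"] C(1)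
      by auto
    obtain W where W: "openin T W" "U = W \<inter> H" using U(1) unfolding openin_subtopology by blast
    show ?thesis using U W flow_one[OF fl] by (intro exI[of _ W]) auto
  qed
  then obtain W where W: "\<And>n. openin T (W n)" "\<And>n. \<one> \<in> W n"
      "\<And>n u y. \<lbrakk>u \<in> W n; u \<in> H; y \<in> topspace X\<rbrakk> \<Longrightarrow> \<bar>F (act u y) - F y\<bar> < C * (1/2) ^ n"
    by (metis IntI)
  obtain len where len: "length_function len" "\<And>g n. \<lbrakk>g \<in> carrier G; len g < (1/2) ^ Suc n\<rbrakk> \<Longrightarrow> g \<in> W n"
    using length_function_exists[of W, OF W(1,2)] by blast
  \<comment> \<open>If \<open>(1/2) ^ (n+2) \<le> len u < (1/2) ^ (n+1)\<close> then \<open>u \<in> W n\<close> and the difference is below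
    \<open>C * (1/2) ^ n \<le> (4 * C) * len u\<close>; if \<open>1/2 \<le> len u\<close> the trivial bound \<open>2 * C\<close> is good enough, and \<open>len u = 0\<close> is a limiting case.\<close>
  have lip: "F (act u y) \<le> F y + (4 * C) * len u" if u: "u \<in> H" and y: "y \<in> topspace X" for u y
  proof (rule field_le_epsilon)
    fix e :: real assume e: "0 < e"
    have l0: "0 \<le> len u" using len(1) HG[OF u] by (auto simp: length_function_def)
    obtain n where n: "(1/2 :: real) ^ n < e / C" using real_arch_pow_inv[of "e / C" "1/2"] e C(1) by auto
    have step: "F (act u y) \<le> F y + (4 * C) * max (len u) ((1/2) ^ Suc k)" for k
    proof (induction k)
      case 0
      have "(4 * C) * (1/2) \<le> (4 * C) * max (len u) (1/2)" using C(1) by (intro mult_left_mono) auto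
      then show ?case using C(2)[OF y] C(2)[OF cl[OF u y]] by simp
    next
      case (Suc k)
      show ?case
      proof (cases "len u < (1/2) ^ Suc k")
        case True
        then have "\<bar>F (act u y) - F y\<bar> < C * (1/2) ^ k" using W(3)[OF len(2) u y] HG[OF u] by blast
        moreover have "(4 * C) * (1/2) ^ Suc (Suc k) \<le> (4 * C) * max (len u) ((1/2) ^ Suc (Suc k))"
          using C(1) by (intro mult_left_mono) auto
        moreover have "(4 * C) * (1/2) ^ Suc (Suc k) = C * (1/2) ^ k" by simp
        ultimately show ?thesis by linarith
      next
        case False
        then have "max (len u) ((1/2) ^ Suc k) \<le> max (len u) ((1/2) ^ Suc (Suc k))" by simp
        then have "(4 * C) * max (len u) ((1/2) ^ Suc k) \<le> (4 * C) * max (len u) ((1/2) ^ Suc (Suc k))"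
          using C(1) by (intro mult_left_mono) auto
        then show ?thesis using Suc.IH by linarith
      qed
    qed
    have "max (len u) ((1/2) ^ Suc (Suc n)) \<le> len u + (1/2) ^ Suc (Suc n)" using l0 by simp
    then have "(4 * C) * max (len u) ((1/2) ^ Suc (Suc n)) \<le> (4 * C) * (len u + (1/2) ^ Suc (Suc n))"
      using C(1) by (intro mult_left_mono) auto
    also have "\<dots> = (4 * C) * len u + C * (1/2) ^ n" by (simp add: algebra_simps)
    also have "C * (1/2) ^ n < e" using n C(1) by (simp add: field_simps)
    finally show "F (act u y) \<le> F y + (4 * C) * len u + e" using step[of "Suc n"] by linarith
  qed
  have H0: "H \<noteq> {}" using subgroup.one_closed[OF H] by blast
  let ?a = "\<lambda>h. F (act h x)" and ?s = "\<lambda>h. inv h"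
  let ?v = "inf_convolution len (4 * C) H ?a ?s"
  have a: "\<bar>?a h\<bar> \<le> C" if "h \<in> H" for h using C(2)[OF cl[OF that x]] .
  have s: "?s h \<in> carrier G" if "h \<in> H" for h using HG[OF that] by simp
  have K: "0 \<le> 4 * C" using C(1) by simp
  show ?thesis
  proof (rule that)
    show "ruc ?v" using a s by (intro inf_convolution(3)[OF len(1) H0 _ K, where A = C]) auto
    fix h assume h: "h \<in> H"
    show "?v h = F (act h x)"
    proof (rule antisym)
      have "?v h \<le> ?a h + (4 * C) * len (h \<otimes> inv h)"
        using a s h HG by (intro inf_convolution(1)[OF len(1) H0 _ K, where A = C]) auto
      then show "?v h \<le> F (act h x)" using len(1) HG[OF h] by (simp add: length_function_def)
      show "F (act h x) \<le> ?v h"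
      proof (rule inf_convolution(2)[OF len(1) H0 _ K, where A = C])
        fix k assume k: "k \<in> H"
        have u: "h \<otimes> inv k \<in> H" using h k subgroup.m_closed[OF H] subgroup.m_inv_closed[OF H] by blast
        have "act (h \<otimes> inv k) (act k x) = act ((h \<otimes> inv k) \<otimes> k) x"
          using flow_mult[OF fl, of "h \<otimes> inv k" k x] u k x by simp
        then have "act (h \<otimes> inv k) (act k x) = act h x" using HG[OF h] HG[OF k] by (simp add: m_assoc)
        then show "F (act h x) \<le> ?a k + (4 * C) * len (h \<otimes> inv k)" using lip[OF u cl[OF k x]] by simp
      qed (use a s in auto)
    qed
  qed
qed

text \<open>
  The integral of \<open>F\<close> is the mean of any extension of its orbit function. Independence of the extension
  makes this linear and invariant; positivity holds because the positive part of an extension of a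
  nonnegative function is again an extension.
\<close>

theorem localized_mean_imp_invariant_state:
  assumes H: "subgroup H G" and m: "localized_mean H m"
    and fl: "flow (G\<lparr>carrier := H\<rparr>) (subtopology T H) X act"
  obtains \<Lambda> where "\<Lambda> \<in> Prob X" "\<And>h. h \<in> H \<Longrightarrow> Prob_action X act h \<Lambda> = \<Lambda>"
proof -
  have HG: "h \<in> carrier G" if "h \<in> H" for h using that subgroup.subset[OF H] by blast
  note P = flow_Prob_eq_states[OF fl] and TH = topological_group_subgroup[OF topological_group_axioms H]
  obtain x where x: "x \<in> topspace X" using flow_nonempty[OF fl] by blast
  let ?ext = "\<lambda>F v. ruc v \<and> (\<forall>h\<in>H. v h = F (act h x))"
  define \<Lambda> where "\<Lambda> F = (if F \<in> continuous_functions X then m (SOME v. ?ext F v) else 0)" for F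
  have cl: "act h x \<in> topspace X" if "h \<in> H" for h using flow_closed[OF fl _ x, of h] that by simp
  have uniq: "m v = m w" if "ruc v" "ruc w" "\<And>h. h \<in> H \<Longrightarrow> v h = w h" for v w
  proof -
    have r: "ruc (\<lambda>g. -1 * w g)" by (rule ruc_scale[OF that(2)])
    have "m (\<lambda>g. v g + (-1) * w g) = 0"
      using that(3) by (intro localized_mean_null[OF H m ruc_add[OF that(1) r]]) simp
    then show ?thesis unfolding localized_meanD(1)[OF m that(1) r] localized_meanD(2)[OF m that(2)] by simp
  qed
  have I: "integ X \<Lambda> F = m v" if F: "cont X F" and v: "ruc v" "\<And>h. h \<in> H \<Longrightarrow> v h = F (act h x)" for F v
  proof -
    let ?F = "restrict F (topspace X)"
    have "?ext ?F v" using v cl by simp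
    then have "?ext ?F (SOME v. ?ext ?F v)" by (rule someI[of "?ext ?F"])
    then have "m (SOME v. ?ext ?F v) = m v" using v cl by (intro uniq) auto
    then show ?thesis using F by (simp add: integ_def \<Lambda>_def)
  qed
  have "\<Lambda> \<in> states X"
    unfolding states_def mem_Collect_eq
  proof (intro conjI allI impI)
    show "\<Lambda> f = 0" if "f \<notin> continuous_functions X" for f using that by (simp add: \<Lambda>_def)
    have "integ X \<Lambda> (\<lambda>_. 1) = m (\<lambda>_. 1)" by (rule I) (auto simp: ruc_const)
    then show "integ X \<Lambda> (\<lambda>_. 1) = 1" using localized_meanD(5)[OF m ruc_const[of 1]] by simp
    fix f assume f: "cont X f"
    obtain v where v: "ruc v" "\<And>h. h \<in> H \<Longrightarrow> v h = f (act h x)" using ruc_extension[OF H fl x f] by blast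
    show "integ X \<Lambda> (\<lambda>x. f x + g x) = integ X \<Lambda> f + integ X \<Lambda> g" if g: "cont X g" for g
    proof -
      obtain w where w: "ruc w" "\<And>h. h \<in> H \<Longrightarrow> w h = g (act h x)" using ruc_extension[OF H fl x g] by blast
      have "integ X \<Lambda> (\<lambda>x. f x + g x) = m (\<lambda>g. v g + w g)"
        by (rule I[OF continuous_map_add[OF f g] ruc_add[OF v(1) w(1)]]) (simp add: v(2) w(2))
      then show ?thesis using I[OF f v] I[OF g w] localized_meanD(1)[OF m v(1) w(1)] by simp
    qed
    show "integ X \<Lambda> (\<lambda>x. c * f x) = c * integ X \<Lambda> f" for c
    proof -
      have "integ X \<Lambda> (\<lambda>x. c * f x) = m (\<lambda>g. c * v g)"
        by (rule I[OF continuous_map_real_mult_left[OF f] ruc_scale[OF v(1)]]) (simp add: v(2))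
      then show ?thesis using I[OF f v] localized_meanD(2)[OF m v(1)] by simp
    qed
    assume f0: "\<forall>x\<in>topspace X. 0 \<le> f x"
    have r: "ruc (\<lambda>g. max (v g) 0)" by (rule ruc_max[OF v(1) ruc_const])
    have "integ X \<Lambda> f = m (\<lambda>g. max (v g) 0)" by (rule I[OF f r]) (simp add: v(2) f0 cl)
    then show "0 \<le> integ X \<Lambda> f" using localized_meanD(3)[OF m r] by simp
  qed
  then have L: "\<Lambda> \<in> Prob X" by (simp add: P)
  have "Prob_action X act h \<Lambda> = \<Lambda>" if h: "h \<in> H" for h
  proof (rule states_eqI[of _ X])
    have hc: "h \<in> carrier (G\<lparr>carrier := H\<rparr>)" using h by simp
    show "Prob_action X act h \<Lambda> \<in> states X" using Prob_action_closed[OF TH fl hc L] by (simp add: P)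
    show "\<Lambda> \<in> states X" using L by (simp add: P)
    fix f assume f: "cont X f"
    obtain v where v: "ruc v" "\<And>h. h \<in> H \<Longrightarrow> v h = f (act h x)" using ruc_extension[OF H fl x f] by blast
    have "integ X \<Lambda> (\<lambda>y. f (act h y)) = m (\<lambda>g. v (h \<otimes> g))"
    proof (rule I[OF flow_cont_act[OF TH fl hc f] ruc_translate[OF v(1) HG[OF h]]])
      fix k assume k: "k \<in> H"
      then show "v (h \<otimes> k) = f (act h (act k x))"
        using v(2)[OF subgroup.m_closed[OF H h k]] flow_mult[OF fl hc, of k x] x by simp
    qed
    then show "integ X (Prob_action X act h \<Lambda>) f = integ X \<Lambda> f"
      using integ_Prob_action[OF TH fl hc L f] I[OF f v] localized_meanD(4)[OF m v(1) h] by simp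
  qed
  then show ?thesis using that L by blast
qed

end

section \<open>Projectivity implies amenability of the subgroup\<close>

context coset_space
begin

sublocale C1: coset_space G T "{\<one>}"
  by (intro coset_space.intro topological_group_axioms coset_space_axioms.intro triv_subgroup)

lemma singleton_coset: "g \<in> carrier G \<Longrightarrow> g <#\<^bsub>G\<^esub> {\<one>} = {g}"
  by (simp add: l_coset_def)

lemma singletons: "C1.S = (\<lambda>g. {g}) ` carrier G"
  by (auto simp: LCOSETS_def singleton_coset)

lemma singleton_act: "\<lbrakk>u \<in> carrier G; g \<in> carrier G\<rbrakk> \<Longrightarrow> u <#\<^bsub>G\<^esub> {g} = {u \<otimes> g}"
  by (simp add: l_coset_def)

text \<open>
  The cosets of the trivial subgroup are the singletons, which serve as the points of \<open>G\<close>.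
\<close>

definition quot :: "'a set \<Rightarrow> 'a set" where
  "quot x = the_elem x <#\<^bsub>G\<^esub> H"

lemma quot_in: "x \<in> C1.S \<Longrightarrow> quot x \<in> S"
  by (auto simp: singletons quot_def coset_in)

lemma quot_act:
  assumes "x \<in> C1.S" "u \<in> carrier G"
  shows "quot (u <#\<^bsub>G\<^esub> x) = u <#\<^bsub>G\<^esub> quot x"
  using assms lcos_m_assoc[OF H_subset] by (auto simp: singletons quot_def singleton_act)

lemma RUC_quot:
  assumes f: "f \<in> R"
  shows "(\<lambda>x\<in>C1.S. f (quot x)) \<in> C1.R"
proof -
  obtain B where B: "\<And>x. x \<in> S \<Longrightarrow> cmod (f x) \<le> B" using RUC_bounded[OF f] by blast
  show ?thesis
  proof (rule C1.RUC_I[of _ B])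
    show "cmod (f (quot x)) \<le> B" if "x \<in> C1.S" for x using B quot_in[OF that] by blast
    fix e :: real assume "0 < e"
    then obtain U where U: "openin T U" "\<one> \<in> U" "\<And>u x. \<lbrakk>u \<in> U; x \<in> S\<rbrakk> \<Longrightarrow> cmod (f (u <#\<^bsub>G\<^esub> x) - f x) < e"
      using RUC_uniform[OF f] by blast
    have "cmod (f (quot (u <#\<^bsub>G\<^esub> x)) - f (quot x)) < e" if "u \<in> U" "x \<in> C1.S" for u x
      unfolding quot_act[OF that(2) open_subset[OF U(1) that(1)]] by (rule U(3)[OF that(1) quot_in[OF that(2)]])
    then show "\<exists>U. openin T U \<and> \<one> \<in> U \<and> (\<forall>u\<in>U. \<forall>x\<in>C1.S. cmod (f (quot (u <#\<^bsub>G\<^esub> x)) - f (quot x)) < e)"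
      using U by blast
  qed
qed

text \<open>
  The map \<open>Sa(G) \<rightarrow> Sa(G/H)\<close> induced by \<open>G \<rightarrow> G/H\<close>.
\<close>

definition proj :: "'a sa_point \<Rightarrow> 'a sa_point" where
  "proj \<omega> = (\<lambda>f\<in>R. \<omega> (\<lambda>x\<in>C1.S. f (quot x)))"

lemma proj_apply: "f \<in> R \<Longrightarrow> proj \<omega> f = \<omega> (\<lambda>x\<in>C1.S. f (quot x))"
  by (simp add: proj_def)

lemma proj_in:
  assumes w: "\<omega> \<in> topspace C1.SaH"
  shows "proj \<omega> \<in> topspace SaH"
proof -
  have t: "(\<lambda>x\<in>C1.S. restrict f S (quot x)) = (\<lambda>x\<in>C1.S. f (quot x))" for f :: "'a set \<Rightarrow> complex"
    by (rule restrict_ext) (simp add: quot_in)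
  have "proj \<omega> \<in> extensional R" by (simp add: proj_def)
  moreover have "proj \<omega> (\<lambda>x\<in>S. 1) = 1" unfolding proj_apply[OF RUC_const] t C1.char_one[OF w] ..
  moreover have "proj \<omega> (\<lambda>x\<in>S. c * f x) = c * proj \<omega> f" if f: "f \<in> R" for c f
  proof -
    have "(\<lambda>x\<in>C1.S. c * f (quot x)) = (\<lambda>x\<in>C1.S. c * (\<lambda>x\<in>C1.S. f (quot x)) x)" by (rule restrict_ext) simp
    then show ?thesis
      unfolding proj_apply[OF RUC_scale[OF f]] t proj_apply[OF f] using C1.char_scale[OF w RUC_quot[OF f]] by simp
  qed
  moreover have "proj \<omega> (\<lambda>x\<in>S. f x + h x) = proj \<omega> f + proj \<omega> h" if f: "f \<in> R" "h \<in> R" for f h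
  proof -
    have "(\<lambda>x\<in>C1.S. f (quot x) + h (quot x)) = (\<lambda>x\<in>C1.S. (\<lambda>x\<in>C1.S. f (quot x)) x + (\<lambda>x\<in>C1.S. h (quot x)) x)"
      by (rule restrict_ext) simp
    then show ?thesis
      unfolding proj_apply[OF RUC_add[OF f]] t proj_apply[OF f(1)] proj_apply[OF f(2)]
      using C1.char_add[OF w RUC_quot[OF f(1)] RUC_quot[OF f(2)]] by simp
  qed
  moreover have "proj \<omega> (\<lambda>x\<in>S. f x * h x) = proj \<omega> f * proj \<omega> h" if f: "f \<in> R" "h \<in> R" for f h
  proof -
    have "(\<lambda>x\<in>C1.S. f (quot x) * h (quot x)) = (\<lambda>x\<in>C1.S. (\<lambda>x\<in>C1.S. f (quot x)) x * (\<lambda>x\<in>C1.S. h (quot x)) x)"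
      by (rule restrict_ext) simp
    then show ?thesis
      unfolding proj_apply[OF RUC_mult[OF f]] t proj_apply[OF f(1)] proj_apply[OF f(2)]
      using C1.char_mult[OF w RUC_quot[OF f(1)] RUC_quot[OF f(2)]] by simp
  qed
  ultimately show ?thesis unfolding Sa_iff by blast
qed

lemma continuous_proj: "continuous_map C1.SaH SaH proj"
proof (rule continuous_map_into_Sa)
  fix f assume f: "f \<in> R"
  show "continuous_map C1.SaH euclidean (\<lambda>z. proj z f)"
    unfolding proj_apply[OF f] by (rule C1.continuous_char[OF RUC_quot[OF f]])
qed (rule proj_in)

lemma proj_act:
  assumes w: "\<omega> \<in> topspace C1.SaH" and g: "g \<in> carrier G"
  shows "proj (C1.act g \<omega>) = act g (proj \<omega>)"
proof (rule extensionalityI[OF char_extensional[OF proj_in[OF C1.act_in[OF w g]]] char_extensional[OF act_in[OF proj_in[OF w] g]]])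
  fix f assume f: "f \<in> R"
  have "(\<lambda>x\<in>C1.S. (\<lambda>x\<in>C1.S. f (quot x)) (g <#\<^bsub>G\<^esub> x)) = (\<lambda>x\<in>C1.S. (\<lambda>x\<in>S. f (g <#\<^bsub>G\<^esub> x)) (quot x))"
    by (rule restrict_ext) (simp add: C1.coset_act(1)[OF _ g] quot_in quot_act[OF _ g])
  then show "proj (C1.act g \<omega>) f = act g (proj \<omega>) f"
    unfolding proj_apply[OF f] C1.act_apply[OF w RUC_quot[OF f]] act_apply[OF proj_in[OF w] f]
      proj_apply[OF RUC_translate[OF f g]] by simp
qed

lemma proj_eval:
  assumes g: "g \<in> carrier G"
  shows "proj (C1.eval {g}) = eval (g <#\<^bsub>G\<^esub> H)"
proof -
  have g1: "{g} \<in> C1.S" using g by (simp add: singletons)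
  show ?thesis
  proof (rule extensionalityI[OF char_extensional[OF proj_in[OF C1.eval_in[OF g1]]] char_extensional[OF eval_in[OF coset_in[OF g]]]])
    fix f assume f: "f \<in> R"
    then show "proj (C1.eval {g}) f = eval (g <#\<^bsub>G\<^esub> H) f"
      unfolding proj_apply[OF f] C1.eval_def eval_def using RUC_quot[OF f] g1 by (simp add: quot_def)
  qed
qed

text \<open>
  The image is compact and contains the dense set \<open>G/H\<close>.
\<close>

lemma proj_surj: "proj ` topspace C1.SaH = topspace SaH"
proof
  show "proj ` topspace C1.SaH \<subseteq> topspace SaH" using proj_in by blast
  have "compactin SaH (proj ` topspace C1.SaH)"
    using image_compactin[OF _ continuous_proj] C1.compact_Sa by (simp add: compact_space_def)
  then have "closedin SaH (proj ` topspace C1.SaH)" by (rule compactin_imp_closedin[OF Hausdorff_Sa])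
  moreover have "eval ` S \<subseteq> proj ` topspace C1.SaH"
  proof
    fix w assume "w \<in> eval ` S"
    then obtain x where "x \<in> S" "w = eval x" by blast
    then obtain g where g: "g \<in> carrier G" "w = eval (g <#\<^bsub>G\<^esub> H)" by (auto elim: cosetE)
    have "C1.eval {g} \<in> topspace C1.SaH" using g(1) by (intro C1.eval_in) (simp add: singletons)
    then show "w \<in> proj ` topspace C1.SaH" using proj_eval[OF g(1)] g(2) by (metis image_eqI)
  qed
  ultimately show "topspace SaH \<subseteq> proj ` topspace C1.SaH"
    using Sa_dense closure_of_minimal[of "eval ` S" "proj ` topspace C1.SaH" SaH] by blast
qed

text \<open>
  Projectivity is applied to the identity of \<open>P(Sa(G/H))\<close> and the affine extension \<open>P(Sa(G)) \<rightarrow> P(Sa(G/H))\<close>.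
  The image of the point mass at \<open>H\<close> under the lift inherits its invariance under \<open>H\<close>.
\<close>

lemma projective_imp_lifted_state:
  assumes proj': "affine_projective TYPE('a sa_functional) TYPE('a sa_functional) G T (Prob SaH) (Prob_action SaH act)"
  obtains \<mu> where "\<mu> \<in> Prob C1.SaH" "push C1.SaH SaH proj \<mu> = dirac SaH (eval H)"
    "\<And>h. h \<in> H \<Longrightarrow> Prob_action C1.SaH C1.act h \<mu> = \<mu>"
proof -
  note TG = topological_group_axioms
  note P = flow_Prob_eq_states[OF flow_Sa] and P1 = flow_Prob_eq_states[OF C1.flow_Sa]
  let ?a = "Prob_action SaH act" and ?a1 = "Prob_action C1.SaH C1.act" and ?\<pi> = "push C1.SaH SaH proj"
  have "continuous_on (states C1.SaH) ?\<pi>"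
    using continuous_push[OF continuous_proj] by (simp add: continuous_map_in_subtopology)
  moreover have \<pi>_onto: "?\<pi> ` states C1.SaH = states SaH"
    by (rule push_surj[OF C1.compact_Sa flow_nonempty[OF flow_Sa] continuous_proj proj_surj])
  moreover have "affine_on (states C1.SaH) ?\<pi>" by (simp add: affine_on_def push_combination)
  moreover have "?\<pi> (?a1 g x) = ?a g (?\<pi> x)" if "g \<in> carrier G" "x \<in> states C1.SaH" for g x
    using that proj_act by (intro push_equivariant[OF TG C1.flow_Sa flow_Sa continuous_proj]) (auto simp: P1)
  ultimately have ext: "affine_extension G (Prob C1.SaH) ?a1 (Prob SaH) ?a ?\<pi>"
    unfolding affine_extension_def affine_gmap_def P P1 by blast
  have idm: "affine_gmap G (Prob SaH) ?a (Prob SaH) ?a (\<lambda>x. x)"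
    by (simp add: affine_gmap_def affine_on_def continuous_on_id)
  have "\<exists>\<psi>. affine_gmap G (Prob SaH) ?a (Prob C1.SaH) ?a1 \<psi> \<and> (\<forall>x\<in>Prob SaH. ?\<pi> (\<psi> x) = x)"
    by (rule proj'[unfolded affine_projective_def, THEN conjunct2, rule_format,
          of "Prob SaH" ?a "Prob C1.SaH" ?a1 "\<lambda>x. x" ?\<pi>])
      (intro conjI affine_flow_Prob[OF TG flow_Sa] affine_flow_Prob[OF TG C1.flow_Sa] idm ext)
  then obtain \<psi> where \<psi>: "affine_gmap G (Prob SaH) ?a (Prob C1.SaH) ?a1 \<psi>" "\<And>x. x \<in> Prob SaH \<Longrightarrow> ?\<pi> (\<psi> x) = x"
    by blast
  let ?d = "dirac SaH (eval H)"
  have d: "?d \<in> Prob SaH" using dirac_state[OF eval_in[OF base_in]] by (simp add: P)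
  show ?thesis
  proof (rule that[of "\<psi> ?d"])
    show "\<psi> ?d \<in> Prob C1.SaH" using \<psi>(1) d unfolding affine_gmap_def by blast
    show "?\<pi> (\<psi> ?d) = ?d" by (rule \<psi>(2)[OF d])
    show "?a1 h (\<psi> ?d) = \<psi> ?d" if h: "h \<in> H" for h
    proof -
      have hG: "h \<in> carrier G" using h H_subset by blast
      have "?a h ?d = dirac SaH (act h (eval H))"
        using push_dirac[OF flow_continuous_act[OF TG flow_Sa hG] eval_in[OF base_in]]
          Prob_action_eq_push[OF d, of act h] by simp
      also have "act h (eval H) = eval H" using act_eval[OF hG base_in] coset_fixed[OF h] by simp
      finally have "?a h ?d = ?d" .
      moreover have "\<psi> (?a h ?d) = ?a1 h (\<psi> ?d)" using \<psi>(1) d hG unfolding affine_gmap_def by blast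
      ultimately show ?thesis by simp
    qed
  qed
qed

definition lift :: "('a \<Rightarrow> real) \<Rightarrow> 'a set \<Rightarrow> real" where
  "lift v x = v (the_elem x)"

lemma lift_RUC:
  assumes v: "ruc v"
  shows "C1.cplx (lift v) \<in> C1.R"
proof -
  obtain B where B: "\<And>g. g \<in> carrier G \<Longrightarrow> \<bar>v g\<bar> \<le> B" using ruc_bounded[OF v] by blast
  show ?thesis
  proof (rule C1.real_RUC_I[of _ B])
    show "\<bar>lift v x\<bar> \<le> B" if "x \<in> C1.S" for x using B that by (auto simp: singletons lift_def)
    fix e :: real assume "0 < e"
    then obtain U where U: "openin T U" "\<one> \<in> U" "\<And>u g. \<lbrakk>u \<in> U; g \<in> carrier G\<rbrakk> \<Longrightarrow> \<bar>v (u \<otimes> g) - v g\<bar> < e"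
      using ruc_uniform[OF v] by blast
    have "\<bar>lift v (u <#\<^bsub>G\<^esub> x) - lift v x\<bar> < e" if u: "u \<in> U" and x: "x \<in> C1.S" for u x
    proof -
      obtain g where g: "g \<in> carrier G" "x = {g}" using x by (auto simp: singletons)
      show ?thesis
        using U(3)[OF u g(1)] singleton_act[OF open_subset[OF U(1) u] g(1)] by (simp add: g(2) lift_def)
    qed
    then show "\<exists>U. openin T U \<and> \<one> \<in> U \<and> (\<forall>u\<in>U. \<forall>x\<in>C1.S. \<bar>lift v (u <#\<^bsub>G\<^esub> x) - lift v x\<bar> < e)"
      using U by blast
  qed
qed

lemma localized_mean_of_state:
  assumes \<mu>: "\<mu> \<in> Prob C1.SaH" and base: "push C1.SaH SaH proj \<mu> = dirac SaH (eval H)"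
    and inv: "\<And>h. h \<in> H \<Longrightarrow> Prob_action C1.SaH C1.act h \<mu> = \<mu>"
  shows "localized_mean H (\<lambda>v. integ C1.SaH \<mu> (C1.hat (lift v)))"
  unfolding localized_mean_def
proof (intro conjI allI impI ballI)
  have s: "\<mu> \<in> states C1.SaH" using \<mu> by (simp add: flow_Prob_eq_states[OF C1.flow_Sa])
  note r = lift_RUC and c = C1.cont_hat[OF lift_RUC]
  fix v assume v: "ruc v"
  show "integ C1.SaH \<mu> (C1.hat (lift (\<lambda>g. v g + w g))) = integ C1.SaH \<mu> (C1.hat (lift v)) + integ C1.SaH \<mu> (C1.hat (lift w))"
    if w: "ruc w" for w
  proof -
    have "lift (\<lambda>g. v g + w g) = (\<lambda>x. lift v x + lift w x)" by (simp add: lift_def fun_eq_iff)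
    then have "integ C1.SaH \<mu> (C1.hat (lift (\<lambda>g. v g + w g))) = integ C1.SaH \<mu> (\<lambda>\<omega>. C1.hat (lift v) \<omega> + C1.hat (lift w) \<omega>)"
      using C1.hat_add[OF r[OF v] r[OF w]] by (intro integ_cong) simp
    then show ?thesis using integ_add[OF s c[OF v] c[OF w]] by simp
  qed
  show "integ C1.SaH \<mu> (C1.hat (lift (\<lambda>g. k * v g))) = k * integ C1.SaH \<mu> (C1.hat (lift v))" for k
  proof -
    have "lift (\<lambda>g. k * v g) = (\<lambda>x. k * lift v x)" by (simp add: lift_def fun_eq_iff)
    then have "integ C1.SaH \<mu> (C1.hat (lift (\<lambda>g. k * v g))) = integ C1.SaH \<mu> (\<lambda>\<omega>. k * C1.hat (lift v) \<omega>)"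
      using C1.hat_scale[OF r[OF v]] by (intro integ_cong) simp
    then show ?thesis using integ_scale[OF s c[OF v]] by simp
  qed
  show "0 \<le> integ C1.SaH \<mu> (C1.hat (lift v))" if "\<forall>g\<in>carrier G. 0 \<le> v g"
    using that by (intro integ_nonneg[OF s c[OF v]] C1.hat_nonneg[OF r[OF v]]) (auto simp: singletons lift_def)
  show "integ C1.SaH \<mu> (C1.hat (lift (\<lambda>g. v (h \<otimes> g)))) = integ C1.SaH \<mu> (C1.hat (lift v))" if h: "h \<in> H" for h
  proof -
    have hG: "h \<in> carrier G" using h H_subset by blast
    have "C1.hat (lift (\<lambda>g. v (h \<otimes> g))) = C1.hat (\<lambda>x. lift v (h <#\<^bsub>G\<^esub> x))"
      by (rule C1.hat_cong) (auto simp: singletons lift_def singleton_act hG)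
    then have "integ C1.SaH \<mu> (C1.hat (lift (\<lambda>g. v (h \<otimes> g)))) = integ C1.SaH \<mu> (\<lambda>\<omega>. C1.hat (lift v) (C1.act h \<omega>))"
      using C1.hat_act[OF r[OF v] _ hG] by (intro integ_cong) simp
    also have "\<dots> = integ C1.SaH (Prob_action C1.SaH C1.act h \<mu>) (C1.hat (lift v))"
      using integ_Prob_action[OF topological_group_axioms C1.flow_Sa hG \<mu> c[OF v]] by simp
    finally show ?thesis unfolding inv[OF h] .
  qed
  show "integ C1.SaH \<mu> (C1.hat (lift v)) = v \<one>" if vH: "\<forall>g\<in>carrier G. \<forall>h\<in>H. v (g \<otimes> h) = v g"
  proof -
    define w where "w x = v (SOME k. k \<in> carrier G \<and> x = k <#\<^bsub>G\<^esub> H)" for x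
    have w: "w (g <#\<^bsub>G\<^esub> H) = v g" if g: "g \<in> carrier G" for g
    proof -
      let ?k = "SOME k. k \<in> carrier G \<and> g <#\<^bsub>G\<^esub> H = k <#\<^bsub>G\<^esub> H"
      have k: "?k \<in> carrier G \<and> g <#\<^bsub>G\<^esub> H = ?k <#\<^bsub>G\<^esub> H" by (rule someI[of _ g]) (use g in simp)
      then obtain h where "h \<in> H" "?k = g \<otimes> h" using coset_eqE[of ?k g] g by metis
      then show ?thesis using vH g by (simp add: w_def)
    qed
    obtain B where B: "\<And>g. g \<in> carrier G \<Longrightarrow> \<bar>v g\<bar> \<le> B" using ruc_bounded[OF v] by blast
    have wR: "cplx w \<in> R"
    proof (rule real_RUC_I[of _ B])
      show "\<bar>w x\<bar> \<le> B" if "x \<in> S" for x using that B w by (elim cosetE) simp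
      fix e :: real assume "0 < e"
      then obtain U where U: "openin T U" "\<one> \<in> U" "\<And>u g. \<lbrakk>u \<in> U; g \<in> carrier G\<rbrakk> \<Longrightarrow> \<bar>v (u \<otimes> g) - v g\<bar> < e"
        using ruc_uniform[OF v] by blast
      have "\<bar>w (u <#\<^bsub>G\<^esub> x) - w x\<bar> < e" if u: "u \<in> U" and x: "x \<in> S" for u x
      proof -
        obtain g where g: "g \<in> carrier G" "x = g <#\<^bsub>G\<^esub> H" using x by (rule cosetE)
        have uG: "u \<in> carrier G" by (rule open_subset[OF U(1) u])
        show ?thesis
          unfolding g(2) lcos_m_assoc[OF H_subset uG g(1)] w[OF g(1)] w[OF m_closed[OF uG g(1)]] by (rule U(3)[OF u g(1)])
      qed
      then show "\<exists>U. openin T U \<and> \<one> \<in> U \<and> (\<forall>u\<in>U. \<forall>x\<in>S. \<bar>w (u <#\<^bsub>G\<^esub> x) - w x\<bar> < e)"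
        using U by blast
    qed
    have "(\<lambda>x\<in>C1.S. cplx w (quot x)) = C1.cplx (lift v)"
      by (rule restrict_ext) (auto simp: quot_in, auto simp: singletons quot_def lift_def w)
    then have "C1.hat (lift v) \<omega> = hat w (proj \<omega>)" for \<omega>
      unfolding hat_def C1.hat_def proj_apply[OF wR] by simp
    then have "integ C1.SaH \<mu> (C1.hat (lift v)) = integ C1.SaH \<mu> (\<lambda>\<omega>. hat w (proj \<omega>))"
      by (rule integ_cong)
    also have "\<dots> = integ SaH (dirac SaH (eval H)) (hat w)"
      using integ_push[OF continuous_proj cont_hat[OF wR], of \<mu>] by (simp add: base)
    also have "\<dots> = w H" using cont_hat[OF wR] eval_in[OF base_in] hat_eval[OF wR base_in] by simp
    also have "\<dots> = v \<one>" using w[OF one_closed] lcos_mult_one[OF H_subset] by simp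
    finally show ?thesis .
  qed
qed

text \<open>
  The lifted state is a localized mean, so every flow of \<open>H\<close> has an invariant measure, and on a strongly
  proximal flow an invariant measure is a fixed point.
\<close>

theorem affine_projective_imp_amenable:
  assumes "affine_projective TYPE('a sa_functional) TYPE('a sa_functional) G T (Prob SaH) (Prob_action SaH act)"
  shows "amenable TYPE('x) (G\<lparr>carrier := H\<rparr>) (subtopology T H)"
  unfolding amenable_def
proof (intro allI impI, elim conjE)
  note TH = topological_group_subgroup[OF topological_group_axioms subgroup_H]
  fix X :: "'x topology" and a
  assume fl: "flow (G\<lparr>carrier := H\<rparr>) (subtopology T H) X a" and sp: "strongly_proximal (G\<lparr>carrier := H\<rparr>) X a"
  obtain \<mu> where \<mu>: "\<mu> \<in> Prob C1.SaH" "push C1.SaH SaH proj \<mu> = dirac SaH (eval H)"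
      "\<And>h. h \<in> H \<Longrightarrow> Prob_action C1.SaH C1.act h \<mu> = \<mu>"
    using projective_imp_lifted_state[OF assms] by blast
  have "localized_mean H (\<lambda>v. integ C1.SaH \<mu> (C1.hat (lift v)))"
    by (rule localized_mean_of_state[OF \<mu>(1,2)]) (rule \<mu>(3))
  then obtain \<Lambda> where L: "\<Lambda> \<in> Prob X" "\<And>h. h \<in> H \<Longrightarrow> Prob_action X a h \<Lambda> = \<Lambda>"
    using localized_mean_imp_invariant_state[OF subgroup_H _ fl] by blast
  obtain x where "x \<in> topspace X" "\<And>h. h \<in> carrier (G\<lparr>carrier := H\<rparr>) \<Longrightarrow> a h x = x"
    using strongly_proximal_fixed_point[OF TH fl sp L(1)] L(2) by auto
  then show "\<exists>x\<in>topspace X. \<forall>g\<in>carrier (G\<lparr>carrier := H\<rparr>). a g x = x" by blast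
qed

end

theorem theorem4p6:
  fixes G :: "('g, 'b) monoid_scheme" and T :: "'g topology" and H :: "'g set"
  assumes "polish_group G T" and "subgroup H G" and "closedin T H"
  shows
    "(amenable TYPE('g sa_point) (G\<lparr>carrier := H\<rparr>) (subtopology T H) \<longleftrightarrow>
        affine_projective TYPE('g sa_functional) TYPE('g sa_functional) G T
          (Prob (Sa G T H)) (Prob_action (Sa G T H) (Sa_action G T H))) \<and>
     (amenable TYPE('g sa_point) (G\<lparr>carrier := H\<rparr>) (subtopology T H) \<longrightarrow>
        amenable TYPE('x) (G\<lparr>carrier := H\<rparr>) (subtopology T H)) \<and>
     (affine_projective TYPE('g sa_functional) TYPE('g sa_functional) G T
          (Prob (Sa G T H)) (Prob_action (Sa G T H) (Sa_action G T H)) \<longrightarrow>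
        affine_projective TYPE('l::locally_convex_space) TYPE('q::locally_convex_space) G T
          (Prob (Sa G T H)) (Prob_action (Sa G T H) (Sa_action G T H)))"
proof -
  interpret polish_group G T by fact
  interpret coset_space G T H
    by (intro coset_space.intro topological_group_axioms coset_space_axioms.intro assms(2))
  note to_projective = amenable_imp_affine_projective and to_amenable = affine_projective_imp_amenable
  show ?thesis
  proof (intro conjI iffI impI)
    assume "amenable TYPE('g sa_point) (G\<lparr>carrier := H\<rparr>) (subtopology T H)"
    then show "affine_projective TYPE('g sa_functional) TYPE('g sa_functional) G T (Prob SaH) (Prob_action SaH act)"
      by (rule to_projective)
    then show "amenable TYPE('x) (G\<lparr>carrier := H\<rparr>) (subtopology T H)"
      by (rule to_amenable)
  next
    assume "affine_projective TYPE('g sa_functional) TYPE('g sa_functional) G T (Prob SaH) (Prob_action SaH act)"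
    then show "amenable TYPE('g sa_point) (G\<lparr>carrier := H\<rparr>) (subtopology T H)"
      by (rule to_amenable)
    then show "affine_projective TYPE('l) TYPE('q) G T (Prob SaH) (Prob_action SaH act)"
      by (rule to_projective)
  qed
qed

end
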